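(* (1) For every prime $p$, the field $\mathbb{F}_p^{alg}$ has good heredity; and these fields are the only algebraically closed fields of good heredity. (2) All global fields, in any characteristic, are rootless, rootless modtor, and of good heredity. (3) Every finitely generated field extension of a field of good heredity is of good heredity.
   Context: Let $F$ be a field with algebraic closure $F^{alg}$. A polynomial $P \in F[x]$ is hereditarily irreducible over $F$ if for every integer $n\ge 1$ the polynomial $P(x^n)$ is irreducible over $F$. A polynomial $P\in F[x]$ has good heredity (over $F$) if for some integer $n \geq 1$ the polynomial $P(x^n)$ factors (up to a nonzero constant) as a product of polynomials in $F[x]$ that are hereditarily irreducible over $F$. The field $F$ has good heredity if every polynomial $P \in F[x]$, none of whose roots in $F^{alg}$ is zero or a root of unity, has good heredity over $F$. An element $a \in F$ that is not a root of unity is rootless (in $F$) if for all but finitely many integers $n\ge 1$ the equation $x^n = a$ has no solution in $F$. An element $a\in F$ that is not a root of unity is rootless modtor (in $F$) if for all but finitely many integers $n\ge 1$, for every root of unity $\zeta \in F$ the equation $x^n=\zeta a$ has no solution in $F$. The field $F$ is rootless (resp. rootless modtor) if every nonzero $f \in F$ that is not a root of unity is rootless (resp. rootless modtor) in $F$. $\mathbb{F}_p^{alg}$ denotes the algebraic closure of the field with $p$ elements. *)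

theory Defs
  imports "HOL-Algebra.Algebraic_Closure_Type"
begin

text \<open>Fields are types of class \<open>field\<close>; a property of the field itself takes an argument of
  type \<open>'a itself\<close>. The algebraic closure of \<open>'a\<close> is the library type \<open>'a alg_closure\<close>, with
  embedding \<open>to_ac\<close>. Qualified names select the type-class notions where HOL-Algebra has
  a homonym.\<close>

section \<open>Heredity\<close>

definition root_of_unity :: "'a::field \<Rightarrow> bool" where
  "root_of_unity x \<longleftrightarrow> (\<exists>n\<ge>1. x ^ n = 1)"

text \<open>\<open>subst_power n P\<close> is the polynomial $P(x^n)$.\<close>

definition subst_power :: "nat \<Rightarrow> 'a::field poly \<Rightarrow> 'a poly" where
  "subst_power n P = Polynomial.pcompose P (Polynomial.monom 1 n)"

definition hereditarily_irreducible :: "'a::field poly \<Rightarrow> bool" where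
  "hereditarily_irreducible P \<longleftrightarrow> (\<forall>n\<ge>1. Factorial_Ring.irreducible (subst_power n P))"

text \<open>The list \<open>Qs\<close> may be empty, so nonzero constant polynomials have good heredity.\<close>

definition poly_good_heredity :: "'a::field poly \<Rightarrow> bool" where
  "poly_good_heredity P \<longleftrightarrow>
     (\<exists>n\<ge>1. \<exists>c Qs. c \<noteq> 0 \<and> subst_power n P = Polynomial.smult c (prod_list Qs) \<and>
        (\<forall>Q\<in>set Qs. hereditarily_irreducible Q))"

text \<open>Every element of \<open>'a alg_closure\<close> is a root of the zero polynomial, so the condition on the
  roots excludes it.\<close>

definition good_heredity :: "'a::field itself \<Rightarrow> bool" where
  "good_heredity _ \<longleftrightarrow>
     (\<forall>P :: 'a poly.
        (\<forall>x :: 'a alg_closure. Polynomial.poly (map_poly to_ac P) x = 0 \<longrightarrow>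
           x \<noteq> 0 \<and> \<not> root_of_unity x)
        \<longrightarrow> poly_good_heredity P)"

section \<open>Rootlessness\<close>

definition rootless_elem :: "'a::field \<Rightarrow> bool" where
  "rootless_elem a \<longleftrightarrow> \<not> root_of_unity a \<and> finite {n. n \<ge> 1 \<and> (\<exists>x. x ^ n = a)}"

definition rootless_modtor_elem :: "'a::field \<Rightarrow> bool" where
  "rootless_modtor_elem a \<longleftrightarrow> \<not> root_of_unity a \<and>
     finite {n. n \<ge> 1 \<and> (\<exists>\<zeta>. root_of_unity \<zeta> \<and> (\<exists>x. x ^ n = \<zeta> * a))}"

definition rootless :: "'a::field itself \<Rightarrow> bool" where
  "rootless _ \<longleftrightarrow> (\<forall>f :: 'a. f \<noteq> 0 \<longrightarrow> \<not> root_of_unity f \<longrightarrow> rootless_elem f)"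

definition rootless_modtor :: "'a::field itself \<Rightarrow> bool" where
  "rootless_modtor _ \<longleftrightarrow> (\<forall>f :: 'a. f \<noteq> 0 \<longrightarrow> \<not> root_of_unity f \<longrightarrow> rootless_modtor_elem f)"

section \<open>Field extensions\<close>

definition field_embedding :: "('a::field \<Rightarrow> 'b::field) \<Rightarrow> bool" where
  "field_embedding h \<longleftrightarrow> h 1 = 1 \<and> (\<forall>x y. h (x + y) = h x + h y) \<and> (\<forall>x y. h (x * y) = h x * h y)"

definition is_subfield :: "'a::field set \<Rightarrow> bool" where
  "is_subfield K \<longleftrightarrow> 0 \<in> K \<and> 1 \<in> K \<and> (\<forall>x\<in>K. - x \<in> K \<and> inverse x \<in> K) \<and>
     (\<forall>x\<in>K. \<forall>y\<in>K. x + y \<in> K \<and> x * y \<in> K)"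

text \<open>\<open>is_subfield hull S\<close> is the subfield generated by \<open>S\<close>. An extension of \<open>'a\<close> is a
  field \<open>'b\<close> with an embedding \<open>h :: 'a \<Rightarrow> 'b\<close>; finitely generated means as a field.\<close>

definition finitely_generated_extension :: "('a::field \<Rightarrow> 'b::field) \<Rightarrow> bool" where
  "finitely_generated_extension h \<longleftrightarrow> field_embedding h \<and>
     (\<exists>S. finite S \<and> is_subfield hull (range h \<union> S) = UNIV)"

definition algebraic_over :: "'a::field set \<Rightarrow> 'a \<Rightarrow> bool" where
  "algebraic_over K x \<longleftrightarrow>
     (\<exists>P. P \<noteq> 0 \<and> (\<forall>i. Polynomial.coeff P i \<in> K) \<and> Polynomial.poly P x = 0)"

text \<open>The whole field is a finite-dimensional vector space over the subfield \<open>K\<close>.\<close>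

definition finite_over :: "'a::field set \<Rightarrow> bool" where
  "finite_over K \<longleftrightarrow>
     (\<exists>B. finite B \<and> (\<forall>x. \<exists>c. (\<forall>b\<in>B. c b \<in> K) \<and> x = (\<Sum>b\<in>B. c b * b)))"

section \<open>The algebraic closure of a prime field and global fields\<close>

text \<open>The algebraically closed field \<open>'a\<close> is an algebraic closure of a field with \<open>p\<close> elements;
  for prime \<open>p\<close> this determines it up to isomorphism.\<close>

definition is_Fp_alg_closure :: "nat \<Rightarrow> 'a::alg_closed_field itself \<Rightarrow> bool" where
  "is_Fp_alg_closure p _ \<longleftrightarrow>
     (\<exists>k :: 'a set. is_subfield k \<and> card k = p \<and> (\<forall>x. algebraic_over k x))"

definition number_field :: "'a::field itself \<Rightarrow> bool" where
  "number_field _ \<longleftrightarrow> (\<exists>h :: rat \<Rightarrow> 'a. field_embedding h \<and> finite_over (range h))"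

text \<open>A finite extension of $\mathbf F_p(t)$ for some prime \<open>p\<close>, with \<open>k\<close> the copy of $\mathbf F_p$ and
  \<open>t\<close> transcendental.\<close>

definition global_function_field :: "'a::field itself \<Rightarrow> bool" where
  "global_function_field _ \<longleftrightarrow>
     (\<exists>(k :: 'a set) t. is_subfield k \<and> prime (card k) \<and> \<not> algebraic_over k t \<and>
        finite_over (is_subfield hull (insert t k)))"

definition global_field :: "'a::field itself \<Rightarrow> bool" where
  "global_field T \<longleftrightarrow> number_field T \<or> global_function_field T"

text \<open>Consistency with the library: the type \<open>'k alg_closure\<close> for a field \<open>'k\<close> with \<open>p\<close> elements, \<open>p\<close> prime,
  is an instance of \<open>is_Fp_alg_closure\<close>.\<close>

lemma is_Fp_alg_closure_alg_closure:
  assumes "prime (card (UNIV :: 'k::field set))"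
  shows "is_Fp_alg_closure (card (UNIV :: 'k set)) TYPE('k alg_closure)"
proof -
  let ?k = "range (to_ac :: 'k \<Rightarrow> 'k alg_closure)"
  have "is_subfield ?k"
    unfolding is_subfield_def
    by (auto simp flip: to_ac_0 to_ac_1 to_ac_minus to_ac_inverse to_ac_add to_ac_mult
             simp del: to_ac_eq_iff)
  moreover have "card ?k = card (UNIV :: 'k set)"
    by (rule card_image) (rule inj_to_ac)
  moreover have "algebraic_over ?k x" for x :: "'k alg_closure"
  proof -
    obtain P :: "'k poly" where P: "P \<noteq> 0" "Polynomial.poly (map_poly to_ac P) x = 0"
      by (rule alg_closure_algebraic)
    have "map_poly to_ac P \<noteq> 0"
      using P(1) by (simp add: map_poly_eq_0_iff)
    then show ?thesis
      unfolding algebraic_over_def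
      by (intro exI[of _ "map_poly to_ac P"]) (simp add: P(2) coeff_map_poly)
  qed
  ultimately show ?thesis
    using assms unfolding is_Fp_alg_closure_def by blast
qed

end

theory Submission
  imports Defs "HOL-Computational_Algebra.Fundamental_Theorem_Algebra"
begin

text \<open>Heredity is a matter of counting factors. If the number of nonconstant factors that a
factorization of $P(x^n)$ can have stays bounded for all $n$ together, take a factorization with
as many factors as possible: each factor $Q$ is hereditarily irreducible, because a proper
factorization of some $Q(x^m)$ would give more factors of $P(x^{nm})$. Conversely, if $P(x^n)$ is
a product of $r$ hereditarily irreducible polynomials, then so is $P(x^{nm})$ for every $m$, and
hence $P(x^m)$, whose factors become factors of $P(x^{nm})$ under $x \mapsto x^n$, has at most $r$ of them.
So a field has good heredity if and only if the factor counts of $P(x^n)$ are bounded for every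
$P$ whose roots are neither zero nor roots of unity. In this form the property makes sense for a
subfield $K$ of an algebraically closed field (\<open>good_heredity_in\<close>), it depends only on the
abstract field (\<open>good_heredity_iff_range\<close>), and irreducibility enters only through minimal
polynomials of elements.

Finitely generated extensions. It is enough to adjoin one element $t$ to $K$. If $t$ is algebraic,
the degree of an element over $K(t)$ is at least its degree over $K$ divided by $[K(t):K]$, so
factor counts grow at most by the factor $[K(t):K]$
(\<open>good_heredity_in_finite_extension\<close>). If $t$ is transcendental, clear denominators in $P$; the
degree in $t$ of the resulting bivariate polynomial is untouched by $x \mapsto x^n$, so it bounds the
number of factors of $P(x^n)$ that involve $t$. The other factors have coefficients in $K$ and
divide $c(x^n)$, where $c \in K[x]$ is the greatest common divisor of the coefficients of the
powers of $t$ (\<open>good_heredity_in_transcendental_extension\<close>).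

The rationals. Let $\beta^n = \alpha$ with $P(\alpha) = 0$, let $K = \mathbf Q(\alpha)$, and let
$e$ be the degree of $\beta$ over $K$. The constant term $c$ of the minimal polynomial of $\beta$ over
$K$ satisfies $c^n = \pm \alpha^e$, and Bezout's identity turns this into a relation
$y^{n/\gcd(e,n)} = \zeta \alpha$ with $y, \zeta \in K$ and $\zeta$ a root of unity. If the exponents in
such relations are at most $C$, then $e \ge n/C$, and $P(x^n)$ has at most $C \deg P$ factors
(\<open>factors_bounded_if_exponents_bounded\<close>). The exponents are bounded by a finiteness argument: if
some power of $y \in K$ is a root of a fixed integer polynomial $f$, then the minimal polynomial of
$y$ over the integers divides some $f(x^N)$, so that its degree, its leading coefficient and its
complex roots are bounded, and only finitely many $y$ are possible
(\<open>finite_int_divisors_of_power_substitutions\<close>).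

Global fields are finitely generated over the rationals or over a finite field. Over a finite field
every algebraic element is zero or a root of unity, so only constant polynomials have to be considered.
Rootlessness follows from good heredity: the $n$ for which $x^n = a$ is solvable are closed under
least common multiples, so if there were infinitely many of them, they would contain long chains
under divisibility, and $x^n - a$ would have arbitrarily many factors
(\<open>rootless_if_good_heredity\<close>). A global field has only finitely many roots of unity, so a common
power removes them, and rootlessness modulo torsion follows.

Over an algebraically closed field $x^n - a$ has $n$ linear factors. Good heredity therefore
forces every element to be zero or a root of unity, that is, algebraic over a finite prime field.\<close>

section \<open>Subfields and polynomials over a subfield\<close>

lemma subfield_0: "is_subfield K \<Longrightarrow> 0 \<in> K"
  and subfield_1: "is_subfield K \<Longrightarrow> 1 \<in> K"
  and subfield_add: "is_subfield K \<Longrightarrow> x \<in> K \<Longrightarrow> y \<in> K \<Longrightarrow> x + y \<in> K"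
  and subfield_mult: "is_subfield K \<Longrightarrow> x \<in> K \<Longrightarrow> y \<in> K \<Longrightarrow> x * y \<in> K"
  and subfield_uminus: "is_subfield K \<Longrightarrow> x \<in> K \<Longrightarrow> - x \<in> K"
  and subfield_inverse: "is_subfield K \<Longrightarrow> x \<in> K \<Longrightarrow> inverse x \<in> K"
  by (auto simp: is_subfield_def)

lemma subfield_diff: "is_subfield K \<Longrightarrow> x \<in> K \<Longrightarrow> y \<in> K \<Longrightarrow> x - y \<in> K"
  using subfield_add[of K x "- y"] subfield_uminus[of K y] by simp

lemma subfield_divide: "is_subfield K \<Longrightarrow> x \<in> K \<Longrightarrow> y \<in> K \<Longrightarrow> x / y \<in> K"
  by (simp add: field_class.field_divide_inverse subfield_mult subfield_inverse)

lemma subfield_sum: "is_subfield K \<Longrightarrow> (\<And>i. i \<in> A \<Longrightarrow> f i \<in> K) \<Longrightarrow> sum f A \<in> K"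
  by (induction A rule: infinite_finite_induct) (auto simp: subfield_0 subfield_add)

lemma subfield_power: "is_subfield K \<Longrightarrow> x \<in> K \<Longrightarrow> x ^ n \<in> K"
  by (induction n) (auto simp: subfield_1 subfield_mult)

lemma subfield_hull: "is_subfield (is_subfield hull S)"
  by (rule hull_in) (unfold is_subfield_def, blast)

definition polys_over :: "'a::field set \<Rightarrow> 'a poly set" where
  "polys_over K = {P. \<forall>i. coeff P i \<in> K}"

lemma polys_overI: "(\<And>i. coeff P i \<in> K) \<Longrightarrow> P \<in> polys_over K"
  and polys_overD: "P \<in> polys_over K \<Longrightarrow> coeff P i \<in> K"
  by (auto simp: polys_over_def)

lemma polys_over_mono: "K \<subseteq> E \<Longrightarrow> polys_over K \<subseteq> polys_over E"
  by (auto simp: polys_over_def)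

context
  fixes K :: "'a::field set"
  assumes K: "is_subfield K"
begin

lemma polys_over_0: "0 \<in> polys_over K"
  and polys_over_1: "1 \<in> polys_over K"
  and polys_over_const_iff: "[:c:] \<in> polys_over K \<longleftrightarrow> c \<in> K"
  and polys_over_add: "P \<in> polys_over K \<Longrightarrow> Q \<in> polys_over K \<Longrightarrow> P + Q \<in> polys_over K"
  and polys_over_uminus: "P \<in> polys_over K \<Longrightarrow> - P \<in> polys_over K"
  and polys_over_diff: "P \<in> polys_over K \<Longrightarrow> Q \<in> polys_over K \<Longrightarrow> P - Q \<in> polys_over K"
  and polys_over_smult: "c \<in> K \<Longrightarrow> P \<in> polys_over K \<Longrightarrow> smult c P \<in> polys_over K"
  and polys_over_monom: "c \<in> K \<Longrightarrow> monom c n \<in> polys_over K"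
  and polys_over_pCons_iff: "pCons c P \<in> polys_over K \<longleftrightarrow> c \<in> K \<and> P \<in> polys_over K"
  using subfield_0[OF K] subfield_1[OF K]
  by (auto simp: polys_over_def coeff_pCons subfield_add[OF K] subfield_diff[OF K]
      subfield_uminus[OF K] subfield_mult[OF K] split: nat.splits)

lemma polys_over_mult: "P \<in> polys_over K \<Longrightarrow> Q \<in> polys_over K \<Longrightarrow> P * Q \<in> polys_over K"
  by (auto simp: polys_over_def coeff_mult intro!: subfield_sum[OF K] subfield_mult[OF K])

lemma polys_over_power: "P \<in> polys_over K \<Longrightarrow> P ^ n \<in> polys_over K"
  by (induction n) (auto simp: polys_over_1 polys_over_mult)

lemma polys_over_prod_list: "set Qs \<subseteq> polys_over K \<Longrightarrow> prod_list Qs \<in> polys_over K"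
  by (induction Qs) (auto simp: polys_over_1 polys_over_mult)

lemma polys_over_pcompose:
  assumes "P \<in> polys_over K" "Q \<in> polys_over K"
  shows "pcompose P Q \<in> polys_over K"
  using assms(1)
proof (induction P)
  case (pCons a P)
  then show ?case
    by (auto simp: pcompose_pCons polys_over_pCons_iff intro!: polys_over_add polys_over_mult assms
        polys_over_0)
qed (simp add: polys_over_0)

lemma polys_over_subst_power: "P \<in> polys_over K \<Longrightarrow> subst_power n P \<in> polys_over K"
  unfolding subst_power_def
  by (intro polys_over_pcompose polys_over_monom) (auto simp: subfield_1[OF K])

lemma poly_in_subfield: "P \<in> polys_over K \<Longrightarrow> x \<in> K \<Longrightarrow> poly P x \<in> K"
  unfolding poly_altdef
  by (intro subfield_sum[OF K] subfield_mult[OF K] subfield_power[OF K]) (auto dest: polys_overD)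

lemma polys_over_division:
  assumes B: "B \<in> polys_over K" "B \<noteq> 0"
  shows "A \<in> polys_over K \<Longrightarrow>
    \<exists>Q R. Q \<in> polys_over K \<and> R \<in> polys_over K \<and> A = Q * B + R \<and> (R = 0 \<or> degree R < degree B)"
proof (induction "degree A" arbitrary: A rule: less_induct)
  case less
  show ?case
  proof (cases "A = 0 \<or> degree A < degree B")
    case True
    with less.prems show ?thesis
      by (intro exI[of _ 0] exI[of _ A]) (auto simp: polys_over_0)
  next
    case False
    define c where "c = lead_coeff A / lead_coeff B"
    define M where "M = monom c (degree A - degree B)"
    define A' where "A' = A - M * B"
    have c: "c \<in> K" "c \<noteq> 0"
      using False B less.prems
      by (auto simp: c_def intro!: subfield_divide[OF K] polys_overD)
    have M: "M \<in> polys_over K"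
      unfolding M_def by (intro polys_over_monom c)
    have A': "A' \<in> polys_over K"
      unfolding A'_def using less.prems M B by (intro polys_over_diff polys_over_mult)
    have degMB: "degree (M * B) = degree A"
      using False B c by (simp add: M_def degree_mult_eq degree_monom_eq)
    have "coeff (M * B) (degree A) = lead_coeff A"
      using False B by (simp add: M_def coeff_monom_mult c_def)
    then have lc: "coeff A' (degree A) = 0"
      by (simp add: A'_def)
    have le: "degree A' \<le> degree A"
      unfolding A'_def using degMB by (intro degree_diff_le) auto
    show ?thesis
    proof (cases "A' = 0")
      case True
      then show ?thesis
        using M by (intro exI[of _ M] exI[of _ 0]) (auto simp: A'_def polys_over_0)
    next
      case False
      then have "degree A' < degree A"
        using lc le by (metis le_neq_implies_less leading_coeff_0_iff)
      from less.hyps[OF this A'] obtain Q R where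
        "Q \<in> polys_over K" "R \<in> polys_over K" "A' = Q * B + R" "R = 0 \<or> degree R < degree B"
        by blast
      then show ?thesis
        using M by (intro exI[of _ "M + Q"] exI[of _ R])
          (auto simp: A'_def algebra_simps intro: polys_over_add)
    qed
  qed
qed

text \<open>Division with remainder over \<open>K\<close> is also one over the large field, where quotient and
remainder are unique.\<close>

lemma polys_over_quotient:
  assumes "A \<in> polys_over K" "B \<in> polys_over K" "B \<noteq> 0" "A = B * C"
  shows "C \<in> polys_over K"
proof -
  obtain Q R where QR: "Q \<in> polys_over K" "A = Q * B + R" "R = 0 \<or> degree R < degree B"
    using polys_over_division[OF assms(2,3,1)] by blast
  have "B * (C - Q) = R"
    using QR(2) assms(4) by (simp add: algebra_simps)
  then have "C - Q = 0"
    using QR(3) assms(3) by (metis degree_mult_right_le leD mult_eq_0_iff)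
  then show ?thesis using QR by simp
qed

end

lemma subst_power_0 [simp]: "subst_power n 0 = 0"
  and subst_power_1 [simp]: "subst_power n 1 = 1"
  and subst_power_mult: "subst_power n (P * Q) = subst_power n P * subst_power n Q"
  and subst_power_add: "subst_power n (P + Q) = subst_power n P + subst_power n Q"
  and subst_power_smult: "subst_power n (smult c P) = smult c (subst_power n P)"
  and poly_subst_power: "poly (subst_power n P) x = poly P (x ^ n)"
  by (simp_all add: subst_power_def pcompose_mult pcompose_add pcompose_smult poly_pcompose
      poly_monom pcompose_1)

lemma degree_subst_power: "degree (subst_power n P) = degree P * n"
  by (simp add: subst_power_def degree_pcompose degree_monom_eq)

lemma subst_power_eq_0_iff: "n \<ge> 1 \<Longrightarrow> subst_power n P = 0 \<longleftrightarrow> P = 0"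
  unfolding subst_power_def by (rule pcompose_eq_0_iff) (simp add: degree_monom_eq)

lemma subst_power_subst_power: "subst_power m (subst_power n P) = subst_power (n * m) P"
proof -
  have "pcompose (monom 1 n) (monom 1 m) = (monom 1 (n * m) :: 'a poly)"
  proof (induction n)
    case (Suc n)
    have "pcompose (monom 1 (Suc n)) (monom 1 m) =
        pcompose (monom 1 1 * monom 1 n) (monom 1 m :: 'a poly)"
      by (simp add: mult_monom)
    also have "\<dots> = monom 1 m * monom 1 (n * m)"
      by (simp only: pcompose_mult Suc) (simp add: monom_altdef pcompose_pCons)
    finally show ?case by (simp add: mult_monom algebra_simps)
  qed (simp add: pcompose_1)
  then show ?thesis
    by (simp add: subst_power_def pcompose_assoc[symmetric])
qed

lemma subst_power_dvd: "P dvd Q \<Longrightarrow> subst_power n P dvd subst_power n Q"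
  by (auto simp: subst_power_mult elim!: dvdE)

lemma subst_power_prod_list: "subst_power n (prod_list Qs) = prod_list (map (subst_power n) Qs)"
  by (induction Qs) (auto simp: subst_power_mult)

section \<open>Minimal polynomials\<close>

text \<open>Minimality is expressed by divisibility. Divisibility in the large polynomial ring suffices, by
\<open>polys_over_quotient\<close>.\<close>

definition is_min_poly :: "'a::field set \<Rightarrow> 'a \<Rightarrow> 'a poly \<Rightarrow> bool" where
  "is_min_poly K x q \<longleftrightarrow> q \<in> polys_over K \<and> lead_coeff q = 1 \<and> poly q x = 0 \<and>
     (\<forall>A\<in>polys_over K. poly A x = 0 \<longrightarrow> q dvd A)"

lemma algebraic_over_iff: "algebraic_over K x \<longleftrightarrow> (\<exists>P\<in>polys_over K. P \<noteq> 0 \<and> poly P x = 0)"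
  by (auto simp: algebraic_over_def polys_over_def)

lemma min_poly_exists:
  assumes K: "is_subfield K" and "algebraic_over K x"
  obtains q where "is_min_poly K x q"
proof -
  define S where "S = {P \<in> polys_over K. P \<noteq> 0 \<and> poly P x = 0}"
  obtain q where q: "q \<in> S" and min: "\<And>A. A \<in> S \<Longrightarrow> degree q \<le> degree A"
    using ex_has_least_nat[of "\<lambda>P. P \<in> S" _ degree] assms(2)
    unfolding algebraic_over_iff S_def by blast
  have qK: "q \<in> polys_over K" "q \<noteq> 0" "poly q x = 0"
    using q by (auto simp: S_def)
  have dvd: "q dvd A" if A: "A \<in> polys_over K" "poly A x = 0" for A
  proof -
    obtain Q R where QR: "R \<in> polys_over K" "A = Q * q + R" "R = 0 \<or> degree R < degree q"
      using polys_over_division[OF K qK(1,2) A(1)] by blast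
    have "poly R x = 0" using QR(2) A qK by simp
    then have "R = 0" using QR(1,3) min[of R] leD unfolding S_def by blast
    then show ?thesis using QR by simp
  qed
  let ?q = "smult (inverse (lead_coeff q)) q"
  have "is_min_poly K x ?q"
    unfolding is_min_poly_def using qK dvd
    by (auto simp: smult_dvd_iff intro!: polys_over_smult[OF K] subfield_inverse[OF K] polys_overD)
  then show ?thesis by (rule that)
qed

lemma min_poly_nonzero: "is_min_poly K x q \<Longrightarrow> q \<noteq> 0"
  by (auto simp: is_min_poly_def)

lemma min_poly_degree_pos: "is_min_poly K x q \<Longrightarrow> degree q > 0"
  by (auto simp: is_min_poly_def elim!: degree_eq_zeroE intro!: Nat.gr0I)

lemma min_poly_factor_exists:
  fixes Q :: "'a::alg_closed_field poly"
  assumes K: "is_subfield K" and Q: "Q \<in> polys_over K" "degree Q > 0"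
  obtains x q where "is_min_poly K x q" "q dvd Q" "poly Q x = 0"
proof -
  obtain x where x: "poly Q x = 0"
    using alg_closed_imp_poly_has_root[OF Q(2)] by blast
  have "algebraic_over K x"
    using Q x by (auto simp: algebraic_over_iff intro!: bexI[of _ Q])
  then obtain q where "is_min_poly K x q"
    using min_poly_exists[OF K] by blast
  with x Q that show ?thesis
    by (auto simp: is_min_poly_def)
qed

section \<open>Linear dependence\<close>

text \<open>Gaussian elimination of one equation at a time: an equation with a nonzero coefficient is solved for
one unknown, which stays in \<open>K\<close>, and substituted into the others.\<close>

lemma homogeneous_system_solution:
  assumes K: "is_subfield K"
  shows "finite B \<Longrightarrow> finite I \<Longrightarrow> card B < card I \<Longrightarrow> (\<And>i b. i \<in> I \<Longrightarrow> b \<in> B \<Longrightarrow> a i b \<in> K) \<Longrightarrow>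
    \<exists>k. (\<forall>i\<in>I. k i \<in> K) \<and> (\<exists>i\<in>I. k i \<noteq> 0) \<and> (\<forall>b\<in>B. (\<Sum>i\<in>I. k i * a i b) = 0)"
proof (induction B arbitrary: I a rule: finite_induct)
  case empty
  then have "I \<noteq> {}" by auto
  then show ?case
    using subfield_1[OF K] by (intro exI[of _ "\<lambda>_. 1"]) auto
next
  case (insert b B)
  show ?case
  proof (cases "\<forall>i\<in>I. a i b = 0")
    case True
    have "\<exists>k. (\<forall>i\<in>I. k i \<in> K) \<and> (\<exists>i\<in>I. k i \<noteq> 0) \<and> (\<forall>b\<in>B. (\<Sum>i\<in>I. k i * a i b) = 0)"
      using insert.prems insert.hyps by (intro insert.IH) auto
    with True show ?thesis by auto
  next
    case False
    then obtain j where j: "j \<in> I" "a j b \<noteq> 0" by blast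
    define J where "J = I - {j}"
    define a' where "a' i c = a i c - a i b / a j b * a j c" for i c
    have "\<exists>k. (\<forall>i\<in>J. k i \<in> K) \<and> (\<exists>i\<in>J. k i \<noteq> 0) \<and> (\<forall>c\<in>B. (\<Sum>i\<in>J. k i * a' i c) = 0)"
      using insert.prems insert.hyps j unfolding J_def a'_def
      by (intro insert.IH)
        (auto intro!: subfield_diff[OF K] subfield_mult[OF K] subfield_divide[OF K])
    then obtain k where k: "\<And>i. i \<in> J \<Longrightarrow> k i \<in> K" "\<exists>i\<in>J. k i \<noteq> 0"
        "\<And>c. c \<in> B \<Longrightarrow> (\<Sum>i\<in>J. k i * a' i c) = 0"
      by blast
    define s where "s = - (\<Sum>i\<in>J. k i * a i b) / a j b"
    have finJ: "finite J" "j \<notin> J" and I: "I = insert j J"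
      using insert.prems j by (auto simp: J_def)
    have s: "s \<in> K"
      unfolding s_def using k(1) insert.prems j
      by (intro subfield_divide[OF K] subfield_uminus[OF K] subfield_sum[OF K] subfield_mult[OF K])
        (auto simp: J_def)
    have ks: "(\<Sum>i\<in>I. (k(j := s)) i * a i c) = s * a j c + (\<Sum>i\<in>J. k i * a i c)" for c
    proof -
      have "(\<Sum>i\<in>J. (k(j := s)) i * a i c) = (\<Sum>i\<in>J. k i * a i c)"
        using finJ by (intro sum.cong) auto
      then show ?thesis using finJ by (simp add: I)
    qed
    have "s * a j c + (\<Sum>i\<in>J. k i * a i c) = (\<Sum>i\<in>J. k i * a' i c)" for c
      using j by (simp add: s_def a'_def sum_subtractf sum_distrib_left sum_distrib_right
          algebra_simps sum_divide_distrib)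
    with k(3) have "\<forall>c\<in>B. (\<Sum>i\<in>I. (k(j := s)) i * a i c) = 0"
      by (simp add: ks del: fun_upd_apply)
    moreover have "(\<Sum>i\<in>I. (k(j := s)) i * a i b) = 0"
      unfolding ks using j by (simp add: s_def)
    moreover have "\<forall>i\<in>I. (k(j := s)) i \<in> K"
      using k s finJ by (auto simp: I)
    moreover have "\<exists>i\<in>I. (k(j := s)) i \<noteq> 0"
      using k(2) finJ unfolding I by (metis fun_upd_apply insertCI)
    ultimately show ?thesis by (intro exI[of _ "k(j := s)"]) auto
  qed
qed

text \<open>\<open>finite_over K\<close> says that this set is everything for some finite \<open>B\<close>.\<close>

definition span_over :: "'a::field set \<Rightarrow> 'a set \<Rightarrow> 'a set" where
  "span_over K B = {x. \<exists>c. (\<forall>b\<in>B. c b \<in> K) \<and> x = (\<Sum>b\<in>B. c b * b)}"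

text \<open>Among \<open>card B + 1\<close> powers of \<open>x\<close> in a space spanned by \<open>card B\<close> elements there is a linear
relation.\<close>

lemma algebraic_if_powers_in_span:
  assumes K: "is_subfield K" and B: "finite B" and x: "\<And>i. i \<le> card B \<Longrightarrow> x ^ i \<in> span_over K B"
  obtains P where "P \<in> polys_over K" "P \<noteq> 0" "degree P \<le> card B" "poly P x = 0"
proof -
  have "\<forall>i\<in>{..card B}. \<exists>c. (\<forall>b\<in>B. c b \<in> K) \<and> x ^ i = (\<Sum>b\<in>B. c b * b)"
    using x by (auto simp: span_over_def)
  then obtain c where c: "\<And>i b. i \<le> card B \<Longrightarrow> b \<in> B \<Longrightarrow> c i b \<in> K"
      "\<And>i. i \<le> card B \<Longrightarrow> x ^ i = (\<Sum>b\<in>B. c i b * b)"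
    by (subst (asm) bchoice_iff) auto
  obtain k where k: "\<forall>i\<in>{..card B}. k i \<in> K" "\<exists>i\<in>{..card B}. k i \<noteq> 0"
      "\<forall>b\<in>B. (\<Sum>i\<le>card B. k i * c i b) = 0"
    using homogeneous_system_solution[OF K B, of "{..card B}" c] c(1) by auto
  define P where "P = (\<Sum>i\<le>card B. monom (k i) i)"
  have coeff: "coeff P i = (if i \<le> card B then k i else 0)" for i
    by (simp add: P_def coeff_sum)
  show ?thesis
  proof
    show "P \<in> polys_over K"
      using k(1) subfield_0[OF K] by (auto simp: polys_over_def coeff)
    show "P \<noteq> 0"
      using k(2) coeff by (metis atMost_iff coeff_0)
    show "degree P \<le> card B"
      by (intro degree_le) (auto simp: coeff)
    have "poly P x = (\<Sum>i\<le>card B. k i * (\<Sum>b\<in>B. c i b * b))"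
      by (simp add: P_def poly_sum poly_monom c(2))
    also have "\<dots> = (\<Sum>b\<in>B. (\<Sum>i\<le>card B. k i * c i b) * b)"
      by (simp add: sum_distrib_left sum_distrib_right mult.assoc) (rule sum.swap)
    also have "\<dots> = 0" using k(3) by simp
    finally show "poly P x = 0" .
  qed
qed

section \<open>Counting factors\<close>

text \<open>The factors are only required to be nonconstant. Since the condition is a divisibility, it passes
to divisors of \<open>P\<close>, and constant factors do not matter.\<close>

definition factors_at_most :: "'a::field set \<Rightarrow> nat \<Rightarrow> 'a poly \<Rightarrow> bool" where
  "factors_at_most K r P \<longleftrightarrow>
     (\<forall>Qs. set Qs \<subseteq> polys_over K \<longrightarrow> (\<forall>Q\<in>set Qs. degree Q > 0) \<longrightarrow> prod_list Qs dvd P \<longrightarrow>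
        length Qs \<le> r)"

lemma factors_at_mostD:
  assumes "factors_at_most K r P" "set Qs \<subseteq> polys_over K" "\<And>Q. Q \<in> set Qs \<Longrightarrow> degree Q > 0"
    "prod_list Qs dvd P"
  shows "length Qs \<le> r"
  using assms unfolding factors_at_most_def by blast

lemma factors_at_most_dvd: "factors_at_most K r P \<Longrightarrow> Q dvd P \<Longrightarrow> factors_at_most K r Q"
  unfolding factors_at_most_def by (meson dvd_trans)

lemma prod_list_dvd_mono:
  fixes f g :: "'b \<Rightarrow> 'a::comm_semiring_1"
  shows "(\<And>x. x \<in> set xs \<Longrightarrow> f x dvd g x) \<Longrightarrow> prod_list (map f xs) dvd prod_list (map g xs)"
  by (induction xs) (auto intro: mult_dvd_mono)

lemma degree_prod_list:
  fixes Qs :: "'a::idom poly list"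
  shows "0 \<notin> set Qs \<Longrightarrow> degree (prod_list Qs) = (\<Sum>Q\<leftarrow>Qs. degree Q)"
  by (induction Qs) (auto simp: degree_mult_eq prod_list_zero_iff)

text \<open>All roots of a minimal polynomial are conjugate: irreducibility in the form in which it is used.\<close>

lemma min_poly_of_root:
  assumes K: "is_subfield K" and M: "is_min_poly K y M" and x: "poly M x = 0"
  shows "is_min_poly K x M"
proof -
  have "M \<noteq> 0" "M \<in> polys_over K" using M by (auto simp: is_min_poly_def)
  then have "algebraic_over K x" using x by (auto simp: algebraic_over_iff)
  then obtain q where q: "is_min_poly K x q" using min_poly_exists[OF K] by blast
  obtain C where C: "M = q * C"
    using q x \<open>M \<in> polys_over K\<close> by (auto simp: is_min_poly_def elim!: dvdE)
  have CK: "C \<in> polys_over K"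
    using polys_over_quotient[OF K _ _ _ C] q M min_poly_nonzero[OF q] by (auto simp: is_min_poly_def)
  have "C \<noteq> 0" using C \<open>M \<noteq> 0\<close> by auto
  have "\<not> M dvd C"
  proof
    assume "M dvd C"
    then have "degree M \<le> degree C" using \<open>C \<noteq> 0\<close> by (rule dvd_imp_degree_le)
    then show False
      using C \<open>C \<noteq> 0\<close> min_poly_degree_pos[OF q] min_poly_nonzero[OF q]
      by (simp add: degree_mult_eq)
  qed
  then have "poly C y \<noteq> 0" using M CK by (auto simp: is_min_poly_def)
  then have "poly q y = 0" using M C by (auto simp: is_min_poly_def)
  then have "M dvd q" using M q by (auto simp: is_min_poly_def)
  with q M x show ?thesis
    by (auto simp: is_min_poly_def intro: dvd_trans)
qed

lemma factor_into_min_polys: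
  fixes P :: "'a::alg_closed_field poly"
  assumes K: "is_subfield K"
  shows "P \<in> polys_over K \<Longrightarrow> P \<noteq> 0 \<Longrightarrow>
    \<exists>Ms. (\<forall>M\<in>set Ms. \<exists>x. is_min_poly K x M) \<and> P = smult (lead_coeff P) (prod_list Ms)"
proof (induction "degree P" arbitrary: P rule: less_induct)
  case less
  show ?case
  proof (cases "degree P = 0")
    case True
    then show ?thesis by (intro exI[of _ "[]"]) (auto elim!: degree_eq_zeroE)
  next
    case False
    then have deg: "degree P > 0" by simp
    obtain x M where M: "is_min_poly K x M" "M dvd P" "poly P x = 0"
      by (rule min_poly_factor_exists[OF K less.prems(1) deg])
    then obtain C where C: "P = M * C" by (elim dvdE)
    have "M \<noteq> 0" "C \<noteq> 0" using C less.prems by auto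
    have "C \<in> polys_over K"
      using polys_over_quotient[OF K less.prems(1) _ \<open>M \<noteq> 0\<close> C] M by (auto simp: is_min_poly_def)
    moreover have "degree C < degree P"
      using C \<open>M \<noteq> 0\<close> \<open>C \<noteq> 0\<close> min_poly_degree_pos[OF M(1)] by (simp add: degree_mult_eq)
    ultimately obtain Ms where Ms: "\<forall>M\<in>set Ms. \<exists>x. is_min_poly K x M"
        "C = smult (lead_coeff C) (prod_list Ms)"
      using less.hyps[of C] \<open>C \<noteq> 0\<close> by blast
    have "lead_coeff P = lead_coeff C"
      using C M by (simp add: lead_coeff_mult is_min_poly_def)
    then have "P = smult (lead_coeff P) (prod_list (M # Ms))"
      using C Ms(2) by (metis mult_smult_right prod_list.Cons)
    with Ms M show ?thesis by (intro exI[of _ "M # Ms"]) auto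
  qed
qed

lemma refine_to_min_polys:
  fixes Qs :: "'a::alg_closed_field poly list"
  assumes K: "is_subfield K"
  shows "set Qs \<subseteq> polys_over K \<Longrightarrow> \<forall>Q\<in>set Qs. degree Q > 0 \<Longrightarrow>
    \<exists>Ms. (\<forall>M\<in>set Ms. \<exists>x. is_min_poly K x M) \<and> length Ms = length Qs \<and> prod_list Ms dvd prod_list Qs"
proof (induction Qs)
  case (Cons Q Qs)
  then obtain Ms where Ms: "\<forall>M\<in>set Ms. \<exists>x. is_min_poly K x M" "length Ms = length Qs"
      "prod_list Ms dvd prod_list Qs"
    by auto
  have Q: "Q \<in> polys_over K" "degree Q > 0" using Cons.prems by auto
  obtain x M where "is_min_poly K x M" "M dvd Q" "poly Q x = 0"
    by (rule min_poly_factor_exists[OF K Q])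
  with Ms show ?case
    by (intro exI[of _ "M # Ms"]) (auto intro: mult_dvd_mono)
qed auto

text \<open>A minimal polynomial of \<open>x\<close> is prime because a product over \<open>E\<close> vanishes at \<open>x\<close> only if one of its
factors does. Primality lets each member of the list be assigned to one of the two factors.\<close>

lemma split_min_polys_dvd_mult:
  assumes E: "is_subfield E"
  shows "\<forall>Q\<in>set Qs. \<exists>x. is_min_poly E x Q \<Longrightarrow> M \<in> polys_over E \<Longrightarrow> N \<in> polys_over E \<Longrightarrow>
    prod_list Qs dvd M * N \<Longrightarrow>
    \<exists>As Bs. set As \<subseteq> set Qs \<and> set Bs \<subseteq> set Qs \<and> length Qs = length As + length Bs \<and>
      prod_list As dvd M \<and> prod_list Bs dvd N"
proof (induction Qs arbitrary: M N)
  case (Cons Q Qs)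
  obtain x where x: "is_min_poly E x Q" using Cons.prems by auto
  note Q = this[unfolded is_min_poly_def] min_poly_nonzero[OF x]
  have dvd: "Q dvd M * N" using Cons.prems(4) by (auto intro: dvd_mult_left)
  then obtain k where k: "M * N = Q * k" by (elim dvdE)
  have "poly (M * N) x = 0" using Q by (simp add: k del: poly_mult) simp
  then consider "Q dvd M" | "Q dvd N"
    using Q Cons.prems by (auto simp del: dvd_mult dvd_mult2)
  then show ?case
  proof cases
    case 1
    then obtain M' where M': "M = Q * M'" by (elim dvdE)
    have "M' \<in> polys_over E"
      using polys_over_quotient[OF E Cons.prems(2) _ _ M'] Q by blast
    moreover have "prod_list Qs dvd M' * N"
      using Cons.prems(4) Q(2) by (simp add: M' mult.assoc)
    ultimately obtain As Bs where "set As \<subseteq> set Qs \<and> set Bs \<subseteq> set Qs \<and>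
        length Qs = length As + length Bs \<and> prod_list As dvd M' \<and> prod_list Bs dvd N"
      using Cons.IH[of M' N] Cons.prems by auto
    then show ?thesis
      by (intro exI[of _ "Q # As"] exI[of _ Bs]) (auto simp: M')
  next
    case 2
    then obtain N' where N': "N = Q * N'" by (elim dvdE)
    have "N' \<in> polys_over E"
      using polys_over_quotient[OF E Cons.prems(3) _ _ N'] Q by blast
    moreover have "prod_list Qs dvd M * N'"
      using Cons.prems(4) Q(2) by (simp add: N' mult.left_commute)
    ultimately obtain As Bs where "set As \<subseteq> set Qs \<and> set Bs \<subseteq> set Qs \<and>
        length Qs = length As + length Bs \<and> prod_list As dvd M \<and> prod_list Bs dvd N'"
      using Cons.IH[of M N'] Cons.prems by auto
    then show ?thesis
      by (intro exI[of _ As] exI[of _ "Q # Bs"]) (auto simp: N')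
  qed
qed auto

text \<open>A minimal polynomial \<open>M\<close> over \<open>K\<close> has at most \<open>m\<close> factors over \<open>E\<close>, since each of them has degree
at least \<open>degree M / m\<close>. With \<open>K = E\<close> and \<open>m = 1\<close> the lemma compares two factorizations over one
field.\<close>

lemma length_min_polys_le:
  assumes K: "is_subfield K" and E: "is_subfield E" and KE: "K \<subseteq> E"
    and m: "\<And>x q M. is_min_poly E x q \<Longrightarrow> is_min_poly K x M \<Longrightarrow> degree M \<le> m * degree q"
    and c: "c \<noteq> 0" "c \<in> E"
  shows "\<forall>M\<in>set Ms. \<exists>x. is_min_poly K x M \<Longrightarrow> \<forall>Q\<in>set Qs. \<exists>x. is_min_poly E x Q \<Longrightarrow>
    prod_list Qs dvd smult c (prod_list Ms) \<Longrightarrow> length Qs \<le> m * length Ms"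
proof (induction Ms arbitrary: Qs)
  case Nil
  have "degree (prod_list Qs) = 0"
    using dvd_imp_degree_le[OF Nil(3)] c by simp
  moreover have "degree (prod_list Qs) > 0" if "Qs = Q # Qs'" for Q Qs'
  proof -
    have "prod_list Qs \<noteq> 0" using Nil(3) c by auto
    then have "degree Q \<le> degree (prod_list Qs)"
      by (intro dvd_imp_degree_le) (auto simp: that)
    with that Nil show ?thesis by (auto dest: min_poly_degree_pos)
  qed
  ultimately show ?case by (cases Qs) auto
next
  case (Cons M Ms)
  have MsE: "set (M # Ms) \<subseteq> polys_over E"
    using Cons.prems(1) polys_over_mono[OF KE] by (auto simp: is_min_poly_def)
  have "prod_list Qs dvd M * smult c (prod_list Ms)"
    using Cons.prems(3) by simp
  then obtain As Bs where AB: "set As \<subseteq> set Qs" "set Bs \<subseteq> set Qs"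
      "length Qs = length As + length Bs" "prod_list As dvd M"
      "prod_list Bs dvd smult c (prod_list Ms)"
    using split_min_polys_dvd_mult[OF E Cons.prems(2), of M "smult c (prod_list Ms)"] MsE c
    by (auto intro!: polys_over_smult[OF E] polys_over_prod_list[OF E])
  have Bs: "length Bs \<le> m * length Ms"
    using AB Cons.prems by (intro Cons.IH) auto
  obtain y where y: "is_min_poly K y M" using Cons.prems(1) by auto
  have "degree M \<le> m * degree A" if A: "A \<in> set As" for A
  proof -
    obtain x where x: "is_min_poly E x A" using A AB(1) Cons.prems(2) by blast
    have "A dvd prod_list As" using that by (auto simp: in_set_conv_decomp)
    then have "A dvd M" using AB(4) by (rule dvd_trans)
    then have "poly M x = 0" using x by (auto simp: is_min_poly_def elim!: dvdE)
    with m[OF x] min_poly_of_root[OF K y] show ?thesis by blast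
  qed
  then have "(\<Sum>A\<leftarrow>As. degree M) \<le> (\<Sum>A\<leftarrow>As. m * degree A)"
    by (intro sum_list_mono) auto
  also have "\<dots> = m * (\<Sum>A\<leftarrow>As. degree A)"
    by (simp add: sum_list_const_mult)
  also have "(\<Sum>A\<leftarrow>As. degree A) = degree (prod_list As)"
    using AB(1) Cons.prems(2) min_poly_nonzero by (subst degree_prod_list) blast+
  also have "\<dots> \<le> degree M"
    using AB(4) min_poly_nonzero[OF y] by (rule dvd_imp_degree_le)
  finally have "length As * degree M \<le> m * degree M"
    by (simp add: sum_list_triv)
  then have "length As \<le> m" using min_poly_degree_pos[OF y] by simp
  with Bs AB(3) show ?case by simp
qed

lemma factors_at_most_extension:
  fixes K :: "'a::alg_closed_field set"
  assumes K: "is_subfield K" and E: "is_subfield E" and KE: "K \<subseteq> E"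
    and m: "\<And>x q M. is_min_poly E x q \<Longrightarrow> is_min_poly K x M \<Longrightarrow> degree M \<le> m * degree q"
    and P: "P \<in> polys_over K" "P \<noteq> 0" "factors_at_most K r P"
  shows "factors_at_most E (m * r) P"
  unfolding factors_at_most_def
proof (intro allI impI)
  fix Qs assume Qs: "set Qs \<subseteq> polys_over E" "\<forall>Q\<in>set Qs. degree Q > 0" "prod_list Qs dvd P"
  obtain Ms where Ms: "\<forall>M\<in>set Ms. \<exists>x. is_min_poly K x M" "P = smult (lead_coeff P) (prod_list Ms)"
    using factor_into_min_polys[OF K P(1,2)] by blast
  have "prod_list Ms dvd P"
    by (subst Ms(2)) (rule dvd_smult, simp)
  have "set Ms \<subseteq> polys_over K" "\<And>M. M \<in> set Ms \<Longrightarrow> degree M > 0"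
    using Ms(1) min_poly_degree_pos is_min_poly_def by blast+
  with \<open>prod_list Ms dvd P\<close> have r: "length Ms \<le> r"
    using \<open>prod_list Ms dvd P\<close> by (intro factors_at_mostD[OF P(3)])
  obtain Qs' where Qs': "\<forall>Q\<in>set Qs'. \<exists>x. is_min_poly E x Q" "length Qs' = length Qs"
      "prod_list Qs' dvd prod_list Qs"
    using refine_to_min_polys[OF E Qs(1,2)] by blast
  have "prod_list Qs' dvd smult (lead_coeff P) (prod_list Ms)"
    using Qs'(3) Qs(3) Ms(2) dvd_trans by metis
  moreover have "lead_coeff P \<in> E" "lead_coeff P \<noteq> 0"
    using P KE polys_overD by auto
  moreover note Ms(1) Qs'(1) m
  ultimately have "length Qs' \<le> m * length Ms"
    by (intro length_min_polys_le[OF K E KE, where c = "lead_coeff P"])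
  also have "\<dots> \<le> m * r" using r by simp
  finally show "length Qs \<le> m * r" using Qs' by simp
qed

section \<open>Finite extensions\<close>

lemma span_over_base:
  assumes "is_subfield K" "finite B" "b \<in> B"
  shows "b \<in> span_over K B"
proof -
  have "(\<Sum>c\<in>B. (if c = b then 1 else 0) * c) = (\<Sum>c\<in>B. if c = b then b else 0)"
    by (rule sum.cong) auto
  then have "b = (\<Sum>c\<in>B. (if c = b then 1 else 0) * c)"
    using assms by simp
  then show ?thesis
    unfolding span_over_def using assms(1)
    by (intro CollectI exI[of _ "\<lambda>c. if c = b then 1 else 0"]) (simp add: subfield_0 subfield_1)
qed

lemma span_over_smult:
  assumes "is_subfield K" "c \<in> K" "x \<in> span_over K B"
  shows "c * x \<in> span_over K B"
proof -
  obtain d where "\<forall>b\<in>B. d b \<in> K" "x = (\<Sum>b\<in>B. d b * b)"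
    using assms by (auto simp: span_over_def)
  then have "\<forall>b\<in>B. c * d b \<in> K" "c * x = (\<Sum>b\<in>B. (c * d b) * b)"
    using subfield_mult[OF assms(1,2)] by (auto simp: sum_distrib_left mult.assoc)
  then show ?thesis unfolding span_over_def by (intro CollectI exI[of _ "\<lambda>b. c * d b"]) simp
qed

lemma span_over_add:
  assumes "is_subfield K" "x \<in> span_over K B" "y \<in> span_over K B"
  shows "x + y \<in> span_over K B"
proof -
  obtain c d where "\<forall>b\<in>B. c b \<in> K" "\<forall>b\<in>B. d b \<in> K" "x = (\<Sum>b\<in>B. c b * b)" "y = (\<Sum>b\<in>B. d b * b)"
    using assms by (auto simp: span_over_def)
  then show ?thesis
    unfolding span_over_def using subfield_add[OF assms(1)]
    by (auto intro!: exI[of _ "\<lambda>b. c b + d b"] simp: algebra_simps sum.distrib)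
qed

lemma span_over_0: "is_subfield K \<Longrightarrow> 0 \<in> span_over K B"
  unfolding span_over_def by (auto intro!: exI[of _ "\<lambda>_. 0"] simp: subfield_0)

lemma span_over_sum:
  "is_subfield K \<Longrightarrow> (\<And>i. i \<in> I \<Longrightarrow> f i \<in> span_over K B) \<Longrightarrow> sum f I \<in> span_over K B"
  by (induction I rule: infinite_finite_induct) (auto simp: span_over_0 span_over_add)

lemma poly_altdef_less:
  fixes x :: "'a::field"
  shows "p = 0 \<or> degree p < n \<Longrightarrow> poly p x = (\<Sum>i<n. coeff p i * x ^ i)"
  unfolding poly_altdef by (cases "p = 0") (auto intro!: sum.mono_neutral_left simp: coeff_eq_0 le_degree)

text \<open>If $E$ is spanned over $K$ by $B$, then $E(x)$ is spanned over $K$ by the products $b x^i$ with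
$b \in B$ and $i < [E(x):E]$.\<close>

lemma algebraic_over_finite_extension:
  assumes K: "is_subfield K" and E: "is_subfield E" and B: "finite B" "E \<subseteq> span_over K B"
    and q: "is_min_poly E x q"
  obtains T where "T \<in> polys_over K" "T \<noteq> 0" "degree T \<le> card B * degree q" "poly T x = 0"
proof -
  let ?e = "degree q"
  \<comment> \<open>Some of these products may coincide, which can only make \<open>B'\<close> smaller.\<close>
  define B' where "B' = (\<lambda>(b, i). b * x ^ i) ` (B \<times> {..<?e})"
  have B': "finite B'" "card B' \<le> card B * ?e"
    using B card_image_le[of "B \<times> {..<?e}"] by (auto simp: B'_def card_cartesian_product)
  have "x ^ j \<in> span_over K B'" for j
  proof -
    have "monom 1 j \<in> polys_over E" "q \<in> polys_over E" "q \<noteq> 0"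
      using q min_poly_nonzero[OF q] subfield_1[OF E]
      by (auto simp: is_min_poly_def intro!: polys_over_monom[OF E])
    then obtain Q R where QR: "R \<in> polys_over E" "monom 1 j = Q * q + R" "R = 0 \<or> degree R < ?e"
      using polys_over_division[OF E] by metis
    have "x ^ j = poly (monom 1 j) x" by (simp add: poly_monom)
    also have "\<dots> = poly R x" using q by (simp add: QR(2) is_min_poly_def)
    also have "\<dots> = (\<Sum>i<?e. coeff R i * x ^ i)"
      using QR(3) by (rule poly_altdef_less)
    also have "\<dots> \<in> span_over K B'"
    proof (rule span_over_sum[OF K])
      fix i assume i: "i \<in> {..<?e}"
      obtain c where c: "\<forall>b\<in>B. c b \<in> K" "coeff R i = (\<Sum>b\<in>B. c b * b)"
        using B(2) polys_overD[OF QR(1), of i] by (auto simp: span_over_def)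
      have "coeff R i * x ^ i = (\<Sum>b\<in>B. c b * (b * x ^ i))"
        by (simp add: c(2) sum_distrib_right mult.assoc)
      also have "\<dots> \<in> span_over K B'"
        using c(1) B'(1) i
        by (intro span_over_sum[OF K] span_over_smult[OF K] span_over_base[OF K])
          (auto simp: B'_def)
      finally show "coeff R i * x ^ i \<in> span_over K B'" .
    qed
    finally show ?thesis .
  qed
  then obtain T where T: "T \<in> polys_over K" "T \<noteq> 0" "degree T \<le> card B'" "poly T x = 0"
    using algebraic_if_powers_in_span[OF K B'(1)] by blast
  then show ?thesis using B' that by (meson le_trans)
qed

lemma min_poly_degree_extension:
  assumes K: "is_subfield K" and E: "is_subfield E" and B: "finite B" "E \<subseteq> span_over K B"
    and q: "is_min_poly E x q" and M: "is_min_poly K x M"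
  shows "degree M \<le> card B * degree q"
proof -
  obtain T where T: "T \<in> polys_over K" "T \<noteq> 0" "degree T \<le> card B * degree q" "poly T x = 0"
    by (rule algebraic_over_finite_extension[OF K E B q])
  have "degree M \<le> degree T"
    using M T by (intro dvd_imp_degree_le) (auto simp: is_min_poly_def)
  with T show ?thesis by linarith
qed

section \<open>Good heredity of a subfield\<close>

definition no_torsion_root :: "'a::field poly \<Rightarrow> bool" where
  "no_torsion_root P \<longleftrightarrow> (\<forall>x. poly P x = 0 \<longrightarrow> x \<noteq> 0 \<and> \<not> root_of_unity x)"

definition good_heredity_in :: "'a::field set \<Rightarrow> bool" where
  "good_heredity_in K \<longleftrightarrow>
     (\<forall>P\<in>polys_over K. no_torsion_root P \<longrightarrow> (\<exists>r. \<forall>n\<ge>1. factors_at_most K r (subst_power n P)))"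

lemma no_torsion_root_nonzero: "no_torsion_root P \<Longrightarrow> P \<noteq> 0"
  unfolding no_torsion_root_def by (metis poly_0)

lemma no_torsion_root_dvd: "no_torsion_root P \<Longrightarrow> Q dvd P \<Longrightarrow> no_torsion_root Q"
  unfolding no_torsion_root_def by (metis dvdE mult_eq_0_iff poly_mult)

lemma no_torsion_root_mult: "no_torsion_root P \<Longrightarrow> no_torsion_root Q \<Longrightarrow> no_torsion_root (P * Q)"
  unfolding no_torsion_root_def by (metis mult_eq_0_iff poly_mult)

lemma torsion_iff: "x = 0 \<or> root_of_unity x \<longleftrightarrow> (\<exists>k\<ge>1. x ^ Suc k = x)"
proof (cases "x = 0")
  case True
  then show ?thesis by (intro iffI exI[of _ 1]) auto
next
  case False
  then have "x ^ Suc k = x \<longleftrightarrow> x ^ k = 1" for k by simp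
  with False show ?thesis by (simp add: root_of_unity_def del: power_Suc)
qed

lemma root_of_unity_1 [simp]: "root_of_unity 1"
  unfolding root_of_unity_def by (intro exI[of _ 1]) simp

lemma root_of_unity_mult:
  assumes "root_of_unity x" "root_of_unity y"
  shows "root_of_unity (x * y)"
proof -
  obtain m n where "m \<ge> 1" "x ^ m = 1" "n \<ge> 1" "y ^ n = 1"
    using assms by (auto simp: root_of_unity_def)
  then have "m * n \<ge> 1" "x ^ (m * n) = 1" "y ^ (n * m) = 1"
    by (simp_all only: power_mult power_one) auto
  then show ?thesis
    unfolding root_of_unity_def
    by (intro exI[of _ "m * n"]) (simp add: power_mult_distrib mult.commute)
qed

lemma root_of_unity_power: "root_of_unity x \<Longrightarrow> root_of_unity (x ^ n)"
  by (induction n) (auto intro: root_of_unity_mult)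

lemma root_of_unity_of_power: "n \<ge> 1 \<Longrightarrow> root_of_unity (x ^ n) \<Longrightarrow> root_of_unity x"
proof -
  assume "n \<ge> 1" "root_of_unity (x ^ n)"
  then obtain m where "m \<ge> 1" "x ^ (n * m) = 1"
    by (auto simp: root_of_unity_def power_mult)
  with \<open>n \<ge> 1\<close> show ?thesis
    unfolding root_of_unity_def by (intro exI[of _ "n * m"]) auto
qed

text \<open>The elements that are zero or roots of unity are exactly the roots of the polynomials $x^{k+1} - x$
with $k \ge 1$, which have coefficients in every subfield.\<close>

definition torsion_poly :: "nat \<Rightarrow> 'a::field poly" where
  "torsion_poly k = monom 1 (Suc k) - monom 1 1"

lemma poly_torsion_poly: "poly (torsion_poly k) x = 0 \<longleftrightarrow> x ^ Suc k = x"
  by (simp add: torsion_poly_def poly_monom)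

lemma torsion_poly_nonzero: "k \<ge> 1 \<Longrightarrow> torsion_poly k \<noteq> 0"
proof
  assume "k \<ge> 1" "torsion_poly k = (0 :: 'a poly)"
  then have "coeff (torsion_poly k :: 'a poly) (Suc k) = 0" by simp
  with \<open>k \<ge> 1\<close> show False by (simp add: torsion_poly_def)
qed

lemma torsion_poly_over: "is_subfield K \<Longrightarrow> torsion_poly k \<in> polys_over K"
  unfolding torsion_poly_def
  by (intro polys_over_diff polys_over_monom) (auto simp: subfield_1)

text \<open>If one root of a minimal polynomial is zero or a root of unity, the polynomial divides some $x^{k+1} - x$,
and all its roots are of that kind.\<close>

lemma min_poly_no_torsion_root:
  assumes K: "is_subfield K" and M: "is_min_poly K x M" and x: "x \<noteq> 0" "\<not> root_of_unity x"
  shows "no_torsion_root M"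
  unfolding no_torsion_root_def
proof (intro allI impI)
  fix y assume y: "poly M y = 0"
  show "y \<noteq> 0 \<and> \<not> root_of_unity y"
  proof (rule ccontr)
    assume "\<not> ?thesis"
    then obtain k where k: "k \<ge> 1" "y ^ Suc k = y" using torsion_iff[of y] by blast
    have "is_min_poly K y M" using min_poly_of_root[OF K M y] .
    then have "M dvd torsion_poly k"
      using torsion_poly_over[OF K, of k] poly_torsion_poly[of k y] k
      unfolding is_min_poly_def by blast
    moreover have "poly M x = 0" using M by (auto simp: is_min_poly_def)
    ultimately have "poly (torsion_poly k) x = 0" by (auto elim!: dvdE)
    then show False using poly_torsion_poly[of k x] torsion_iff[of x] k x by blast
  qed
qed

text \<open>Replacing every root of $P$ by its minimal polynomial over $K$ gives a multiple $T \in K[x]$ of $P$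
which again has no torsion roots. The factor counts of $T(x^n)$ over $K$ bound those of $P(x^n)$ over
$E$ up to the factor $[E:K]$.\<close>

lemma good_heredity_in_finite_extension:
  fixes K :: "'a::alg_closed_field set"
  assumes K: "is_subfield K" and E: "is_subfield E" and KE: "K \<subseteq> E"
    and B: "finite B" "E \<subseteq> span_over K B" and gh: "good_heredity_in K"
  shows "good_heredity_in E"
  unfolding good_heredity_in_def
proof (intro ballI impI)
  fix P assume P: "P \<in> polys_over E" "no_torsion_root P"
  have *: "\<exists>T\<in>polys_over K. no_torsion_root T \<and> prod_list Ms dvd T"
    if "\<forall>M\<in>set Ms. \<exists>x. is_min_poly E x M" "no_torsion_root (prod_list Ms)" for Ms
    using that
  proof (induction Ms)
    case Nil
    then show ?case
      by (intro bexI[of _ 1]) (simp_all add: no_torsion_root_def polys_over_1[OF K])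
  next
    case (Cons q Ms)
    have nt: "no_torsion_root q" "no_torsion_root (prod_list Ms)"
      using Cons.prems(2) by (auto intro: no_torsion_root_dvd)
    obtain T where T: "T \<in> polys_over K" "no_torsion_root T" "prod_list Ms dvd T"
      using Cons.IH Cons.prems nt by auto
    obtain x where q: "is_min_poly E x q" using Cons.prems(1) by auto
    have "algebraic_over K x"
      using algebraic_over_finite_extension[OF K E B q] by (auto simp: algebraic_over_iff)
    then obtain M where M: "is_min_poly K x M" using min_poly_exists[OF K] by blast
    have "poly q x = 0" using q by (simp add: is_min_poly_def)
    then have "no_torsion_root M"
      using nt(1) unfolding no_torsion_root_def[of q] by (intro min_poly_no_torsion_root[OF K M]) blast+
    moreover have "q dvd M" "M \<in> polys_over K"
      using q M polys_over_mono[OF KE] by (auto simp: is_min_poly_def)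
    ultimately show ?case
      using T by (intro bexI[of _ "M * T"])
        (auto intro: mult_dvd_mono no_torsion_root_mult polys_over_mult[OF K])
  qed
  obtain Ms where Ms: "\<forall>M\<in>set Ms. \<exists>x. is_min_poly E x M" "P = smult (lead_coeff P) (prod_list Ms)"
    using factor_into_min_polys[OF E P(1) no_torsion_root_nonzero[OF P(2)]] by blast
  have "prod_list Ms dvd P"
    by (subst Ms(2)) (rule dvd_smult, simp)
  then obtain T where T: "T \<in> polys_over K" "no_torsion_root T" "prod_list Ms dvd T"
    using * Ms(1) no_torsion_root_dvd[OF P(2)] by blast
  obtain r where r: "\<And>n. n \<ge> 1 \<Longrightarrow> factors_at_most K r (subst_power n T)"
    using gh T unfolding good_heredity_in_def by blast
  have PT: "P dvd T"
    using T(3) no_torsion_root_nonzero[OF P(2)] by (subst Ms(2)) (simp add: smult_dvd_iff)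
  have "factors_at_most E (card B * r) (subst_power n P)" if n: "n \<ge> 1" for n
  proof -
    have "factors_at_most E (card B * r) (subst_power n T)"
      using r[OF n] T n no_torsion_root_nonzero[OF T(2)]
      by (intro factors_at_most_extension[OF K E KE] min_poly_degree_extension[OF K E B])
        (auto simp: subst_power_eq_0_iff intro!: polys_over_subst_power[OF K])
    then show ?thesis
      using PT by (rule factors_at_most_dvd[OF _ subst_power_dvd])
  qed
  then show "\<exists>r. \<forall>n\<ge>1. factors_at_most E r (subst_power n P)" by blast
qed

text \<open>The values at $s$ of the polynomials over $K$ form a field: the inverse of a value $y \ne 0$
is a polynomial in $y$, by the minimal polynomial $q = c + x q'$ of $y$, as $c = - y q'(y)$ and $c \ne 0$.\<close>

lemma algebraic_simple_extension_span:
  fixes K :: "'a::field set"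
  assumes K: "is_subfield K" and s: "algebraic_over K s"
  obtains B where "finite B" "is_subfield hull (insert s K) \<subseteq> span_over K B"
proof -
  obtain M where M: "is_min_poly K s M" using min_poly_exists[OF K s] by blast
  define B where "B = (\<lambda>i. s ^ i) ` {..<degree M}"
  define W where "W = (\<lambda>A. poly A s) ` polys_over K"
  have "finite B" by (simp add: B_def)
  have WB: "W \<subseteq> span_over K B"
  proof
    fix y assume "y \<in> W"
    then obtain A where A: "A \<in> polys_over K" "y = poly A s" by (auto simp: W_def)
    obtain Q R where QR: "R \<in> polys_over K" "A = Q * M + R" "R = 0 \<or> degree R < degree M"
      using polys_over_division[OF K _ min_poly_nonzero[OF M] A(1)] M
      by (auto simp: is_min_poly_def)
    have "y = poly R s" using M by (simp add: A QR(2) is_min_poly_def)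
    also have "\<dots> = (\<Sum>i<degree M. coeff R i * s ^ i)"
      using QR(3) by (rule poly_altdef_less)
    also have "\<dots> \<in> span_over K B"
      using polys_overD[OF QR(1)] \<open>finite B\<close>
      by (intro span_over_sum[OF K] span_over_smult[OF K] span_over_base[OF K]) (auto simp: B_def)
    finally show "y \<in> span_over K B" .
  qed
  have Winv: "inverse y \<in> W" if y: "y \<in> W" "y \<noteq> 0" for y
  proof -
    obtain A where A: "A \<in> polys_over K" "y = poly A s" using y by (auto simp: W_def)
    have "y ^ i \<in> span_over K B" for i
    proof -
      have "y ^ i = poly (A ^ i) s" by (simp add: A)
      then have "y ^ i \<in> W"
        unfolding W_def using polys_over_power[OF K A(1), of i] by (metis image_eqI)
      then show ?thesis using WB by blast
    qed
    then obtain P where "P \<in> polys_over K" "P \<noteq> 0" "poly P y = 0"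
      using algebraic_if_powers_in_span[OF K \<open>finite B\<close>] by metis
    then have "algebraic_over K y" by (auto simp: algebraic_over_iff)
    then obtain q where q: "is_min_poly K y q" using min_poly_exists[OF K] by blast
    obtain c q' where cq: "q = pCons c q'" by (cases q)
    have cK: "c \<in> K" "q' \<in> polys_over K"
      using q by (auto simp: is_min_poly_def cq polys_over_pCons_iff[OF K])
    have root: "c + y * poly q' y = 0" using q by (simp add: is_min_poly_def cq)
    have "c \<noteq> 0"
    proof
      assume "c = 0"
      then have "poly q' y = 0" using root y by simp
      then have "q dvd q'" using q cK by (auto simp: is_min_poly_def)
      moreover have "q' \<noteq> 0" using min_poly_nonzero[OF q] \<open>c = 0\<close> by (auto simp: cq)
      ultimately have "degree q \<le> degree q'" by (intro dvd_imp_degree_le)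
      then show False using \<open>q' \<noteq> 0\<close> by (simp add: cq)
    qed
    have "inverse y = poly (smult (- inverse c) (pcompose q' A)) s"
      using root \<open>c \<noteq> 0\<close> y(2) by (simp add: poly_pcompose A(2)[symmetric] field_simps)
        (simp add: add.commute eq_neg_iff_add_eq_0)
    moreover have "smult (- inverse c) (pcompose q' A) \<in> polys_over K"
      using cK A by (intro polys_over_smult[OF K] polys_over_pcompose[OF K] subfield_uminus[OF K]
          subfield_inverse[OF K])
    ultimately show ?thesis unfolding W_def by (rule image_eqI)
  qed
  have WI: "poly A s \<in> W" if "A \<in> polys_over K" for A
    using that by (simp add: W_def)
  have W0: "0 \<in> W" using WI[OF polys_over_0[OF K]] by simp
  have "is_subfield W"
    unfolding is_subfield_def
  proof (intro conjI ballI)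
    show "1 \<in> W" using WI[OF polys_over_1[OF K]] by simp
    show "inverse y \<in> W" if "y \<in> W" for y using Winv[OF that] W0 by (cases "y = 0") auto
    fix y assume "y \<in> W"
    then obtain A where A: "A \<in> polys_over K" "y = poly A s" unfolding W_def by (elim imageE)
    show "- y \<in> W" using WI[OF polys_over_uminus[OF K A(1)]] by (simp add: A(2))
    fix z assume "z \<in> W"
    then obtain B where B: "B \<in> polys_over K" "z = poly B s" unfolding W_def by (elim imageE)
    show "y + z \<in> W" using WI[OF polys_over_add[OF K A(1) B(1)]] by (simp add: A(2) B(2))
    show "y * z \<in> W" using WI[OF polys_over_mult[OF K A(1) B(1)]] by (simp add: A(2) B(2))
  qed (rule W0)
  moreover have "insert s K \<subseteq> W"
  proof -
    have "poly [:0, 1:] s \<in> W" unfolding W_def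
      by (intro imageI) (simp add: polys_over_pCons_iff[OF K] subfield_0[OF K] subfield_1[OF K] polys_over_0[OF K])
    moreover have "poly [:c:] s \<in> W" if "c \<in> K" for c unfolding W_def
      using that by (intro imageI) (simp add: polys_over_const_iff[OF K])
    ultimately show ?thesis by auto
  qed
  ultimately have "is_subfield hull (insert s K) \<subseteq> W" by (intro hull_minimal)
  with WB \<open>finite B\<close> that show ?thesis by blast
qed

section \<open>Transfer along field embeddings\<close>

context
  fixes h :: "'d::field \<Rightarrow> 'l::field"
  assumes h: "field_embedding h"
begin

lemma embedding_1: "h 1 = 1" and embedding_add: "h (x + y) = h x + h y"
  and embedding_mult: "h (x * y) = h x * h y"
  using h by (auto simp: field_embedding_def)

lemma embedding_0: "h 0 = 0"
  using embedding_add[of 0 0] by (metis add_0_right add_left_cancel)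

lemma embedding_uminus: "h (- x) = - h x"
  using embedding_add[of x "- x"] by (simp add: embedding_0 eq_neg_iff_add_eq_0 add.commute)

lemma embedding_eq_0_iff: "h x = 0 \<longleftrightarrow> x = 0"
proof
  assume "h x = 0"
  show "x = 0"
  proof (rule ccontr)
    assume "x \<noteq> 0"
    then have "h x * h (inverse x) = 1" by (simp add: embedding_mult[symmetric] embedding_1)
    with \<open>h x = 0\<close> show False by simp
  qed
qed (simp add: embedding_0)

lemma embedding_inverse: "h (inverse x) = inverse (h x)"
proof (cases "x = 0")
  case False
  then have "h x * h (inverse x) = 1" by (simp add: embedding_mult[symmetric] embedding_1)
  then show ?thesis by (simp add: inverse_unique)
qed (simp add: embedding_0)

lemma embedding_inj: "inj h"
proof (rule injI)
  fix x y assume "h x = h y"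
  then have "h (x - y) = 0"
    using embedding_add[of x "- y"] by (simp add: embedding_uminus)
  then show "x = y" by (simp add: embedding_eq_0_iff)
qed

lemma embedding_sum: "h (sum f A) = (\<Sum>i\<in>A. h (f i))"
  by (induction A rule: infinite_finite_induct) (simp_all add: embedding_0 embedding_add)

lemma subfield_range: "is_subfield (range h)"
  unfolding is_subfield_def
  by (auto simp: embedding_0[symmetric] embedding_1[symmetric] embedding_uminus[symmetric]
      embedding_inverse[symmetric] embedding_add[symmetric] embedding_mult[symmetric])

lemma coeff_map_embedding: "coeff (map_poly h P) i = h (coeff P i)"
  by (simp add: coeff_map_poly embedding_0)

lemma map_embedding_mult: "map_poly h (P * Q) = map_poly h P * map_poly h Q"
  by (intro poly_eqI) (simp add: coeff_map_embedding coeff_mult embedding_sum embedding_mult)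

lemma map_embedding_1: "map_poly h 1 = 1"
  by (simp add: embedding_1)

lemma map_embedding_smult: "map_poly h (smult c P) = smult (h c) (map_poly h P)"
  by (intro poly_eqI) (simp add: coeff_map_embedding embedding_mult)

lemma map_embedding_monom: "map_poly h (monom c n) = monom (h c) n"
  by (rule map_poly_monom) (rule embedding_0)

lemma map_embedding_torsion_poly: "map_poly h (torsion_poly k) = torsion_poly k"
proof -
  have "h (a - b) = h a - h b" for a b
    using embedding_add[of a "- b"] by (simp add: embedding_uminus)
  then have "map_poly h (torsion_poly k) = map_poly h (monom 1 (Suc k)) - map_poly h (monom 1 1)"
    by (intro poly_eqI) (simp add: coeff_map_embedding torsion_poly_def)
  then show ?thesis by (simp add: torsion_poly_def map_embedding_monom embedding_1)
qed

lemma map_embedding_prod_list: "map_poly h (prod_list Qs) = prod_list (map (map_poly h) Qs)"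
  by (induction Qs) (simp_all add: map_embedding_1 map_embedding_mult)

lemma map_embedding_eq_0_iff: "map_poly h P = 0 \<longleftrightarrow> P = 0"
  by (rule map_poly_eq_0_iff) (simp_all add: embedding_0 embedding_eq_0_iff)

lemma map_embedding_inj: "map_poly h P = map_poly h Q \<longleftrightarrow> P = Q"
proof
  assume "map_poly h P = map_poly h Q"
  then have "h (coeff P i) = h (coeff Q i)" for i by (metis coeff_map_embedding)
  then show "P = Q" using embedding_inj by (intro poly_eqI) (auto dest: injD)
qed auto

lemma degree_map_embedding: "degree (map_poly h P) = degree P"
  by (rule degree_map_poly) (simp add: embedding_eq_0_iff)

lemma map_embedding_subst_power: "map_poly h (subst_power n P) = subst_power n (map_poly h P)"
proof (induction P)
  case (pCons a P)
  have add: "map_poly h (A + B) = map_poly h A + map_poly h B" for A B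
    by (intro poly_eqI) (simp add: coeff_map_embedding embedding_add)
  show ?case
    using pCons by (simp add: subst_power_def pcompose_pCons add map_embedding_mult map_poly_pCons
        embedding_0 map_embedding_monom embedding_1)
qed simp

lemma polys_over_range: "polys_over (range h) = range (map_poly h)"
proof (intro subset_antisym subsetI)
  fix P assume P: "P \<in> polys_over (range h)"
  have "map_poly h (map_poly (inv_into UNIV h) P) = P"
  proof (rule poly_eqI)
    fix i
    have "inv_into UNIV h 0 = 0" using embedding_inj by (metis embedding_0 inv_f_f)
    then show "coeff (map_poly h (map_poly (inv_into UNIV h) P)) i = coeff P i"
      using polys_overD[OF P, of i] by (simp add: coeff_map_embedding coeff_map_poly f_inv_into_f)
  qed
  then show "P \<in> range (map_poly h)" by (metis rangeI)
qed (auto simp: polys_over_def coeff_map_embedding)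

lemma map_embedding_dvd_iff: "map_poly h P dvd map_poly h Q \<longleftrightarrow> P dvd Q"
proof
  assume dvd: "map_poly h P dvd map_poly h Q"
  show "P dvd Q"
  proof (cases "P = 0")
    case True
    then show ?thesis using dvd by (simp add: map_embedding_eq_0_iff)
  next
    case False
    obtain C where C: "map_poly h Q = map_poly h P * C" using dvd by (elim dvdE)
    have "C \<in> polys_over (range h)"
      using False by (intro polys_over_quotient[OF subfield_range _ _ _ C])
        (auto simp: polys_over_range map_embedding_eq_0_iff)
    then obtain C' where "C = map_poly h C'" by (auto simp: polys_over_range)
    with C have "Q = P * C'" by (simp add: map_embedding_mult[symmetric] map_embedding_inj)
    then show ?thesis by simp
  qed
qed (auto simp: map_embedding_mult elim!: dvdE)

lemma factors_at_most_map_embedding: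
  "factors_at_most (range h) r (map_poly h P) \<longleftrightarrow> factors_at_most UNIV r P"
proof
  assume *: "factors_at_most (range h) r (map_poly h P)"
  show "factors_at_most UNIV r P"
    unfolding factors_at_most_def
  proof (intro allI impI)
    fix Qs :: "'d poly list" assume Qs: "\<forall>Q\<in>set Qs. degree Q > 0" "prod_list Qs dvd P"
    have "length (map (map_poly h) Qs) \<le> r"
      using Qs by (intro factors_at_mostD[OF *])
        (auto simp: polys_over_range degree_map_embedding map_embedding_prod_list[symmetric]
          map_embedding_dvd_iff)
    then show "length Qs \<le> r" by simp
  qed
next
  assume *: "factors_at_most UNIV r P"
  show "factors_at_most (range h) r (map_poly h P)"
    unfolding factors_at_most_def
  proof (intro allI impI)
    fix Qs :: "'l poly list"
    assume Qs: "set Qs \<subseteq> polys_over (range h)" "\<forall>Q\<in>set Qs. degree Q > 0"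
      "prod_list Qs dvd map_poly h P"
    obtain Qs' where Qs': "Qs = map (map_poly h) Qs'"
      using Qs(1) by (metis polys_over_range ex_map_conv rangeE subsetD)
    have "length Qs' \<le> r"
      using Qs by (intro factors_at_mostD[OF *])
        (auto simp: Qs' polys_over_def degree_map_embedding map_embedding_prod_list[symmetric]
          map_embedding_dvd_iff)
    then show "length Qs \<le> r" by (simp add: Qs')
  qed
qed

end

lemma field_embedding_to_ac: "field_embedding to_ac"
  by (simp add: field_embedding_def)

lemma field_embedding_comp: "field_embedding g \<Longrightarrow> field_embedding h \<Longrightarrow> field_embedding (g \<circ> h)"
  by (simp add: field_embedding_def)

text \<open>Having a common root with $x^{k+1} - x$ means having a common factor with it over the small field.
Hence it does not matter in which algebraically closed field the roots are taken.\<close>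

lemma no_torsion_root_embedding:
  fixes h1 :: "'d::field \<Rightarrow> 'l1::field" and h2 :: "'d \<Rightarrow> 'l2::alg_closed_field"
  assumes h1: "field_embedding h1" and h2: "field_embedding h2"
    and P: "no_torsion_root (map_poly h2 P)"
  shows "no_torsion_root (map_poly h1 P)"
  unfolding no_torsion_root_def
proof (intro allI impI)
  fix x assume x: "poly (map_poly h1 P) x = 0"
  show "x \<noteq> 0 \<and> \<not> root_of_unity x"
  proof (rule ccontr)
    assume "\<not> ?thesis"
    then obtain k where k: "k \<ge> 1" "x ^ Suc k = x" using torsion_iff[of x] by blast
    have xN: "poly (torsion_poly k) x = 0" using poly_torsion_poly k by blast
    note R = subfield_range[OF h1]
    have "algebraic_over (range h1) x"
      unfolding algebraic_over_iff
      using torsion_poly_over[OF R] torsion_poly_nonzero[OF k(1)] xN by blast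
    then obtain q where q: "is_min_poly (range h1) x q" using min_poly_exists[OF R] by blast
    then obtain q' where q': "q = map_poly h1 q'"
      by (auto simp: is_min_poly_def polys_over_range[OF h1])
    have "q dvd map_poly h1 P"
      using q x by (auto simp: is_min_poly_def polys_over_range[OF h1])
    then have qP: "q' dvd P" by (simp add: q' map_embedding_dvd_iff[OF h1])
    have "q dvd torsion_poly k"
      using q xN torsion_poly_over[OF R] by (auto simp: is_min_poly_def)
    then have "q dvd map_poly h1 (torsion_poly k)"
      by (simp add: map_embedding_torsion_poly[OF h1])
    then have qN: "q' dvd torsion_poly k" by (simp add: q' map_embedding_dvd_iff[OF h1])
    have "degree (map_poly h2 q') > 0"
      using min_poly_degree_pos[OF q] by (simp add: q' degree_map_embedding[OF h1] degree_map_embedding[OF h2])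
    then obtain y where y: "poly (map_poly h2 q') y = 0"
      using alg_closed_imp_poly_has_root by blast
    have "map_poly h2 q' dvd map_poly h2 P" using qP by (simp add: map_embedding_dvd_iff[OF h2])
    then have "poly (map_poly h2 P) y = 0" using y by (auto elim!: dvdE)
    then have "y \<noteq> 0 \<and> \<not> root_of_unity y" using P by (auto simp: no_torsion_root_def)
    moreover have "map_poly h2 q' dvd torsion_poly k"
      using qN map_embedding_dvd_iff[OF h2, of q' "torsion_poly k"]
      by (simp add: map_embedding_torsion_poly[OF h2])
    then have "poly (torsion_poly k) y = 0" using y by (auto elim!: dvdE)
    then have "y = 0 \<or> root_of_unity y" using torsion_iff[of y] k(1) poly_torsion_poly by blast
    ultimately show False by blast
  qed
qed

section \<open>Bounded factor counts characterise good heredity\<close>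

lemma irreducible_degree_pos: "irreducible I \<Longrightarrow> degree I > 0" for I :: "'d::field poly"
  unfolding irreducible_def by (metis is_unit_iff_degree not_gr_zero)

lemma degree_pos_not_unit: "degree p > 0 \<Longrightarrow> \<not> is_unit p" for p :: "'d::field poly"
  using is_unit_iff_degree[of p] by (cases "p = 0") auto

text \<open>This translates irreducibility over the type \<open>'d\<close> into the language of minimal polynomials.\<close>

lemma irreducible_map_min_poly:
  fixes I :: "'d::field poly" and h :: "'d \<Rightarrow> 'l::alg_closed_field"
  assumes h: "field_embedding h" and I: "irreducible I"
  obtains x M a where "is_min_poly (range h) x M" "a \<noteq> 0" "map_poly h I = smult (h a) M"
proof -
  note R = subfield_range[OF h] and pr = polys_over_range[OF h]
  have "map_poly h I \<in> polys_over (range h)" "degree (map_poly h I) > 0"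
    using irreducible_degree_pos[OF I] by (simp_all add: pr degree_map_embedding[OF h])
  then obtain x M where M: "is_min_poly (range h) x M" "M dvd map_poly h I"
    by (rule min_poly_factor_exists[OF R])
  then obtain M' where M': "M = map_poly h M'"
    by (auto simp: is_min_poly_def pr)
  have "M' dvd I" using M(2) by (simp add: M' map_embedding_dvd_iff[OF h])
  then obtain C where C: "I = M' * C" by (elim dvdE)
  have "\<not> is_unit M'"
    using min_poly_degree_pos[OF M(1)]
    by (intro degree_pos_not_unit) (simp add: M' degree_map_embedding[OF h])
  then have "is_unit C" using I C by (auto dest: irreducibleD)
  then obtain a where a: "C = [:a:]" "a \<noteq> 0" by (auto simp: is_unit_poly_iff dvd_field_iff)
  have "map_poly h I = smult (h a) M"
    by (simp add: C a M' map_embedding_smult[OF h])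
  with that M(1) a(2) show ?thesis by blast
qed

text \<open>The comparison is made in an algebraic closure, where the irreducible factors turn into minimal
polynomials.\<close>

lemma length_le_irreducible_factors:
  fixes Is Qs :: "'d::field poly list"
  assumes Is: "\<forall>I\<in>set Is. irreducible I" and Qs: "\<forall>Q\<in>set Qs. degree Q > 0"
    and c: "c \<noteq> 0" and dvd: "prod_list Qs dvd smult c (prod_list Is)"
  shows "length Qs \<le> length Is"
proof -
  let ?h = "to_ac :: 'd \<Rightarrow> 'd alg_closure" and ?K = "range (to_ac :: 'd \<Rightarrow> 'd alg_closure)"
  note h = field_embedding_to_ac[where 'a = 'd]
  note R = subfield_range[OF h]
  have "\<exists>Ms a. (\<forall>M\<in>set Ms. \<exists>x. is_min_poly ?K x M) \<and> length Ms = length Is \<and> a \<noteq> 0 \<and>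
      map_poly ?h (prod_list Is) = smult (?h a) (prod_list Ms)"
    using Is
  proof (induction Is)
    case Nil
    then show ?case by (intro exI[of _ "[]"] exI[of _ 1]) simp
  next
    case (Cons I Is)
    then obtain Ms a where Ms: "\<forall>M\<in>set Ms. \<exists>x. is_min_poly ?K x M" "length Ms = length Is" "a \<noteq> 0"
      "map_poly ?h (prod_list Is) = smult (?h a) (prod_list Ms)" by auto
    have "irreducible I" using Cons.prems by simp
    then obtain x M b where M: "is_min_poly ?K x M" "b \<noteq> 0" "map_poly ?h I = smult (?h b) M"
      by (rule irreducible_map_min_poly[OF h])
    show ?case
      using Ms M by (intro exI[of _ "M # Ms"] exI[of _ "b * a"])
        (auto simp: map_embedding_mult[OF h] mult.commute[of "to_ac a"])
  qed
  then obtain Ms a where Ms: "\<forall>M\<in>set Ms. \<exists>x. is_min_poly ?K x M" "length Ms = length Is"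
      "a \<noteq> 0" "map_poly ?h (prod_list Is) = smult (?h a) (prod_list Ms)" by blast
  have "set (map (map_poly ?h) Qs) \<subseteq> polys_over ?K"
      "\<forall>Q\<in>set (map (map_poly ?h) Qs). degree Q > 0"
    using Qs by (auto simp: polys_over_range[OF h] degree_map_embedding[OF h])
  then obtain Qs' where Qs': "\<forall>Q\<in>set Qs'. \<exists>x. is_min_poly ?K x Q" "length Qs' = length Qs"
      "prod_list Qs' dvd prod_list (map (map_poly ?h) Qs)"
    using refine_to_min_polys[OF R, of "map (map_poly ?h) Qs"] by auto
  have "map_poly ?h (prod_list Qs) dvd map_poly ?h (smult c (prod_list Is))"
    using dvd by (simp only: map_embedding_dvd_iff[OF h])
  also have "map_poly ?h (smult c (prod_list Is)) = smult (?h (c * a)) (prod_list Ms)"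
    by (simp add: map_embedding_smult[OF h] Ms(4))
  finally have "prod_list Qs' dvd smult (?h (c * a)) (prod_list Ms)"
    using Qs'(3) by (auto simp: map_embedding_prod_list[OF h] intro: dvd_trans)
  moreover have "degree M \<le> 1 * degree q" if "is_min_poly ?K x q" "is_min_poly ?K x M" for x q M
    using that min_poly_nonzero[OF that(1)] by (auto simp: is_min_poly_def intro!: dvd_imp_degree_le)
  moreover have "?h (c * a) \<noteq> 0" using c Ms(3) by auto
  moreover have "?h (c * a) \<in> ?K" by (rule rangeI)
  ultimately have "length Qs' \<le> 1 * length Ms"
    using Ms(1) Qs'(1)
    by (intro length_min_polys_le[OF R R order.refl, where c = "?h (c * a)"])
  then show ?thesis using Qs' Ms by simp
qed

lemma poly_good_heredity_imp_bounded:
  assumes "poly_good_heredity P"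
  shows "\<exists>r. \<forall>n\<ge>1. factors_at_most UNIV r (subst_power n P)"
proof -
  obtain n c Hs where n: "n \<ge> 1" and c: "c \<noteq> 0"
      and P: "subst_power n P = smult c (prod_list Hs)"
      and Hs: "\<forall>H\<in>set Hs. hereditarily_irreducible H"
    using assms unfolding poly_good_heredity_def by blast
  have "factors_at_most UNIV (length Hs) (subst_power m P)" if m: "m \<ge> 1" for m
    unfolding factors_at_most_def
  proof (intro allI impI)
    fix Qs assume Qs: "\<forall>Q\<in>set Qs. degree Q > 0" "prod_list Qs dvd subst_power m P"
    have "prod_list (map (subst_power n) Qs) dvd subst_power n (subst_power m P)"
      using subst_power_dvd[OF Qs(2)] by (simp add: subst_power_prod_list)
    also have "\<dots> = subst_power m (subst_power n P)"
      by (simp add: subst_power_subst_power mult.commute)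
    also have "\<dots> = smult c (prod_list (map (subst_power m) Hs))"
      by (simp add: P subst_power_smult subst_power_prod_list)
    finally have "length (map (subst_power n) Qs) \<le> length (map (subst_power m) Hs)"
      using Hs Qs(1) m n c
      by (intro length_le_irreducible_factors[where c = c])
        (auto simp: hereditarily_irreducible_def degree_subst_power)
    then show "length Qs \<le> length Hs" by simp
  qed
  then show ?thesis by blast
qed

text \<open>A factorization of some $P(x^n)$ with the largest number of factors, over all $n$, consists of
hereditarily irreducible polynomials.\<close>

lemma bounded_imp_poly_good_heredity:
  assumes "P \<noteq> 0" and r: "\<And>n. n \<ge> 1 \<Longrightarrow> factors_at_most UNIV r (subst_power n P)"
  shows "poly_good_heredity P"
proof -
  define good where "good n Qs \<longleftrightarrow> n \<ge> 1 \<and> (\<forall>Q\<in>set Qs. degree Q > 0) \<and>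
    prod_list Qs dvd subst_power n P" for n Qs
  have "good 1 []" by (simp add: good_def)
  moreover have "length Qs < Suc r" if "good n Qs" for n Qs
    using factors_at_mostD[OF r, of n Qs] that by (auto simp: good_def polys_over_def less_Suc_eq_le)
  ultimately obtain n Qs where gd: "good n Qs"
    and max: "\<And>m Rs. good m Rs \<Longrightarrow> length Rs \<le> length Qs"
    using ex_has_greatest_nat[of "\<lambda>p. good (fst p) (snd p)" "(1, [])" "\<lambda>p. length (snd p)" "Suc r"]
    by (metis fst_conv snd_conv surjective_pairing)
  have n: "n \<ge> 1" and Qs: "\<forall>Q\<in>set Qs. degree Q > 0" using gd by (auto simp: good_def)
  obtain R where R: "subst_power n P = prod_list Qs * R" using gd by (auto simp: good_def elim: dvdE)
  have "degree R = 0"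
  proof (rule ccontr)
    assume "degree R \<noteq> 0"
    then have "good n (R # Qs)" using gd R by (auto simp: good_def mult.commute)
    then show False using max by fastforce
  qed
  then obtain c where c: "R = [:c:]" by (rule degree_eq_zeroE)
  have "c \<noteq> 0" using R c n assms(1) by (auto simp: subst_power_eq_0_iff)
  have "hereditarily_irreducible Q" if Q: "Q \<in> set Qs" for Q
    unfolding hereditarily_irreducible_def
  proof (intro allI impI)
    fix m :: nat assume m: "m \<ge> 1"
    have deg: "degree (subst_power m Q) > 0" using Qs Q m by (simp add: degree_subst_power)
    show "irreducible (subst_power m Q)"
    proof (rule irreducibleI)
      show "subst_power m Q \<noteq> 0" using deg by auto
      show "\<not> is_unit (subst_power m Q)" using deg by (rule degree_pos_not_unit)
      fix A B assume AB: "subst_power m Q = A * B"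
      show "is_unit A \<or> is_unit B"
      proof (rule ccontr)
        assume "\<not> (is_unit A \<or> is_unit B)"
        moreover have "A \<noteq> 0" "B \<noteq> 0" using AB deg by auto
        ultimately have dAB: "degree A > 0" "degree B > 0" by (auto simp: is_unit_iff_degree)
        \<comment> \<open>Substituting $x^m$ and replacing \<open>Q\<close> by its two factors gives a longer list.\<close>
        obtain Us Vs where UV: "Qs = Us @ Q # Vs" using Q by (meson split_list)
        define Rs where "Rs = map (subst_power m) Us @ A # B # map (subst_power m) Vs"
        have "prod_list Rs = subst_power m (prod_list Qs)"
          by (simp add: Rs_def UV subst_power_mult subst_power_prod_list AB mult.assoc)
        also have "\<dots> dvd subst_power m (subst_power n P)"
          using gd by (auto simp: good_def intro!: subst_power_dvd)
        finally have "good (n * m) Rs"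
          using n m Qs dAB by (auto simp: good_def Rs_def UV subst_power_subst_power degree_subst_power)
        then have "length Rs \<le> length Qs" by (rule max)
        then show False by (simp add: Rs_def UV)
      qed
    qed
  qed
  then show ?thesis
    unfolding poly_good_heredity_def using n \<open>c \<noteq> 0\<close>
    by (intro exI[of _ n] conjI exI[of _ c] exI[of _ Qs]) (auto simp: R c)
qed

text \<open>The bridge between fields as types and subfields of an algebraically closed field: adjoining
elements one at a time produces intermediate fields that are only available as sets.\<close>

lemma good_heredity_iff_range:
  fixes h :: "'d::field \<Rightarrow> 'l::alg_closed_field"
  assumes h: "field_embedding h"
  shows "good_heredity TYPE('d) \<longleftrightarrow> good_heredity_in (range h)"
proof -
  let ?ac = "to_ac :: 'd \<Rightarrow> 'd alg_closure"
  have "good_heredity TYPE('d) \<longleftrightarrow>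
      (\<forall>P :: 'd poly. no_torsion_root (map_poly ?ac P) \<longrightarrow> poly_good_heredity P)"
    by (simp add: good_heredity_def no_torsion_root_def)
  also have "\<dots> \<longleftrightarrow> (\<forall>P :: 'd poly. no_torsion_root (map_poly h P) \<longrightarrow> poly_good_heredity P)"
    using no_torsion_root_embedding[OF h field_embedding_to_ac]
      no_torsion_root_embedding[OF field_embedding_to_ac h] by blast
  also have "\<dots> \<longleftrightarrow> (\<forall>P :: 'd poly. no_torsion_root (map_poly h P) \<longrightarrow>
      (\<exists>r. \<forall>n\<ge>1. factors_at_most UNIV r (subst_power n P)))"
  proof -
    have "poly_good_heredity P \<longleftrightarrow> (\<exists>r. \<forall>n\<ge>1. factors_at_most UNIV r (subst_power n P))"
      if "no_torsion_root (map_poly h P)" for P :: "'d poly"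
    proof -
      have "P \<noteq> 0" using no_torsion_root_nonzero[OF that] by auto
      then show ?thesis
        using poly_good_heredity_imp_bounded bounded_imp_poly_good_heredity by blast
    qed
    then show ?thesis by blast
  qed
  also have "\<dots> \<longleftrightarrow> good_heredity_in (range h)"
    by (simp add: good_heredity_in_def polys_over_range[OF h] map_embedding_subst_power[OF h, symmetric]
        factors_at_most_map_embedding[OF h])
  finally show ?thesis .
qed

section \<open>Transcendental simple extensions\<close>

text \<open>Bivariate polynomials are written as polynomials in $t$ with coefficients in $K[x]$: the outer variable is
the one to be specialised. Substituting $c$ for $t$ is then \<open>poly A [:c:]\<close>, a ring homomorphism, and
the degree in $t$ is \<open>degree A\<close>, which is additive on products.\<close>

definition bivariate_over :: "'a::field set \<Rightarrow> 'a poly poly set" where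
  "bivariate_over K = {A. \<forall>j. coeff A j \<in> polys_over K}"

text \<open>A polynomial in $t$ alone.\<close>

definition outer_poly :: "'a::field poly \<Rightarrow> 'a poly poly" where
  "outer_poly d = map_poly (\<lambda>a. [:a:]) d"

lemma coeff_outer_poly: "coeff (outer_poly d) i = [:coeff d i:]"
  by (simp add: outer_poly_def coeff_map_poly)

lemma outer_poly_mult: "outer_poly (p * q) = outer_poly p * outer_poly q"
proof (rule poly_eqI)
  fix i
  have *: "(\<Sum>j\<in>J. [:f j:]) = [:\<Sum>j\<in>J. f j:]" for J :: "nat set" and f :: "nat \<Rightarrow> 'a"
    by (induction J rule: infinite_finite_induct) auto
  show "coeff (outer_poly (p * q)) i = coeff (outer_poly p * outer_poly q) i"
    by (simp add: coeff_outer_poly coeff_mult * mult.commute)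
qed

lemma outer_poly_1: "outer_poly 1 = 1"
  by (simp add: outer_poly_def)

lemma poly_outer_poly: "poly (outer_poly d) [:c:] = [:poly d c:]"
  by (simp add: outer_poly_def pcompose_altdef[symmetric] pcompose_pCons_0)

lemma outer_poly_in_bivariate: "is_subfield K \<Longrightarrow> d \<in> polys_over K \<Longrightarrow> outer_poly d \<in> bivariate_over K"
  by (simp add: bivariate_over_def coeff_outer_poly polys_over_const_iff polys_overD)

lemma polys_over_sum: "is_subfield K \<Longrightarrow> (\<And>i. i \<in> I \<Longrightarrow> f i \<in> polys_over K) \<Longrightarrow> sum f I \<in> polys_over K"
  by (induction I rule: infinite_finite_induct) (auto simp: polys_over_0 polys_over_add)

lemma bivariate_over_mult:
  "is_subfield K \<Longrightarrow> A \<in> bivariate_over K \<Longrightarrow> B \<in> bivariate_over K \<Longrightarrow> A * B \<in> bivariate_over K"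
  by (auto simp: bivariate_over_def coeff_mult intro!: polys_over_sum polys_over_mult)

lemma bivariate_over_add:
  "is_subfield K \<Longrightarrow> A \<in> bivariate_over K \<Longrightarrow> B \<in> bivariate_over K \<Longrightarrow> A + B \<in> bivariate_over K"
  by (auto simp: bivariate_over_def intro!: polys_over_add)

lemma bivariate_over_diff:
  "is_subfield K \<Longrightarrow> A \<in> bivariate_over K \<Longrightarrow> B \<in> bivariate_over K \<Longrightarrow> A - B \<in> bivariate_over K"
  by (auto simp: bivariate_over_def intro!: polys_over_diff)

lemma bivariate_over_prod_list:
  assumes K: "is_subfield K"
  shows "set As \<subseteq> bivariate_over K \<Longrightarrow> prod_list As \<in> bivariate_over K"
proof (induction As)
  case Nil
  have "coeff 1 j \<in> polys_over K" for j
    by (cases j) (simp_all add: polys_over_0[OF K] polys_over_1[OF K])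
  then show ?case by (simp add: bivariate_over_def)
qed (auto intro: bivariate_over_mult[OF K])

lemma poly_prod_list: "poly (prod_list Qs) x = (\<Prod>Q\<leftarrow>Qs. poly Q x)"
  by (induction Qs) auto

lemma coeff_poly_const: "coeff (poly A [:t:]) i = poly (map_poly (\<lambda>p. coeff p i) A) t"
  by (induction A) (simp_all add: map_poly_pCons)

lemma bivariate_eq_0_if_transcendental:
  assumes t: "\<not> algebraic_over K t" and A: "A \<in> bivariate_over K" "poly A [:t:] = 0"
  shows "A = 0"
proof -
  have "map_poly (\<lambda>p. coeff p i) A = 0" for i
  proof -
    have "map_poly (\<lambda>p. coeff p i) A \<in> polys_over K"
      using A(1) by (auto simp: bivariate_over_def polys_over_def coeff_map_poly)
    moreover have "poly (map_poly (\<lambda>p. coeff p i) A) t = 0"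
      using A(2) by (simp add: coeff_poly_const[symmetric])
    ultimately show ?thesis using t by (auto simp: algebraic_over_iff)
  qed
  then have "coeff (coeff A j) i = 0" for i j
    by (metis coeff_0 coeff_map_poly)
  then show ?thesis by (simp add: poly_eq_iff)
qed

lemma simple_extension_fractions:
  assumes K: "is_subfield K" and x: "x \<in> is_subfield hull (insert t K)"
  obtains p q where "p \<in> polys_over K" "q \<in> polys_over K" "poly q t \<noteq> 0" "x = poly p t / poly q t"
proof -
  \<comment> \<open>The fractions form a field containing $K$ and $t$, hence containing the generated subfield.\<close>
  define W where "W = {poly p t / poly q t | p q. p \<in> polys_over K \<and> q \<in> polys_over K \<and> poly q t \<noteq> 0}"
  have WI: "poly p t / poly q t \<in> W" if "p \<in> polys_over K" "q \<in> polys_over K" "poly q t \<noteq> 0" for p q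
    using that by (auto simp: W_def)
  have WI1: "poly p t \<in> W" if "p \<in> polys_over K" for p
    using WI[OF that polys_over_1[OF K]] by simp
  have W0: "0 \<in> W" using WI1[OF polys_over_0[OF K]] by simp
  have "is_subfield W"
    unfolding is_subfield_def
  proof (intro conjI ballI)
    show "1 \<in> W" using WI1[OF polys_over_1[OF K]] by simp
    fix y assume "y \<in> W"
    then obtain p q where y: "p \<in> polys_over K" "q \<in> polys_over K" "poly q t \<noteq> 0"
        "y = poly p t / poly q t"
      unfolding W_def by blast
    show "- y \<in> W"
      using WI[OF polys_over_uminus[OF K y(1)] y(2,3)] by (simp add: y(4))
    show "inverse y \<in> W"
    proof (cases "poly p t = 0")
      case False
      then show ?thesis using WI[OF y(2,1)] by (simp add: y(4))
    qed (simp add: y(4) W0)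
    fix z assume "z \<in> W"
    then obtain p' q' where z: "p' \<in> polys_over K" "q' \<in> polys_over K" "poly q' t \<noteq> 0"
        "z = poly p' t / poly q' t"
      unfolding W_def by blast
    have q: "q * q' \<in> polys_over K" "poly (q * q') t \<noteq> 0"
      using polys_over_mult[OF K y(2) z(2)] y(3) z(3) by auto
    have "p * q' + p' * q \<in> polys_over K"
      using y z by (intro polys_over_add[OF K] polys_over_mult[OF K])
    from WI[OF this q] show "y + z \<in> W"
      using y(3) z(3) by (simp add: y(4) z(4) add_frac_eq)
    show "y * z \<in> W"
      using WI[OF polys_over_mult[OF K y(1) z(1)] q] by (simp add: y(4) z(4))
  qed (rule W0)
  moreover have "insert t K \<subseteq> W"
  proof -
    have "[:0, 1:] \<in> polys_over K"
      by (simp add: polys_over_pCons_iff[OF K] subfield_0[OF K] subfield_1[OF K] polys_over_0[OF K])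
    from WI1[OF this] have "t \<in> W" by simp
    moreover have "c \<in> W" if "c \<in> K" for c
      using WI1[of "[:c:]"] that by (simp add: polys_over_const_iff[OF K])
    ultimately show ?thesis by auto
  qed
  ultimately have "is_subfield hull (insert t K) \<subseteq> W" by (intro hull_minimal)
  with x that show ?thesis unfolding W_def by blast
qed

text \<open>The bound on the degrees in $x$ serves for the finiteness of the torsion in function fields.\<close>

lemma clear_denominators:
  assumes K: "is_subfield K"
  shows "Q \<in> polys_over (is_subfield hull (insert t K)) \<Longrightarrow>
    \<exists>d A. d \<in> polys_over K \<and> poly d t \<noteq> 0 \<and> A \<in> bivariate_over K \<and>
      poly A [:t:] = smult (poly d t) Q \<and> (\<forall>j. degree (coeff A j) \<le> length (coeffs Q))"
proof (induction Q)
  case 0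
  have "0 \<in> bivariate_over K" by (simp add: bivariate_over_def polys_over_0[OF K])
  then show ?case
    by (intro exI[of _ 1] exI[of _ 0]) (simp add: polys_over_1[OF K])
next
  case (pCons a Q)
  have a: "a \<in> is_subfield hull (insert t K)"
    and "Q \<in> polys_over (is_subfield hull (insert t K))"
    using pCons.prems by (auto simp: polys_over_pCons_iff[OF subfield_hull])
  then obtain d A where dA: "d \<in> polys_over K" "poly d t \<noteq> 0" "A \<in> bivariate_over K"
      "poly A [:t:] = smult (poly d t) Q" "\<And>j. degree (coeff A j) \<le> length (coeffs Q)"
    using pCons.IH by blast
  obtain p q where pq: "p \<in> polys_over K" "q \<in> polys_over K" "poly q t \<noteq> 0" "a = poly p t / poly q t"
    by (rule simple_extension_fractions[OF K a])
  define A' where "A' = outer_poly q * smult [:0, 1:] A + outer_poly (d * p)"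
  have X: "[:0, 1:] \<in> polys_over K"
    by (simp add: polys_over_pCons_iff[OF K] subfield_0[OF K] subfield_1[OF K] polys_over_0[OF K])
  have "smult [:0, 1:] A \<in> bivariate_over K"
    using dA(3) polys_over_mult[OF K X] unfolding bivariate_over_def by simp
  then have "A' \<in> bivariate_over K"
    unfolding A'_def using pq dA
    by (intro bivariate_over_add[OF K] bivariate_over_mult[OF K] outer_poly_in_bivariate[OF K]
        polys_over_mult[OF K])
  moreover have "poly A' [:t:] = smult (poly (d * q) t) (pCons a Q)"
    using pq(3) by (simp add: A'_def poly_outer_poly dA(4) pq(4) mult.commute)
  moreover have "degree (coeff A' j) \<le> length (coeffs (pCons a Q))" for j
  proof -
    have len: "length (coeffs (pCons a Q)) = Suc (length (coeffs Q))"
      using pCons.hyps by (auto simp: cCons_def)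
    have "degree (coeff (outer_poly q) i * ([:0, 1:] * coeff A k)) \<le> Suc (length (coeffs Q))" for i k
    proof -
      have "degree (coeff (outer_poly q) i * ([:0, 1:] * coeff A k))
          \<le> degree (coeff (outer_poly q) i) + (degree [:0, 1 :: 'a:] + degree (coeff A k))"
        using degree_mult_le[of "coeff (outer_poly q) i" "[:0, 1:] * coeff A k"]
          degree_mult_le[of "[:0, 1:]" "coeff A k"] by linarith
      also have "\<dots> \<le> Suc (length (coeffs Q))"
        using dA(5)[of k] by (simp add: coeff_outer_poly)
      finally show ?thesis .
    qed
    then have "degree (coeff A' j) \<le> Suc (length (coeffs Q))"
      unfolding A'_def coeff_add coeff_mult coeff_smult
      by (intro degree_add_le degree_sum_le) (auto simp: coeff_outer_poly)
    then show ?thesis by (simp only: len)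
  qed
  moreover have "d * q \<in> polys_over K" "poly (d * q) t \<noteq> 0"
    using dA pq polys_over_mult[OF K] by auto
  ultimately show ?case by (intro exI[of _ "d * q"] exI[of _ A']) blast
qed

text \<open>No $t - c$ divides \<open>A\<close>. Over an algebraically closed field this means that \<open>A\<close> has no nonconstant
factor in $t$ alone, so it is primitive as a polynomial in $x$.\<close>

definition primitive_outer :: "'a::field poly poly \<Rightarrow> bool" where
  "primitive_outer A \<longleftrightarrow> (\<forall>c. poly A [:c:] \<noteq> 0)"

lemma primitive_outer_decomposition:
  "A \<noteq> 0 \<Longrightarrow> \<exists>e A'. e \<noteq> 0 \<and> A = outer_poly e * A' \<and> primitive_outer A'"
proof (induction "degree A" arbitrary: A rule: less_induct)
  case less
  show ?case
  proof (cases "primitive_outer A")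
    case True
    then show ?thesis by (intro exI[of _ 1] exI[of _ A]) (simp add: outer_poly_1)
  next
    case False
    then obtain c where "poly A [:c:] = 0" by (auto simp: primitive_outer_def)
    then obtain B where B: "A = [:- [:c:], 1:] * B"
      by (metis dvdE poly_eq_0_iff_dvd)
    have "B \<noteq> 0" using B less.prems by auto
    moreover have "degree A = Suc (degree B)"
      unfolding B using \<open>B \<noteq> 0\<close> by (subst degree_mult_eq) auto
    ultimately obtain e A' where e: "e \<noteq> 0" and "B = outer_poly e * A'" "primitive_outer A'"
      using less.hyps[of B] by auto
    moreover have "[:- [:c:], 1:] = outer_poly [:- c, 1:]"
      by (simp add: outer_poly_def map_poly_pCons)
    ultimately have "A = outer_poly ([:- c, 1:] * e) * A'" "primitive_outer A'"
      using B by (simp_all only: outer_poly_mult mult.assoc)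
    moreover have "[:- c, 1:] * e \<noteq> 0" using e by (simp only: mult_eq_0_iff) simp
    ultimately show ?thesis by blast
  qed
qed

text \<open>Gauss's lemma. Allowing the coefficients of the polynomials in $t$ to lie in the algebraically
closed field makes every irreducible polynomial in $t$ linear, and the lemma reduces to substituting
a root: products of primitive polynomials are primitive because substitution is multiplicative, and a root of
\<open>d\<close> must be a root of \<open>e\<close>.\<close>

lemma primitive_outer_dvd:
  fixes A B :: "'a::alg_closed_field poly poly"
  shows "d \<noteq> 0 \<Longrightarrow> primitive_outer B \<Longrightarrow> outer_poly d * A = outer_poly e * B \<Longrightarrow> B dvd A"
proof (induction "degree d" arbitrary: d e rule: less_induct)
  case less
  show ?case
  proof (cases "degree d = 0")
    case True
    then obtain a where a: "d = [:a:]" "a \<noteq> 0" using less.prems(1) by (auto elim: degree_eq_zeroE)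
    have "outer_poly [:inverse a:] * (outer_poly d * A) = A"
      using a by (simp add: mult.assoc[symmetric] outer_poly_mult[symmetric])
        (simp add: one_pCons[symmetric] outer_poly_1)
    then show ?thesis using less.prems(3) by (metis dvd_triv_right mult.assoc)
  next
    case False
    then obtain c where c: "poly d c = 0" using alg_closed_imp_poly_has_root by blast
    have "poly (outer_poly e * B) [:c:] = 0"
      unfolding less.prems(3)[symmetric] by (simp add: poly_outer_poly c)
    then have "poly e c = 0"
      using less.prems(2) by (auto simp: poly_outer_poly primitive_outer_def)
    then obtain d' e' where de: "d = [:- c, 1:] * d'" "e = [:- c, 1:] * e'"
      using c by (auto simp: poly_eq_0_iff_dvd elim!: dvdE)
    have "d' \<noteq> 0" using de less.prems(1) by auto
    have "degree d = Suc (degree d')"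
      unfolding de using \<open>d' \<noteq> 0\<close> by (subst degree_mult_eq) auto
    moreover have "outer_poly [:- c, 1:] \<noteq> 0"
      by (simp add: outer_poly_def map_poly_pCons)
    then have "outer_poly d' * A = outer_poly e' * B"
      using less.prems(3) unfolding de outer_poly_mult mult.assoc by simp
    ultimately show ?thesis using less.hyps[of d' e'] \<open>d' \<noteq> 0\<close> less.prems(2) by simp
  qed
qed

text \<open>A nonzero polynomial of least degree in the ideal of all \<open>q\<close> over \<open>K\<close> for which $q(x^n)$ is divisible
by every common divisor of the $p(x^n)$ with $p \in S$, for each $n$.\<close>

lemma gcd_over_subfield:
  assumes K: "is_subfield K" and S: "S \<subseteq> polys_over K" "p0 \<in> S" "p0 \<noteq> 0"
  obtains c where "c \<in> polys_over K" "\<And>p. p \<in> S \<Longrightarrow> c dvd p"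
    "\<And>n g. (\<And>p. p \<in> S \<Longrightarrow> g dvd subst_power n p) \<Longrightarrow> g dvd subst_power n c"
proof -
  \<comment> \<open>An ideal of the polynomial ring over \<open>K\<close> that contains \<open>S\<close>.\<close>
  define I where "I = {q \<in> polys_over K. \<forall>n g. (\<forall>p\<in>S. g dvd subst_power n p) \<longrightarrow> g dvd subst_power n q}"
  have SI: "S \<subseteq> I" using S(1) by (auto simp: I_def)
  obtain c where c: "c \<in> I" "c \<noteq> 0" and min: "\<And>q. q \<in> I \<Longrightarrow> q \<noteq> 0 \<Longrightarrow> degree c \<le> degree q"
    using ex_has_least_nat[of "\<lambda>q. q \<in> I \<and> q \<noteq> 0" p0 degree] S SI by blast
  have cK: "c \<in> polys_over K" using c by (simp add: I_def)
  have "c dvd p" if p: "p \<in> S" for p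
  proof -
    have pK: "p \<in> polys_over K" using p S by auto
    obtain Q R where QR: "Q \<in> polys_over K" "R \<in> polys_over K" "p = Q * c + R"
        "R = 0 \<or> degree R < degree c"
      using polys_over_division[OF K cK c(2) pK] by blast
    have "g dvd subst_power n R" if g: "\<forall>p\<in>S. g dvd subst_power n p" for n g
    proof -
      have "g dvd subst_power n p" "g dvd subst_power n c"
        using g p c by (auto simp: I_def)
      then show ?thesis
        unfolding QR(3) subst_power_add subst_power_mult by (simp add: dvd_add_right_iff)
    qed
    then have "R \<in> I" using QR by (simp add: I_def)
    then have "R = 0" using min[of R] QR(4) by fastforce
    then show ?thesis using QR(3) by simp
  qed
  moreover have "g dvd subst_power n c" if "\<And>p. p \<in> S \<Longrightarrow> g dvd subst_power n p" for n g
    using c(1) that unfolding I_def by blast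
  ultimately show ?thesis using that cK by blast
qed

lemma poly_map_subst_power:
  "poly (map_poly (subst_power n) A) [:c:] = subst_power n (poly A [:c:])"
proof (induction A)
  case (pCons a A)
  have "subst_power n ([:c:] * poly A [:c:]) = [:c:] * subst_power n (poly A [:c:])"
    by (simp add: subst_power_smult)
  with pCons show ?case by (simp add: map_poly_pCons subst_power_add del: mult_pCons_left)
qed simp

lemma length_filter_pos_le_sum_list:
  fixes f :: "'b \<Rightarrow> nat"
  shows "length (filter (\<lambda>x. f x > 0) xs) \<le> (\<Sum>x\<leftarrow>xs. f x)"
  by (induction xs) auto

text \<open>Let $A(x,t)$ be $P$ with its denominators cleared. By Gauss's lemma the factors of $P(x^n)$ over
$K(t)$ become factors $C_Q$ of $A(x^n,t)$. At most $\deg_t A$ of them involve $t$. The others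
are proportional to polynomials over $K$ dividing all coefficients of $A(x^n,t)$, hence dividing
$c(x^n)$ for the greatest common divisor $c$ of the coefficients of $A$, and good heredity of $K$ applies to $c$.\<close>

lemma good_heredity_in_transcendental_extension:
  fixes K :: "'a::alg_closed_field set"
  assumes K: "is_subfield K" and t: "\<not> algebraic_over K t" and gh: "good_heredity_in K"
  shows "good_heredity_in (is_subfield hull (insert t K))"
  unfolding good_heredity_in_def
proof (intro ballI impI)
  let ?E = "is_subfield hull (insert t K)"
  note E = subfield_hull[of "insert t K"]
  fix P assume P: "P \<in> polys_over ?E" "no_torsion_root P"
  have "P \<noteq> 0" by (rule no_torsion_root_nonzero[OF P(2)])
  obtain D A where DA: "D \<in> polys_over K" "poly D t \<noteq> 0" "A \<in> bivariate_over K"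
      "poly A [:t:] = smult (poly D t) P"
    using clear_denominators[OF K P(1)] by blast
  have "A \<noteq> 0" using DA \<open>P \<noteq> 0\<close> by auto
  have "range (coeff A) \<subseteq> polys_over K" "lead_coeff A \<in> range (coeff A)" "lead_coeff A \<noteq> 0"
    using DA(3) \<open>A \<noteq> 0\<close> by (auto simp: bivariate_over_def)
  then obtain c where c: "c \<in> polys_over K" "\<And>p. p \<in> range (coeff A) \<Longrightarrow> c dvd p"
      "\<And>n g. (\<And>p. p \<in> range (coeff A) \<Longrightarrow> g dvd subst_power n p) \<Longrightarrow> g dvd subst_power n c"
    by (rule gcd_over_subfield[OF K]) blast
  have "[:c:] dvd A" using c(2) by (simp add: const_poly_dvd_iff)
  then have "c dvd poly A [:t:]" by (auto elim!: dvdE)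
  then have "c dvd P" using DA by (simp add: dvd_smult_iff)
  then have "no_torsion_root c" by (rule no_torsion_root_dvd[OF P(2)])
  then obtain r where r: "\<And>n. n \<ge> 1 \<Longrightarrow> factors_at_most K r (subst_power n c)"
    using gh c(1) unfolding good_heredity_in_def by blast
  have "factors_at_most ?E (degree A + r) (subst_power n P)" if n: "n \<ge> 1" for n
    unfolding factors_at_most_def
  proof (intro allI impI)
    fix Qs assume Qs: "set Qs \<subseteq> polys_over ?E" "\<forall>Q\<in>set Qs. degree Q > 0"
      "prod_list Qs dvd subst_power n P"
    obtain R where R: "subst_power n P = prod_list Qs * R" using Qs(3) by (elim dvdE)
    have "subst_power n P \<noteq> 0" using \<open>P \<noteq> 0\<close> n by (simp add: subst_power_eq_0_iff)
    then have nz: "prod_list Qs \<noteq> 0" "R \<noteq> 0" using R by auto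
    have "R \<in> polys_over ?E"
      using P Qs nz by (intro polys_over_quotient[OF E _ _ _ R])
        (auto intro: polys_over_subst_power[OF E] polys_over_prod_list[OF E])
    then have QsR: "set (R # Qs) \<subseteq> polys_over ?E" using Qs by auto
    have "\<forall>Q\<in>polys_over ?E. \<exists>dB. fst dB \<in> polys_over K \<and> poly (fst dB) t \<noteq> 0 \<and>
        snd dB \<in> bivariate_over K \<and> poly (snd dB) [:t:] = smult (poly (fst dB) t) Q"
      using clear_denominators[OF K] by fastforce
    then obtain dB where dB: "\<And>Q. Q \<in> polys_over ?E \<Longrightarrow> fst (dB Q) \<in> polys_over K \<and>
        poly (fst (dB Q)) t \<noteq> 0 \<and> snd (dB Q) \<in> bivariate_over K \<and>
        poly (snd (dB Q)) [:t:] = smult (poly (fst (dB Q)) t) Q"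
      by metis
    define d B where "d Q = fst (dB Q)" and "B Q = snd (dB Q)" for Q
    have dK: "d Q \<in> polys_over K" "poly (d Q) t \<noteq> 0" and BK: "B Q \<in> bivariate_over K"
      and Bt: "poly (B Q) [:t:] = smult (poly (d Q) t) Q" if "Q \<in> set (R # Qs)" for Q
      using dB[of Q] that QsR by (auto simp: d_def B_def)
    define An where "An = map_poly (subst_power n) A"
    have An: "An \<in> bivariate_over K"
      using DA(3) polys_over_subst_power[OF K]
      by (simp add: An_def bivariate_over_def coeff_map_poly)
    have An0: "An \<noteq> 0"
      using \<open>A \<noteq> 0\<close> n unfolding An_def
      by (subst map_poly_eq_0_iff) (auto simp: subst_power_eq_0_iff)
    define ds where "ds = prod_list (map d (R # Qs))"
    have dst: "poly ds t \<noteq> 0"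
      using dK(2) by (auto simp: ds_def poly_prod_list prod_list_zero_iff)
    have evB: "poly (prod_list (map B Rs)) [:t:] = smult (poly (prod_list (map d Rs)) t) (prod_list Rs)"
      if "set Rs \<subseteq> set (R # Qs)" for Rs
      using that by (induction Rs) (simp_all add: Bt mult.commute)
    have "outer_poly ds * An - outer_poly D * prod_list (map B (R # Qs)) = 0"
    proof (rule bivariate_eq_0_if_transcendental[OF t])
      have "set (map B (R # Qs)) \<subseteq> bivariate_over K" "set (map d (R # Qs)) \<subseteq> polys_over K"
        using BK dK by auto
      then show "outer_poly ds * An - outer_poly D * prod_list (map B (R # Qs)) \<in> bivariate_over K"
        unfolding ds_def using An DA(1)
        by (intro bivariate_over_diff[OF K] bivariate_over_mult[OF K] outer_poly_in_bivariate[OF K]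
            bivariate_over_prod_list[OF K] polys_over_prod_list[OF K])
      have "poly An [:t:] = smult (poly D t) (prod_list (R # Qs))"
        by (simp add: An_def poly_map_subst_power DA(4) subst_power_smult R mult.commute)
      then show "poly (outer_poly ds * An - outer_poly D * prod_list (map B (R # Qs))) [:t:] = 0"
        using evB[of "R # Qs"] by (simp add: poly_outer_poly ds_def mult.commute del: list.map prod_list.Cons)
    qed
    then have eq: "outer_poly ds * An = outer_poly D * prod_list (map B (R # Qs))" by simp
    have B0: "B Q \<noteq> 0" if "Q \<in> set (R # Qs)" for Q
      using Bt[OF that] dK(2)[OF that] that nz by (auto simp: prod_list_zero_iff)
    have "\<forall>Q\<in>set (R # Qs). \<exists>eC. fst eC \<noteq> 0 \<and> B Q = outer_poly (fst eC) * snd eC \<and>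
        primitive_outer (snd eC)"
    proof
      fix Q assume "Q \<in> set (R # Qs)"
      then obtain e C where "e \<noteq> 0 \<and> B Q = outer_poly e * C \<and> primitive_outer C"
        using primitive_outer_decomposition[OF B0] by blast
      then show "\<exists>eC. fst eC \<noteq> 0 \<and> B Q = outer_poly (fst eC) * snd eC \<and> primitive_outer (snd eC)"
        by (intro exI[of _ "(e, C)"]) simp
    qed
    then obtain eC where eC: "\<And>Q. Q \<in> set (R # Qs) \<Longrightarrow> fst (eC Q) \<noteq> 0 \<and>
        B Q = outer_poly (fst (eC Q)) * snd (eC Q) \<and> primitive_outer (snd (eC Q))"
      by metis
    define e C where "e Q = fst (eC Q)" and "C Q = snd (eC Q)" for Q
    have e0: "e Q \<noteq> 0" and BeC: "B Q = outer_poly (e Q) * C Q" and C: "primitive_outer (C Q)"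
      if "Q \<in> set (R # Qs)" for Q
      using eC[OF that] by (auto simp: e_def C_def)
    have "prod_list (map B Rs) = outer_poly (prod_list (map e Rs)) * prod_list (map C Rs)"
      if "set Rs \<subseteq> set (R # Qs)" for Rs
      using that by (induction Rs) (simp_all add: BeC outer_poly_1 outer_poly_mult mult_ac)
    then have "outer_poly ds * An =
        outer_poly (D * prod_list (map e (R # Qs))) * prod_list (map C (R # Qs))"
      using eq by (simp only: outer_poly_mult mult.assoc)
    moreover have "primitive_outer (prod_list (map C (R # Qs)))"
    proof -
      have "poly (C Q) [:z:] \<noteq> 0" if "Q \<in> set (R # Qs)" for Q z
        using C[OF that] by (simp add: primitive_outer_def)
      then show ?thesis
        unfolding primitive_outer_def poly_prod_list prod_list_zero_iff by auto
    qed
    moreover have "ds \<noteq> 0" using dst by auto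
    ultimately have "prod_list (map C (R # Qs)) dvd An"
      by (intro primitive_outer_dvd)
    then have CAn: "prod_list (map C Qs) dvd An" by (auto intro: dvd_mult_right)
    have C0: "0 \<notin> set (map C Qs)"
      using C unfolding primitive_outer_def by (metis imageE list.set_intros(2) poly_0 set_map)

    have "length (filter (\<lambda>Q. degree (C Q) > 0) Qs) \<le> (\<Sum>Q\<leftarrow>Qs. degree (C Q))"
      by (rule length_filter_pos_le_sum_list)
    also have "\<dots> = degree (prod_list (map C Qs))"
      using degree_prod_list[OF C0] by (simp add: o_def)
    also have "\<dots> \<le> degree An" using CAn An0 by (rule dvd_imp_degree_le)
    also have "\<dots> \<le> degree A" unfolding An_def by (intro degree_le) (simp add: coeff_map_poly coeff_eq_0)
    finally have le1: "length (filter (\<lambda>Q. degree (C Q) > 0) Qs) \<le> degree A" .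

    \<comment> \<open>For a factor \<open>Q\<close> that does not involve $t$, the coefficients of \<open>B Q\<close> are multiples of one
      polynomial in $x$. The leading one is nonzero and lies over \<open>K\<close>.\<close>
    define Ss where "Ss = filter (\<lambda>Q. \<not> degree (C Q) > 0) Qs"
    have "\<exists>g\<in>polys_over K. degree g > 0 \<and> [:g:] dvd C Q" if Q: "Q \<in> set Ss" for Q
    proof -
      have Q': "Q \<in> set (R # Qs)" "degree (C Q) = 0" "degree Q > 0"
        using Q Qs by (auto simp: Ss_def)
      obtain g where g: "C Q = [:g:]" using Q'(2) by (rule degree_eq_zeroE)
      let ?g = "coeff (B Q) (degree (e Q))"
      have eq: "?g = smult (lead_coeff (e Q)) g"
        by (simp add: BeC[OF Q'(1)] g coeff_outer_poly mult.commute[of _ "[:g:]"])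
      have "smult (poly (e Q) t) g = smult (poly (d Q) t) Q"
        using Bt[OF Q'(1)] by (simp add: BeC[OF Q'(1)] g poly_outer_poly)
      then have "degree g > 0"
        using dK(2)[OF Q'(1)] Q'(3) by (metis degree_smult_eq not_gr_zero)
      then have "degree ?g > 0" using e0[OF Q'(1)] by (simp add: eq)
      moreover have "?g dvd g" using e0[OF Q'(1)] by (simp add: eq smult_dvd_iff)
      then have "[:?g:] dvd C Q" by (simp add: g)
      moreover have "?g \<in> polys_over K" using BK[OF Q'(1)] by (simp add: bivariate_over_def)
      ultimately show ?thesis by blast
    qed
    then obtain g where g: "\<And>Q. Q \<in> set Ss \<Longrightarrow> g Q \<in> polys_over K \<and> degree (g Q) > 0 \<and> [:g Q:] dvd C Q"
      by metis
    have "[:prod_list (map g Rs):] = prod_list (map (\<lambda>Q. [:g Q:]) Rs)" for Rs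
    proof (induction Rs)
      case (Cons Q Rs)
      have "[:prod_list (map g (Q # Rs)):] = [:g Q:] * [:prod_list (map g Rs):]" by simp
      also note Cons
      finally show ?case by simp
    qed (simp add: one_pCons)
    then have "[:prod_list (map g Ss):] dvd prod_list (map C Ss)"
      using g by (simp add: prod_list_dvd_mono)
    also have "prod_list (map C Ss) dvd prod_list (map C Qs)"
      unfolding Ss_def by (induction Qs) (auto intro: mult_dvd_mono)
    also note CAn
    finally have "prod_list (map g Ss) dvd subst_power n p" if "p \<in> range (coeff A)" for p
      using that by (auto simp: An_def const_poly_dvd_iff coeff_map_poly)
    then have "prod_list (map g Ss) dvd subst_power n c" by (rule c(3))
    then have "length (map g Ss) \<le> r"
      using g by (intro factors_at_mostD[OF r[OF n]]) auto
    then show "length Qs \<le> degree A + r"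
      using le1 sum_length_filter_compl[of "\<lambda>Q. degree (C Q) > 0" Qs] by (simp add: Ss_def)
  qed
  then show "\<exists>r. \<forall>n\<ge>1. factors_at_most ?E r (subst_power n P)" by blast
qed

section \<open>Finitely generated extensions\<close>

lemma good_heredity_in_simple_extension:
  fixes K :: "'a::alg_closed_field set"
  assumes K: "is_subfield K" and gh: "good_heredity_in K"
  shows "good_heredity_in (is_subfield hull (insert t K))"
proof (cases "algebraic_over K t")
  case True
  obtain B where "finite B" "is_subfield hull (insert t K) \<subseteq> span_over K B"
    by (rule algebraic_simple_extension_span[OF K True])
  moreover have "K \<subseteq> is_subfield hull (insert t K)" using hull_subset[of "insert t K"] by auto
  ultimately show ?thesis
    using good_heredity_in_finite_extension[OF K subfield_hull] gh by blast
next
  case False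
  then show ?thesis by (rule good_heredity_in_transcendental_extension[OF K _ gh])
qed

lemma good_heredity_in_finitely_generated:
  fixes K :: "'a::alg_closed_field set"
  assumes K: "is_subfield K" and gh: "good_heredity_in K" and S: "finite S"
  shows "good_heredity_in (is_subfield hull (K \<union> S))"
  using S
proof (induction S)
  case empty
  then show ?case using gh K by (simp add: hull_same)
next
  case (insert s S)
  have "is_subfield hull (K \<union> insert s S) = is_subfield hull (insert s (is_subfield hull (K \<union> S)))"
    using hull_insert[of is_subfield s "K \<union> S"] by simp
  then show ?case
    using good_heredity_in_simple_extension[OF subfield_hull insert.IH] by simp
qed

lemma subfield_image:
  assumes g: "field_embedding g" and T: "is_subfield T"
  shows "is_subfield (g ` T)"
  using T unfolding is_subfield_def
  by (auto simp: embedding_0[OF g, symmetric] embedding_1[OF g, symmetric]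
      embedding_add[OF g, symmetric] embedding_mult[OF g, symmetric]
      embedding_uminus[OF g, symmetric] embedding_inverse[OF g, symmetric] simp del: image_eqI intro!: imageI)

lemma image_subfield_hull:
  assumes g: "field_embedding g"
  shows "g ` (is_subfield hull S) = is_subfield hull (g ` S)"
proof (rule subset_antisym)
  have 1: "is_subfield (g -` T)" if "is_subfield T" for T
    using that unfolding is_subfield_def
    by (auto simp: embedding_0[OF g] embedding_1[OF g] embedding_add[OF g] embedding_mult[OF g]
        embedding_uminus[OF g] embedding_inverse[OF g])
  have "is_subfield hull S \<subseteq> g -` (is_subfield hull (g ` S))"
  proof (rule hull_minimal)
    show "is_subfield (g -` (is_subfield hull (g ` S)))" by (rule 1[OF subfield_hull])
  qed (auto intro: hull_inc)
  then show "g ` (is_subfield hull S) \<subseteq> is_subfield hull (g ` S)" by auto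
  show "is_subfield hull (g ` S) \<subseteq> g ` (is_subfield hull S)"
  proof (rule hull_minimal)
    show "is_subfield (g ` (is_subfield hull S))" by (rule subfield_image[OF g subfield_hull])
  qed (auto intro: hull_inc)
qed

theorem good_heredity_finitely_generated:
  fixes h :: "'d::field \<Rightarrow> 'e::field"
  assumes gh: "good_heredity TYPE('d)" and fg: "finitely_generated_extension h"
  shows "good_heredity TYPE('e)"
proof -
  let ?g = "to_ac :: 'e \<Rightarrow> 'e alg_closure"
  note g = field_embedding_to_ac[where 'a = 'e]
  obtain S where h: "field_embedding h" and S: "finite S" "is_subfield hull (range h \<union> S) = UNIV"
    using fg unfolding finitely_generated_extension_def by blast
  have gh': "field_embedding (?g \<circ> h)" by (rule field_embedding_comp[OF g h])
  have "good_heredity_in (range (?g \<circ> h))"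
    using gh good_heredity_iff_range[OF gh'] by simp
  then have "good_heredity_in (is_subfield hull (range (?g \<circ> h) \<union> ?g ` S))"
    using S by (intro good_heredity_in_finitely_generated[OF subfield_range[OF gh']]) auto
  also have "is_subfield hull (range (?g \<circ> h) \<union> ?g ` S) = range ?g"
    using image_subfield_hull[OF g, of "range h \<union> S"] S(2) by (simp add: image_Un image_comp)
  finally show ?thesis using good_heredity_iff_range[OF g] by simp
qed

section \<open>Bounded exponents\<close>

text \<open>A bound for the exponents in the definition of \<open>rootless_modtor_elem\<close>, relative to a subfield.\<close>

definition exponents_bounded :: "'a::field set \<Rightarrow> 'a \<Rightarrow> nat \<Rightarrow> bool" where
  "exponents_bounded K a C \<longleftrightarrow>
     (\<forall>n\<ge>1. \<forall>y\<in>K. \<forall>z\<in>K. root_of_unity z \<longrightarrow> y ^ n = z * a \<longrightarrow> n \<le> C)"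

text \<open>The constant coefficient is, up to sign, the product of the roots: this is the norm of a root.\<close>

lemma constant_coeff_power:
  fixes q :: "'a::alg_closed_field poly"
  shows "lead_coeff q = 1 \<Longrightarrow> \<forall>x. poly q x = 0 \<longrightarrow> x ^ n = a \<Longrightarrow>
    poly q 0 ^ n = (-1) ^ (degree q * n) * a ^ degree q"
proof (induction "degree q" arbitrary: q)
  case 0
  then have "q = 1" by (metis degree_eq_zeroE lead_coeff_pCons(2) one_pCons degree_0 coeff_pCons_0)
  then show ?case by simp
next
  case (Suc m)
  then obtain x where x: "poly q x = 0" using alg_closed_imp_poly_has_root[of q] by auto
  then obtain p where p: "q = [:- x, 1:] * p" by (auto simp: poly_eq_0_iff_dvd elim!: dvdE)
  have "p \<noteq> 0" using p Suc.prems(1) by auto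
  have deg: "degree q = Suc (degree p)"
    unfolding p using \<open>p \<noteq> 0\<close> by (subst degree_mult_eq) auto
  have "lead_coeff p = 1"
    using Suc.prems(1) unfolding p lead_coeff_mult by simp
  moreover have "\<forall>y. poly p y = 0 \<longrightarrow> y ^ n = a"
    using Suc.prems(2) unfolding p by simp
  ultimately have IH: "poly p 0 ^ n = (-1) ^ (degree p * n) * a ^ degree p"
    using Suc.hyps deg by simp
  have xn: "x ^ n = a" using Suc.prems(2) x by blast
  have "poly q 0 = - x * poly p 0" by (simp add: p)
  then have "poly q 0 ^ n = (-1) ^ n * x ^ n * poly p 0 ^ n"
    by (simp only: power_mult_distrib power_minus[of x])
  also have "\<dots> = (-1) ^ (degree q * n) * a ^ degree q"
    by (simp add: IH deg xn power_add)
  finally show ?case .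
qed

text \<open>Let $e$ be the degree of $b$ over $K$ and $c$ its norm up to sign, so that $c^n = \pm a^e$. With
$g = \gcd(e,n)$, $e = e'g$, $n = n'g$, the quotient $w = c^{n'}/a^{e'}$ is a root of unity in $K$. If
$e'u = n'v + 1$, then $d = c^u/a^v$ satisfies $d^{n'} = w^u a$, so $n' \le C$ and $n \le C g \le C e$.\<close>

lemma degree_factor_ge_exponent:
  fixes K :: "'a::alg_closed_field set"
  assumes K: "is_subfield K" and a: "a \<in> K" "a \<noteq> 0" and C: "exponents_bounded K a C"
    and q: "is_min_poly K b q" and b: "b ^ n = a" and n: "n \<ge> 1"
  shows "n \<le> C * degree q"
proof -
  define e where "e = degree q"
  have e: "e > 0" using min_poly_degree_pos[OF q] by (simp add: e_def)
  have "monom 1 n - [:a:] \<in> polys_over K"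
    using a by (intro polys_over_diff[OF K] polys_over_monom[OF K])
      (simp_all add: polys_over_const_iff[OF K] subfield_1[OF K])
  moreover have "poly (monom 1 n - [:a:]) b = 0" by (simp add: poly_monom b)
  ultimately have dvd: "q dvd monom 1 n - [:a:]" using q by (auto simp: is_min_poly_def)
  have roots: "\<forall>x. poly q x = 0 \<longrightarrow> x ^ n = a"
  proof (intro allI impI)
    fix x assume "poly q x = 0"
    with dvd have "poly (monom 1 n - [:a:]) x = 0" by (auto elim!: dvdE simp del: poly_diff)
    then show "x ^ n = a" by (simp add: poly_monom)
  qed
  define c where "c = poly q 0"
  have qK: "q \<in> polys_over K" "lead_coeff q = 1" using q by (auto simp: is_min_poly_def)
  have cK: "c \<in> K" unfolding c_def by (rule poly_in_subfield[OF K qK(1) subfield_0[OF K]])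
  have cn: "c ^ n = (-1) ^ (e * n) * a ^ e"
    unfolding c_def e_def by (rule constant_coeff_power[OF qK(2) roots])
  define g where "g = gcd e n"
  have g: "g > 0" using e by (simp add: g_def)
  obtain e' n' where en: "e = e' * g" "n = n' * g" "coprime e' n'"
    using gcd_coprime_exists[of e n] g unfolding g_def by blast
  have e': "e' > 0" "n' \<ge> 1" using e n en(1,2) by (cases "e' = 0"; cases "n' = 0"; simp)+
  \<comment> \<open>The norm relation says that \<open>w ^ g\<close> is a power of \<open>-1\<close>.\<close>
  define w where "w = c ^ n' / a ^ e'"
  have "w ^ g = (-1) ^ (e * n)"
    using cn a(2) by (simp add: w_def power_divide power_mult[symmetric] en(1,2)[symmetric])
  moreover have "root_of_unity (-1 :: 'a)"
    unfolding root_of_unity_def by (intro exI[of _ 2]) simp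
  ultimately have "root_of_unity (w ^ g)" by (simp add: root_of_unity_power)
  then have w: "root_of_unity w" using root_of_unity_of_power[of g w] g by simp
  have wK: "w \<in> K" unfolding w_def
    using cK a by (intro subfield_divide[OF K] subfield_power[OF K])
  obtain u v where uv: "e' * u = n' * v + 1"
    using bezout_nat[of e' n'] e' en(3) by auto
  define d where "d = c ^ u / a ^ v"
  have dK: "d \<in> K" unfolding d_def
    using cK a by (intro subfield_divide[OF K] subfield_power[OF K])
  have "c ^ n' = w * a ^ e'" using a by (simp add: w_def)
  then have "c ^ (n' * u) = w ^ u * a ^ (e' * u)"
    by (simp add: power_mult power_mult_distrib)
  then have "d ^ n' = w ^ u * a"
    using a(2) by (simp add: d_def power_divide power_mult[symmetric] mult.commute[of _ n'] uv)
  moreover have "root_of_unity (w ^ u)" "w ^ u \<in> K"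
    using w wK by (auto intro: root_of_unity_power subfield_power[OF K])
  ultimately have "n' \<le> C" using C dK e'(2) unfolding exponents_bounded_def by blast
  then have "n \<le> C * g" by (simp add: en(2))
  also have "g \<le> e" using e by (simp add: g_def)
  finally show ?thesis by (simp add: e_def)
qed

text \<open>Every factor of $P(x^n)$ has degree at least $n/C$, while the degrees add up to at most $n \deg P$.\<close>

lemma factors_bounded_if_exponents_bounded:
  fixes F :: "'a::alg_closed_field set"
  assumes F: "is_subfield F" and P: "P \<in> polys_over F" "no_torsion_root P"
    and bounded: "\<And>a. poly P a = 0 \<Longrightarrow>
      \<exists>K C. is_subfield K \<and> F \<subseteq> K \<and> a \<in> K \<and> exponents_bounded K a C"
  shows "\<exists>r. \<forall>n\<ge>1. factors_at_most F r (subst_power n P)"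
proof -
  have P0: "P \<noteq> 0" by (rule no_torsion_root_nonzero[OF P(2)])
  define Z where "Z = {a. poly P a = 0}"
  have "finite Z" unfolding Z_def by (rule poly_roots_finite[OF P0])
  have "\<forall>a\<in>Z. \<exists>C K. is_subfield K \<and> F \<subseteq> K \<and> a \<in> K \<and> exponents_bounded K a C"
    using bounded unfolding Z_def by blast
  then obtain C where C: "\<And>a. a \<in> Z \<Longrightarrow>
      \<exists>K. is_subfield K \<and> F \<subseteq> K \<and> a \<in> K \<and> exponents_bounded K a (C a)"
    by metis
  define c where "c = (\<Sum>a\<in>Z. C a)"
  have "factors_at_most F (c * degree P) (subst_power n P)" if n: "n \<ge> 1" for n
    unfolding factors_at_most_def
  proof (intro allI impI)
    fix Qs assume Qs: "set Qs \<subseteq> polys_over F" "\<forall>Q\<in>set Qs. degree Q > 0"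
      "prod_list Qs dvd subst_power n P"
    have "n \<le> c * degree Q" if Q: "Q \<in> set Qs" for Q
    proof -
      have QF: "Q \<in> polys_over F" "degree Q > 0" using Q Qs by auto
      then have "Q \<noteq> 0" by auto
      obtain b where b: "poly Q b = 0" using alg_closed_imp_poly_has_root[OF QF(2)] by blast
      have "Q dvd prod_list Qs" using Q by (auto simp: in_set_conv_decomp)
      then have "Q dvd subst_power n P" using Qs(3) by (rule dvd_trans)
      then have "poly (subst_power n P) b = 0" using b by (auto elim!: dvdE)
      then have a: "b ^ n \<in> Z" by (simp add: Z_def poly_subst_power)
      then have a0: "b ^ n \<noteq> 0" using P(2) unfolding Z_def no_torsion_root_def by blast
      obtain K where K: "is_subfield K" "F \<subseteq> K" "b ^ n \<in> K" "exponents_bounded K (b ^ n) (C (b ^ n))"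
        using C[OF a] by blast
      have QK: "Q \<in> polys_over K" using polys_over_mono[OF K(2)] QF by blast
      then have "algebraic_over K b" using b \<open>Q \<noteq> 0\<close> by (auto simp: algebraic_over_iff)
      then obtain q where q: "is_min_poly K b q" using min_poly_exists[OF K(1)] by blast
      have "n \<le> C (b ^ n) * degree q"
        by (rule degree_factor_ge_exponent[OF K(1,3) a0 K(4) q refl n])
      also have "C (b ^ n) \<le> c"
        unfolding c_def by (rule member_le_sum[OF a _ \<open>finite Z\<close>]) simp
      also have "degree q \<le> degree Q"
        using q b QK \<open>Q \<noteq> 0\<close> by (intro dvd_imp_degree_le) (auto simp: is_min_poly_def)
      finally show ?thesis by simp
    qed
    then have "(\<Sum>Q\<leftarrow>Qs. n) \<le> (\<Sum>Q\<leftarrow>Qs. c * degree Q)"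
      by (intro sum_list_mono) auto
    also have "\<dots> = c * (\<Sum>Q\<leftarrow>Qs. degree Q)" by (simp add: sum_list_const_mult)
    also have "(\<Sum>Q\<leftarrow>Qs. degree Q) = degree (prod_list Qs)"
      using Qs(2) by (subst degree_prod_list) auto
    also have "\<dots> \<le> degree (subst_power n P)"
      using Qs(3) P0 n by (intro dvd_imp_degree_le) (auto simp: subst_power_eq_0_iff)
    finally have "length Qs * n \<le> c * degree P * n"
      by (simp add: sum_list_triv degree_subst_power)
    then show "length Qs \<le> c * degree P" using n by simp
  qed
  then show ?thesis by blast
qed

section \<open>A finiteness theorem of Northcott type\<close>

text \<open>Splitting off one linear factor multiplies a bound for the coefficients by $1 + |x| \le 1 + B$.\<close>

lemma complex_poly_coeff_bound:
  fixes q :: "complex poly"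
  assumes B: "B \<ge> 0"
  shows "q \<noteq> 0 \<Longrightarrow> \<forall>x. poly q x = 0 \<longrightarrow> norm x \<le> B \<Longrightarrow>
    norm (coeff q i) \<le> norm (lead_coeff q) * (1 + B) ^ degree q"
proof (induction "degree q" arbitrary: q i)
  case 0
  then show ?case by (cases i) (auto simp: coeff_eq_0)
next
  case (Suc m)
  then obtain x where x: "poly q x = 0" using alg_closed_imp_poly_has_root[of q] by auto
  then obtain p where p: "q = [:- x, 1:] * p" by (auto simp: poly_eq_0_iff_dvd elim!: dvdE)
  have "p \<noteq> 0" using p Suc.prems(1) by auto
  have deg: "degree q = Suc (degree p)"
    unfolding p using \<open>p \<noteq> 0\<close> by (subst degree_mult_eq) auto
  have lc: "lead_coeff q = lead_coeff p" unfolding p lead_coeff_mult by simp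
  define M where "M = norm (lead_coeff p) * (1 + B) ^ degree p"
  have IH: "norm (coeff p j) \<le> M" for j
    unfolding M_def using Suc.hyps(1)[of p j] Suc.hyps(2) Suc.prems(2) deg \<open>p \<noteq> 0\<close> by (auto simp: p)
  have M0: "M \<ge> 0" using IH[of 0] norm_ge_zero order_trans by blast
  have xB: "norm x \<le> B" using x Suc.prems(2) by blast
  have "coeff q i = (case i of 0 \<Rightarrow> 0 | Suc j \<Rightarrow> coeff p j) - x * coeff p i"
    by (simp add: p coeff_pCons split: nat.splits)
  then have "norm (coeff q i) \<le> norm (case i of 0 \<Rightarrow> 0 | Suc j \<Rightarrow> coeff p j) + norm (x * coeff p i)"
    by (simp add: norm_triangle_ineq4)
  also have "norm (case i of 0 \<Rightarrow> 0 | Suc j \<Rightarrow> coeff p j) \<le> M"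
    using IH M0 by (cases i) auto
  also have "norm (x * coeff p i) \<le> B * M"
    using xB IH[of i] B by (simp add: norm_mult mult_mono)
  finally have "norm (coeff q i) \<le> M + B * M" by simp
  also have "M + B * M = norm (lead_coeff q) * (1 + B) ^ degree q"
    unfolding lc unfolding M_def deg by (simp add: algebra_simps)
  finally show ?case .
qed

lemma finite_int_polys_bounded: "finite {g :: int poly. degree g \<le> D \<and> (\<forall>i. \<bar>coeff g i\<bar> \<le> M)}"
proof (rule finite_subset)
  let ?L = "{xs. set xs \<subseteq> {-M..M} \<and> length xs \<le> Suc D}"
  show "finite (Poly ` ?L)" by (intro finite_imageI finite_lists_length_le) simp
  show "{g :: int poly. degree g \<le> D \<and> (\<forall>i. \<bar>coeff g i\<bar> \<le> M)} \<subseteq> Poly ` ?L"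
  proof
    fix g :: "int poly" assume g: "g \<in> {g. degree g \<le> D \<and> (\<forall>i. \<bar>coeff g i\<bar> \<le> M)}"
    have "set (coeffs g) \<subseteq> {-M..M}"
    proof
      fix c assume "c \<in> set (coeffs g)"
      then obtain i where "c = coeff g i" by (auto simp: coeffs_def split: if_splits)
      with g have "\<bar>c\<bar> \<le> M" by auto
      then show "c \<in> {-M..M}" by auto
    qed
    moreover have "length (coeffs g) \<le> Suc D"
      using g by (cases "g = 0") (auto simp: length_coeffs_degree)
    moreover have "g = Poly (coeffs g)" by simp
    ultimately show "g \<in> Poly ` ?L" by blast
  qed
qed

definition int_poly :: "int poly \<Rightarrow> 'a::comm_ring_1 poly" where
  "int_poly g = map_poly of_int g"

lemma coeff_int_poly: "coeff (int_poly g) i = of_int (coeff g i)"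
  by (simp add: int_poly_def coeff_map_poly)

lemma int_poly_mult: "int_poly (p * q) = int_poly p * int_poly q"
  by (intro poly_eqI) (simp add: coeff_int_poly coeff_mult)

lemma int_poly_add: "int_poly (p + q) = int_poly p + int_poly q"
  by (intro poly_eqI) (simp add: coeff_int_poly)

lemma int_poly_smult: "int_poly (smult c p) = smult (of_int c) (int_poly p)"
  by (intro poly_eqI) (simp add: coeff_int_poly)

lemma int_poly_0 [simp]: "int_poly 0 = 0"
  by (simp add: int_poly_def)

lemma int_poly_dvd: "p dvd q \<Longrightarrow> int_poly p dvd int_poly q"
  by (auto simp: int_poly_mult elim!: dvdE)

lemma int_poly_pcompose: "int_poly (pcompose p q) = pcompose (int_poly p) (int_poly q)"
proof (induction p)
  case (pCons a p)
  have *: "int_poly (pCons b r) = pCons (of_int b) (int_poly r)" for b r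
    by (simp add: int_poly_def map_poly_pCons)
  show ?case
    using pCons.IH by (simp add: pcompose_pCons int_poly_add int_poly_mult *)
qed simp

lemma poly_int_poly_pcompose_monom:
  fixes x :: "'a::comm_ring_1"
  shows "poly (int_poly (pcompose p (monom 1 n))) x = poly (int_poly p) (x ^ n)"
proof -
  have "int_poly (monom 1 n) = (monom 1 n :: 'a poly)"
    by (simp add: int_poly_def map_poly_monom)
  then show ?thesis by (simp add: int_poly_pcompose poly_pcompose poly_monom)
qed

text \<open>The leading coefficient of a divisor $g$ of $f(x^n)$ divides that of $f$, and the complex roots of
$g$ are $n$-th roots of roots of $f$, so their absolute values are at most $\max(1, |z|)$ for a root $z$ of $f$.
Both bounds are independent of $n$.\<close>

theorem finite_int_divisors_of_power_substitutions:
  fixes f :: "int poly"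
  assumes "f \<noteq> 0"
  shows "finite {g. degree g \<le> D \<and> (\<exists>n\<ge>1. g dvd pcompose f (monom 1 n))}"
proof -
  let ?c = "int_poly :: int poly \<Rightarrow> complex poly"
  have c0: "?c g = 0 \<longleftrightarrow> g = 0" for g
    by (simp add: poly_eq_iff coeff_int_poly)
  have degc: "degree (?c g) = degree g" for g
    unfolding int_poly_def by (rule degree_map_poly) simp
  define B where "B = Max (insert 1 (norm ` {x. poly (?c f) x = 0}))"
  have fin: "finite {x. poly (?c f) x = 0}"
    by (rule poly_roots_finite) (simp add: c0 assms)
  have B1: "B \<ge> 1" unfolding B_def using fin by (intro Max_ge) auto
  have Broot: "norm x \<le> B" if "poly (?c f) x = 0" for x
    unfolding B_def using fin that by (intro Max_ge) auto
  define M where "M = \<lfloor>real_of_int \<bar>lead_coeff f\<bar> * (1 + B) ^ D\<rfloor>"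
  have "\<bar>coeff g i\<bar> \<le> M" if g: "degree g \<le> D" "n \<ge> 1" "g dvd pcompose f (monom 1 n)" for g n i
  proof -
    have "pcompose f (monom 1 n) \<noteq> 0"
      using assms g(2) by (subst pcompose_eq_0_iff) (simp_all add: degree_monom_eq)
    then have "g \<noteq> 0" using g(3) by auto
    have "lead_coeff (pcompose f (monom 1 n)) = lead_coeff f"
      using g(2) by (subst lead_coeff_comp) (simp_all add: degree_monom_eq)
    then have "lead_coeff g dvd lead_coeff f"
      using g(3) by (metis dvdE dvd_triv_left lead_coeff_mult)
    then have lc: "\<bar>lead_coeff g\<bar> \<le> \<bar>lead_coeff f\<bar>"
      using assms by (intro dvd_imp_le_int) auto
    have roots: "\<forall>x. poly (?c g) x = 0 \<longrightarrow> norm x \<le> B"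
    proof (intro allI impI)
      fix x assume "poly (?c g) x = 0"
      with int_poly_dvd[OF g(3), where 'a = complex]
      have "poly (?c (pcompose f (monom 1 n))) x = 0" by (auto elim!: dvdE)
      then have "poly (?c f) (x ^ n) = 0" by (simp only: poly_int_poly_pcompose_monom)
      then have le: "norm x ^ n \<le> B" using Broot[of "x ^ n"] by (simp add: norm_power)
      show "norm x \<le> B"
      proof (rule ccontr)
        assume "\<not> norm x \<le> B"
        then have "norm x > B" "norm x \<ge> 1" using B1 by auto
        moreover have "norm x ^ 1 \<le> norm x ^ n"
          using g(2) \<open>norm x \<ge> 1\<close> by (rule power_increasing)
        ultimately show False using le by simp
      qed
    qed
    have "norm (coeff (?c g) i) \<le> norm (lead_coeff (?c g)) * (1 + B) ^ degree (?c g)"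
      using B1 \<open>g \<noteq> 0\<close> by (intro complex_poly_coeff_bound roots) (simp_all add: c0)
    then have "real_of_int \<bar>coeff g i\<bar> \<le> real_of_int \<bar>lead_coeff g\<bar> * (1 + B) ^ degree g"
      by (simp add: degc coeff_int_poly)
    also have "\<dots> \<le> real_of_int \<bar>lead_coeff f\<bar> * (1 + B) ^ D"
      using lc B1 g(1) by (intro mult_mono power_increasing) auto
    finally show ?thesis unfolding M_def by (simp add: le_floor_iff)
  qed
  then have "{g. degree g \<le> D \<and> (\<exists>n\<ge>1. g dvd pcompose f (monom 1 n))} \<subseteq>
      {g. degree g \<le> D \<and> (\<forall>i. \<bar>coeff g i\<bar> \<le> M)}" by blast
  then show ?thesis by (rule finite_subset) (rule finite_int_polys_bounded)
qed

section \<open>Finite extensions of the rationals\<close>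

lemma embedding_of_nat: "field_embedding h \<Longrightarrow> h (of_nat n) = of_nat n"
  by (induction n) (simp_all add: embedding_0 embedding_1 embedding_add)

lemma embedding_of_int: "field_embedding h \<Longrightarrow> h (of_int n) = of_int n"
  by (cases n rule: int_cases2) (simp_all add: embedding_of_nat embedding_uminus)

context
  fixes h :: "rat \<Rightarrow> 'l::field"
  assumes h: "field_embedding h"
begin

lemma of_int_eq_0_iff_embedding: "(of_int n :: 'l) = 0 \<longleftrightarrow> n = 0"
proof -
  have "(of_int n :: 'l) = h (of_int n)" by (rule embedding_of_int[OF h, symmetric])
  then show ?thesis by (simp only: embedding_eq_0_iff[OF h] of_int_eq_0_iff)
qed

lemma int_poly_eq_0_iff: "(int_poly g :: 'l poly) = 0 \<longleftrightarrow> g = 0"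
  by (simp add: poly_eq_iff coeff_int_poly of_int_eq_0_iff_embedding)

lemma degree_int_poly: "degree (int_poly g :: 'l poly) = degree g"
  unfolding int_poly_def by (rule degree_map_poly) (simp add: of_int_eq_0_iff_embedding)

lemma clear_int_denominators:
  "T \<in> polys_over (range h) \<Longrightarrow> \<exists>d U. d \<noteq> 0 \<and> int_poly U = smult (of_int d) T"
proof (induction T)
  case 0
  then show ?case by (intro exI[of _ 1] exI[of _ 0]) simp
next
  case (pCons a T)
  then obtain d U where dU: "d \<noteq> 0" "int_poly U = smult (of_int d) T" and "a \<in> range h"
    by (auto simp: polys_over_pCons_iff[OF subfield_range[OF h]])
  then obtain r where r: "a = h r" by auto
  obtain p q where pq: "r = of_int p / of_int q" "q \<noteq> 0"
    by (metis quotient_of_unique quotient_of_denom_pos quotient_of_div less_int_code(1) surjective_pairing)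
  have "h r * h (of_int q) = h (of_int p)"
    using pq by (simp add: embedding_mult[OF h, symmetric])
  then have qa: "of_int q * a = of_int p" by (simp add: r embedding_of_int[OF h] mult.commute)
  have "int_poly (pCons (d * p) (smult q U)) = pCons (of_int (d * p)) (smult (of_int q) (int_poly U))"
    by (simp add: int_poly_def map_poly_pCons int_poly_smult[unfolded int_poly_def])
  also have "\<dots> = smult (of_int (d * q)) (pCons a T)"
    using qa by (simp add: dU(2) mult.assoc mult.commute)
  finally show ?case using dU pq by (intro exI[of _ "d * q"] exI[of _ "pCons (d * p) (smult q U)"]) simp
qed

text \<open>Gauss's lemma over the integers: a primitive polynomial of least degree vanishing at $y$ divides,
by pseudo-division, a constant multiple of every other one, and the constant can be cancelled.\<close>

lemma int_min_poly:
  assumes T: "T \<noteq> 0" "poly (int_poly T) (y :: 'l) = 0"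
  obtains g where "g \<noteq> 0" "degree g \<le> degree T" "poly (int_poly g) y = 0"
    "\<And>f. poly (int_poly f) y = 0 \<Longrightarrow> g dvd f"
proof -
  obtain g0 where g0: "g0 \<noteq> 0" "poly (int_poly g0) y = 0"
    and min: "\<And>f. f \<noteq> 0 \<Longrightarrow> poly (int_poly f) y = 0 \<Longrightarrow> degree g0 \<le> degree f"
    using ex_has_least_nat[of "\<lambda>f. f \<noteq> 0 \<and> poly (int_poly f) y = 0" T degree] T by blast
  define g where "g = primitive_part g0"
  have g: "g \<noteq> 0" "content g = 1" "degree g = degree g0" using g0 by (simp_all add: g_def)
  have "int_poly g0 = smult (of_int (content g0)) (int_poly g :: 'l poly)"
    unfolding g_def by (simp add: int_poly_smult[symmetric])
  then have gy: "poly (int_poly g) y = 0"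
    using g0 by (simp add: of_int_eq_0_iff_embedding)
  have "g dvd f" if f: "poly (int_poly f) y = 0" for f
  proof -
    obtain q r where qr: "pseudo_divmod f g = (q, r)" by (cases "pseudo_divmod f g")
    define c where "c = lead_coeff g ^ (Suc (degree f) - degree g)"
    have eq: "smult c f = g * q + r" and deg: "r = 0 \<or> degree r < degree g"
      using pseudo_divmod[OF g(1) qr] by (simp_all add: c_def)
    have "int_poly (smult c f) = int_poly g * int_poly q + (int_poly r :: 'l poly)"
      by (simp add: eq int_poly_add int_poly_mult)
    then have "poly (int_poly (smult c f)) y = poly (int_poly r) y" by (simp add: gy)
    then have "poly (int_poly r) y = 0" by (simp add: int_poly_smult f)
    then have "r = 0" using min[of r] deg g(3) by fastforce
    then have eq: "smult c f = g * q" using eq by simp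
    have "c \<noteq> 0" using g(1) by (simp add: c_def)
    have "content (smult c f) = content q" unfolding eq content_mult by (simp add: g(2))
    then have "c dvd content q" by (metis content_smult dvd_normalize_iff dvd_triv_left normalize_dvd_iff)
    then have "[:c:] dvd q" using const_poly_dvd_iff_dvd_content by blast
    then obtain q' where "q = [:c:] * q'" by (elim dvdE)
    then have "smult c f = smult c (g * q')" using eq by (simp add: mult_ac)
    then have "f = g * q'" using \<open>c \<noteq> 0\<close> by (simp add: poly_eq_iff)
    then show ?thesis by simp
  qed
  then show ?thesis using that[of g] g gy min[OF T] by simp
qed

context
  fixes K B :: "'l set"
  assumes K: "is_subfield K" and B: "finite B" "K \<subseteq> span_over (range h) B"
begin

lemma finite_extension_int_poly:
  assumes y: "y \<in> K"
  obtains U where "U \<noteq> 0" "degree U \<le> card B" "poly (int_poly U) y = 0"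
proof -
  have "y ^ i \<in> span_over (range h) B" for i
    using B(2) subfield_power[OF K y] by blast
  then obtain T where T: "T \<in> polys_over (range h)" "T \<noteq> 0" "degree T \<le> card B" "poly T y = 0"
    using algebraic_if_powers_in_span[OF subfield_range[OF h] B(1)] by metis
  obtain d U where U: "d \<noteq> 0" "int_poly U = smult (of_int d) T"
    using clear_int_denominators[OF T(1)] by blast
  have "U \<noteq> 0" using U T(2) by (metis int_poly_0 smult_eq_0_iff of_int_eq_0_iff_embedding)
  moreover have "degree U \<le> card B"
    using T(3) U degree_int_poly[of U] by (simp add: of_int_eq_0_iff_embedding)
  ultimately show ?thesis using that[of U] U(2) T(4) by simp
qed

lemma finite_roots_of_power_substitutions:
  assumes f: "f \<noteq> 0"
  shows "finite {y \<in> K. \<exists>n\<ge>1. poly (int_poly f) (y ^ n) = 0}"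
proof (rule finite_subset)
  define G where "G = {g. degree g \<le> card B \<and> (\<exists>n\<ge>1. g dvd pcompose f (monom 1 n))}"
  have "finite G" unfolding G_def by (rule finite_int_divisors_of_power_substitutions[OF f])
  then show "finite (\<Union>g\<in>G - {0}. {y :: 'l. poly (int_poly g) y = 0})"
    by (intro finite_UN_I poly_roots_finite) (auto simp: int_poly_eq_0_iff)
  show "{y \<in> K. \<exists>n\<ge>1. poly (int_poly f) (y ^ n) = 0} \<subseteq> (\<Union>g\<in>G - {0}. {y. poly (int_poly g) y = 0})"
  proof
    fix y assume "y \<in> {y \<in> K. \<exists>n\<ge>1. poly (int_poly f) (y ^ n) = 0}"
    then obtain n where y: "y \<in> K" "n \<ge> 1" "poly (int_poly (pcompose f (monom 1 n))) y = 0"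
      by (auto simp: poly_int_poly_pcompose_monom)
    obtain U where U: "U \<noteq> 0" "degree U \<le> card B" "poly (int_poly U) y = 0"
      by (rule finite_extension_int_poly[OF y(1)])
    obtain g where g: "g \<noteq> 0" "degree g \<le> degree U" "poly (int_poly g) y = 0"
        "\<And>f. poly (int_poly f) y = 0 \<Longrightarrow> g dvd f"
      by (rule int_min_poly[OF U(1,3)]) blast
    have "g \<in> G" unfolding G_def using g U(2) y by auto
    with g show "y \<in> (\<Union>g\<in>G - {0}. {y. poly (int_poly g) y = 0})" by auto
  qed
qed

text \<open>Roots of unity are the elements some power of which is a root of $x - 1$.\<close>

lemma finite_torsion_finite_extension: "finite {z \<in> K. root_of_unity z}"
proof (rule finite_subset)
  show "finite {y \<in> K. \<exists>n\<ge>1. poly (int_poly [:-1, 1:]) (y ^ n) = 0}"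
    by (rule finite_roots_of_power_substitutions) simp
  have "poly (int_poly [:-1, 1:]) x = x - 1" for x :: 'l
    by (simp add: int_poly_def map_poly_pCons)
  then show "{z \<in> K. root_of_unity z} \<subseteq> {y \<in> K. \<exists>n\<ge>1. poly (int_poly [:-1, 1:]) (y ^ n) = 0}"
    by (auto simp: root_of_unity_def)
qed

end

end

lemma common_exponent:
  assumes "finite Z" "\<And>z. z \<in> Z \<Longrightarrow> root_of_unity z"
  shows "\<exists>w\<ge>1. \<forall>z\<in>Z. z ^ w = 1"
  using assms
proof (induction Z rule: finite_induct)
  case (insert z Z)
  then obtain w where w: "w \<ge> 1" "\<forall>z\<in>Z. z ^ w = 1" by auto
  obtain n where n: "n \<ge> 1" "z ^ n = 1" using insert.prems[of z] by (auto simp: root_of_unity_def)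
  have "z ^ (w * n) = 1" using n by (simp add: mult.commute[of w] power_mult)
  moreover have "y ^ (w * n) = 1" if "y \<in> Z" for y using w that by (simp add: power_mult)
  ultimately show ?case using w n by (intro exI[of _ "w * n"]) auto
qed auto

text \<open>Raising $y^n = z a$ to a common exponent $w$ of the roots of unity in $K$ gives
$y^{nw} = a^w$. This leaves finitely many $y$, and each $y$ belongs to only one $n$, because $y$
is not a root of unity.\<close>

lemma exponents_bounded_finite_extension:
  fixes h :: "rat \<Rightarrow> 'l::field"
  assumes h: "field_embedding h" and K: "is_subfield K"
    and B: "finite B" "K \<subseteq> span_over (range h) B"
    and a: "a \<in> K" "a \<noteq> 0" "\<not> root_of_unity a"
  shows "\<exists>C. exponents_bounded K a C"
proof -
  obtain w where w: "w \<ge> 1" "\<And>z. z \<in> K \<Longrightarrow> root_of_unity z \<Longrightarrow> z ^ w = 1"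
    using common_exponent[OF finite_torsion_finite_extension[OF h K B]] by blast
  obtain f where f: "f \<noteq> 0" "degree f \<le> card B" "poly (int_poly f) (a ^ w) = 0"
    by (rule finite_extension_int_poly[OF h K B subfield_power[OF K a(1)]])
  define N where "N = {n. n \<ge> 1 \<and> (\<exists>y\<in>K. \<exists>z\<in>K. root_of_unity z \<and> y ^ n = z * a)}"
  have "\<forall>n\<in>N. \<exists>y\<in>K. y ^ (n * w) = a ^ w"
  proof
    fix n assume "n \<in> N"
    then obtain y z where y: "y \<in> K" "z \<in> K" "root_of_unity z" "y ^ n = z * a"
      by (auto simp: N_def)
    have "y ^ (n * w) = a ^ w" by (simp add: power_mult y(4) power_mult_distrib w(2)[OF y(2,3)])
    with y(1) show "\<exists>y\<in>K. y ^ (n * w) = a ^ w" by blast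
  qed
  then obtain y where y: "\<And>n. n \<in> N \<Longrightarrow> y n \<in> K \<and> y n ^ (n * w) = a ^ w"
    by metis
  have neq: "y m \<noteq> y n" if mn: "m \<in> N" "n \<in> N" "m < n" for m n
  proof
    assume eq: "y m = y n"
    have "y m ^ (m * w) * y m ^ ((n - m) * w) = y n ^ (n * w)"
      using mn(3) by (simp add: eq power_add[symmetric] distrib_right[symmetric])
    then have "a ^ w * y m ^ ((n - m) * w) = a ^ w" using y mn by simp
    then have "y m ^ ((n - m) * w) = 1" using a(2) by simp
    then have "root_of_unity (y m)"
      unfolding root_of_unity_def using mn(3) w(1) by (intro exI[of _ "(n - m) * w"]) simp
    then have "root_of_unity (a ^ w)" using y[OF mn(1)] root_of_unity_power by metis
    then show False using root_of_unity_of_power[OF w(1)] a(3) by blast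
  qed
  have "inj_on y N"
    using neq by (intro inj_onI) (metis linorder_neqE_nat)
  moreover have "y ` N \<subseteq> {y \<in> K. \<exists>n\<ge>1. poly (int_poly f) (y ^ n) = 0}"
  proof
    fix u assume "u \<in> y ` N"
    then obtain n where n: "n \<in> N" "u = y n" by auto
    then have "n * w \<ge> 1" using w(1) by (simp add: N_def)
    moreover have "poly (int_poly f) (u ^ (n * w)) = 0" using y[OF n(1)] f(3) by (simp add: n(2))
    ultimately show "u \<in> {y \<in> K. \<exists>n\<ge>1. poly (int_poly f) (y ^ n) = 0}" using y[OF n(1)] n(2) by blast
  qed
  then have "finite (y ` N)"
    by (rule finite_subset) (rule finite_roots_of_power_substitutions[OF h K B f(1)])
  ultimately have "finite N" by (rule finite_imageD[rotated])
  then have "n \<le> Max N" if "n \<in> N" for n using that by simp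
  then show ?thesis unfolding exponents_bounded_def N_def by blast
qed

theorem good_heredity_rat: "good_heredity TYPE(rat)"
proof -
  let ?h = "to_ac :: rat \<Rightarrow> rat alg_closure"
  note h = field_embedding_to_ac[where 'a = rat]
  note R = subfield_range[OF h]
  have "good_heredity_in (range ?h)"
    unfolding good_heredity_in_def
  proof (intro ballI impI)
    fix P assume P: "P \<in> polys_over (range ?h)" "no_torsion_root P"
    show "\<exists>r. \<forall>n\<ge>1. factors_at_most (range ?h) r (subst_power n P)"
    proof (rule factors_bounded_if_exponents_bounded[OF R P])
      fix a assume a: "poly P a = 0"
      then have a': "a \<noteq> 0" "\<not> root_of_unity a" using P(2) unfolding no_torsion_root_def by auto
      have "algebraic_over (range ?h) a"
        using a P(1) no_torsion_root_nonzero[OF P(2)] unfolding algebraic_over_iff by blast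
      then obtain B where B: "finite B" "is_subfield hull (insert a (range ?h)) \<subseteq> span_over (range ?h) B"
        by (rule algebraic_simple_extension_span[OF R])
      have sub: "insert a (range ?h) \<subseteq> is_subfield hull (insert a (range ?h))" by (rule hull_subset)
      then have "\<exists>C. exponents_bounded (is_subfield hull (insert a (range ?h))) a C"
        using a' by (intro exponents_bounded_finite_extension[OF h subfield_hull B]) auto
      then show "\<exists>K C. is_subfield K \<and> range ?h \<subseteq> K \<and> a \<in> K \<and> exponents_bounded K a C"
        using sub subfield_hull by blast
    qed
  qed
  then show ?thesis using good_heredity_iff_range[OF h] by simp
qed

section \<open>Algebraic closures of finite prime fields\<close>

lemma finite_span_over:
  assumes "finite K" "finite B"
  shows "finite (span_over K B)"
proof (rule finite_subset)
  show "finite ((\<lambda>c. \<Sum>b\<in>B. c b * b) ` (B \<rightarrow>\<^sub>E K))"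
    using assms by (intro finite_imageI finite_PiE)
  show "span_over K B \<subseteq> (\<lambda>c. \<Sum>b\<in>B. c b * b) ` (B \<rightarrow>\<^sub>E K)"
  proof
    fix x assume "x \<in> span_over K B"
    then obtain c where c: "\<forall>b\<in>B. c b \<in> K" "x = (\<Sum>b\<in>B. c b * b)"
      by (auto simp: span_over_def)
    have "x = (\<Sum>b\<in>B. restrict c B b * b)" unfolding c(2) by (intro sum.cong) auto
    moreover have "restrict c B \<in> B \<rightarrow>\<^sub>E K" using c(1) by auto
    ultimately show "x \<in> (\<lambda>c. \<Sum>b\<in>B. c b * b) ` (B \<rightarrow>\<^sub>E K)" by blast
  qed
qed

lemma finite_simple_extension:
  assumes k: "is_subfield k" "finite k" and x: "algebraic_over k x"
  shows "finite (is_subfield hull (insert x k))"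
proof -
  obtain B where "finite B" "is_subfield hull (insert x k) \<subseteq> span_over k B"
    by (rule algebraic_simple_extension_span[OF k(1) x])
  then show ?thesis using finite_span_over[OF k(2)] finite_subset by blast
qed

text \<open>The powers of $x$ lie in a finite field, so two of them coincide.\<close>

lemma algebraic_over_finite_imp_torsion:
  assumes k: "is_subfield k" "finite k" and x: "algebraic_over k x"
  shows "x = 0 \<or> root_of_unity x"
proof (rule disjCI)
  assume nr: "\<not> root_of_unity x"
  have "x \<in> is_subfield hull (insert x k)" by (rule hull_inc) simp
  then have "range (\<lambda>n. x ^ n) \<subseteq> is_subfield hull (insert x k)"
    using subfield_power[OF subfield_hull] by blast
  then have "finite (range (\<lambda>n. x ^ n))"
    using finite_simple_extension[OF k x] finite_subset by blast
  then have "\<not> inj (\<lambda>n. x ^ n)" using finite_imageD infinite_UNIV_nat by blast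
  then obtain m n where "x ^ m = x ^ n" "m \<noteq> n" by (auto simp: inj_def)
  then obtain m n where mn: "x ^ m = x ^ n" "m < n" by (metis linorder_neqE_nat)
  have "x ^ m * x ^ (n - m) = x ^ (m + (n - m))" by (rule power_add[symmetric])
  also have "\<dots> = x ^ m" using mn by simp
  finally have "x ^ m * x ^ (n - m) = x ^ m" .
  then have "x ^ m = 0 \<or> x ^ (n - m) = 1" by simp
  moreover have "x ^ (n - m) \<noteq> 1"
    using nr mn(2) unfolding root_of_unity_def by (auto dest: spec[of _ "n - m"])
  ultimately show "x = 0" by simp
qed

text \<open>Only constant polynomials satisfy the hypothesis on the roots.\<close>

lemma good_heredity_in_if_torsion:
  fixes K :: "'l::alg_closed_field set"
  assumes "\<And>x. algebraic_over K x \<Longrightarrow> x = 0 \<or> root_of_unity x"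
  shows "good_heredity_in K"
  unfolding good_heredity_in_def
proof (intro ballI impI)
  fix P assume P: "P \<in> polys_over K" "no_torsion_root P"
  have P0: "P \<noteq> 0" by (rule no_torsion_root_nonzero[OF P(2)])
  have deg: "degree P = 0"
  proof (rule ccontr)
    assume "degree P \<noteq> 0"
    then obtain x where x: "poly P x = 0" using alg_closed_imp_poly_has_root[of P] by auto
    then have "algebraic_over K x" using P P0 by (auto simp: algebraic_over_iff)
    with assms x P(2) show False unfolding no_torsion_root_def by blast
  qed
  have "factors_at_most K 0 (subst_power n P)" if "n \<ge> 1" for n
    unfolding factors_at_most_def
  proof (intro allI impI)
    fix Qs assume Qs: "\<forall>Q\<in>set Qs. degree Q > 0" "prod_list Qs dvd subst_power n P"
    have nz: "subst_power n P \<noteq> 0" using P0 that by (simp add: subst_power_eq_0_iff)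
    have "degree Q = 0" if "Q \<in> set Qs" for Q
    proof -
      have "Q dvd prod_list Qs" using that by (auto simp: in_set_conv_decomp)
      then have "degree Q \<le> degree (subst_power n P)"
        using Qs(2) nz by (meson dvd_imp_degree_le dvd_trans)
      then show ?thesis using deg by (simp add: degree_subst_power)
    qed
    then show "length Qs \<le> 0" using Qs(1) by (cases Qs) auto
  qed
  then show "\<exists>r. \<forall>n\<ge>1. factors_at_most K r (subst_power n P)" by blast
qed

lemma good_heredity_iff_UNIV:
  "good_heredity TYPE('l::alg_closed_field) \<longleftrightarrow> good_heredity_in (UNIV :: 'l set)"
  using good_heredity_iff_range[of "\<lambda>x :: 'l. x"] by (simp add: field_embedding_def)

theorem good_heredity_Fp_alg_closure:
  assumes p: "prime p" and "is_Fp_alg_closure p TYPE('a::alg_closed_field)"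
  shows "good_heredity TYPE('a)"
proof -
  obtain k :: "'a set" where k: "is_subfield k" "card k = p" "\<And>x. algebraic_over k x"
    using assms(2) unfolding is_Fp_alg_closure_def by blast
  have "finite k" using k(2) p by (metis card.infinite not_prime_0)
  then have "x = 0 \<or> root_of_unity x" for x :: 'a
    using algebraic_over_finite_imp_torsion[OF k(1)] k(3) by blast
  then show ?thesis
    unfolding good_heredity_iff_UNIV by (intro good_heredity_in_if_torsion)
qed

text \<open>The polynomials $x^n - a$ split into $n$ linear factors, so their factor counts are unbounded.\<close>

lemma torsion_if_good_heredity:
  fixes x :: "'b::alg_closed_field"
  assumes "good_heredity TYPE('b)"
  shows "x = 0 \<or> root_of_unity x"
proof (rule ccontr)
  assume x: "\<not> ?thesis"
  have "no_torsion_root [:- x, 1:]" using x by (auto simp: no_torsion_root_def)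
  moreover have "[:- x, 1:] \<in> polys_over UNIV" by (simp add: polys_over_def)
  ultimately obtain r where r: "\<And>n. n \<ge> 1 \<Longrightarrow> factors_at_most UNIV r (subst_power n [:- x, 1:])"
    using assms unfolding good_heredity_iff_UNIV good_heredity_in_def by blast
  let ?P = "subst_power (Suc r) [:- x, 1:]"
  have "?P \<noteq> 0" by (subst subst_power_eq_0_iff) auto
  then obtain A where A: "size A = degree ?P" "?P = smult (lead_coeff ?P) (\<Prod>x\<in>#A. [:- x, 1:])"
    using alg_closed_imp_factorization by blast
  obtain xs where xs: "mset xs = A" using ex_mset by blast
  define Qs where "Qs = map (\<lambda>x. [:- x, 1:]) xs"
  have "(\<Prod>x\<in>#A. [:- x, 1:]) = prod_list Qs"
    by (simp add: Qs_def xs[symmetric] prod_mset_prod_list[symmetric] del: prod_mset_prod_list)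
  then have "prod_list Qs dvd ?P" by (subst A(2)) (simp add: dvd_smult)
  then have "length Qs \<le> r"
    by (intro factors_at_mostD[OF r]) (auto simp: Qs_def polys_over_def)
  moreover have "length Qs = size A" by (simp add: Qs_def xs[symmetric])
  ultimately show False by (simp add: A(1) degree_subst_power)
qed

lemma of_nat_eq_iff_mod_CHAR:
  "(of_nat m :: 'b::field) = of_nat n \<longleftrightarrow> m mod CHAR('b) = n mod CHAR('b)"
proof (induction m n rule: linorder_wlog)
  case (le m n)
  have "(of_nat n :: 'b) = of_nat m + of_nat (n - m)" using le by (simp flip: of_nat_add)
  then have "(of_nat m :: 'b) = of_nat n \<longleftrightarrow> (of_nat (n - m) :: 'b) = 0" by auto
  also have "\<dots> \<longleftrightarrow> n mod CHAR('b) = m mod CHAR('b)"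
    using le by (simp only: of_nat_eq_0_iff_char_dvd mod_eq_dvd_iff_nat)
  finally show ?case by auto
qed auto

text \<open>All elements being zero or roots of unity, the characteristic is positive because $2$ is neither in
characteristic zero, and the multiples of $1$ form a field because inverses of roots of
unity are powers.\<close>

theorem Fp_alg_closure_if_good_heredity:
  assumes "good_heredity TYPE('b::alg_closed_field)"
  shows "\<exists>p. prime p \<and> is_Fp_alg_closure p TYPE('b)"
proof -
  note tors = torsion_if_good_heredity[OF assms]
  let ?p = "CHAR('b)"
  have "?p > 0"
  proof (rule ccontr)
    assume "\<not> ?p > 0"
    then have inj: "(of_nat m :: 'b) = of_nat n \<longleftrightarrow> m = n" for m n
      by (simp add: of_nat_eq_iff_mod_CHAR)
    have "(of_nat 2 :: 'b) \<noteq> 0" using inj[of 2 0] by simp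
    then obtain n where n: "n \<ge> 1" "(of_nat 2 :: 'b) ^ n = 1"
      using tors[of "of_nat 2"] unfolding root_of_unity_def by blast
    then have "(of_nat (2 ^ n) :: 'b) = of_nat 1" by simp
    then have "(2::nat) ^ n = 1" by (simp only: inj)
    with n show False by simp
  qed
  then have p: "prime ?p" by (rule prime_CHAR_semidom)
  define k where "k = range (of_nat :: nat \<Rightarrow> 'b)"
  have "is_subfield k"
    unfolding is_subfield_def
  proof (intro conjI ballI)
    show "0 \<in> k" "1 \<in> k" unfolding k_def using rangeI[of of_nat 0] rangeI[of of_nat 1] by simp_all
    fix x assume "x \<in> k"
    then obtain m where m: "x = of_nat m" by (auto simp: k_def)
    have "x + of_nat ((?p - 1) * m) = of_nat (?p * m)"
      using \<open>?p > 0\<close> by (simp add: m flip: of_nat_add of_nat_mult add: algebra_simps diff_mult_distrib)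
    also have "\<dots> = 0" by simp
    finally have "- x = of_nat ((?p - 1) * m)" by (simp add: minus_unique)
    then show "- x \<in> k" unfolding k_def by (rule range_eqI)
    show "inverse x \<in> k"
    proof (cases "x = 0")
      case False
      then obtain n where n: "n \<ge> 1" "x ^ n = 1" using tors[of x] unfolding root_of_unity_def by blast
      then have "x * x ^ (n - 1) = 1" by (simp flip: power_Suc)
      then have "inverse x = of_nat (m ^ (n - 1))" by (simp add: m inverse_unique)
      then show ?thesis unfolding k_def by (rule range_eqI)
    qed (simp add: \<open>0 \<in> k\<close>)
    fix y assume "y \<in> k"
    then obtain m' where m': "y = of_nat m'" by (auto simp: k_def)
    have "x + y = of_nat (m + m')" "x * y = of_nat (m * m')" by (simp_all add: m m')
    then show "x + y \<in> k" "x * y \<in> k" unfolding k_def by (blast intro: range_eqI)+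
  qed
  moreover have "card k = ?p"
  proof -
    have "k = of_nat ` {..<?p}"
    proof
      show "k \<subseteq> of_nat ` {..<?p}"
      proof
        fix x assume "x \<in> k"
        then obtain m where m: "x = of_nat m" by (auto simp: k_def)
        have "x = of_nat (m mod ?p)" unfolding m of_nat_eq_iff_mod_CHAR by simp
        moreover have "m mod ?p < ?p" using \<open>?p > 0\<close> by simp
        ultimately show "x \<in> of_nat ` {..<?p}" by blast
      qed
    qed (auto simp: k_def)
    moreover have "inj_on (of_nat :: nat \<Rightarrow> 'b) {..<?p}"
      by (intro inj_onI) (auto simp: of_nat_eq_iff_mod_CHAR)
    ultimately show ?thesis by (simp add: card_image)
  qed
  moreover have "algebraic_over k x" for x
  proof -
    obtain j where j: "j \<ge> 1" "x ^ Suc j = x" using tors[of x] torsion_iff[of x] by blast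
    then show ?thesis
      using torsion_poly_over[OF \<open>is_subfield k\<close>, of j] torsion_poly_nonzero[OF j(1)]
        poly_torsion_poly[of j x] unfolding algebraic_over_iff by blast
  qed
  ultimately show ?thesis using p unfolding is_Fp_alg_closure_def by blast
qed

section \<open>Global fields\<close>

lemma finite_over_iff: "finite_over K \<longleftrightarrow> (\<exists>B. finite B \<and> UNIV \<subseteq> span_over K B)"
  by (auto simp: finite_over_def span_over_def)

lemma hull_eq_UNIV_if_finite_over:
  assumes "K \<subseteq> is_subfield hull S" "UNIV \<subseteq> span_over K B"
  shows "is_subfield hull (S \<union> B) = UNIV"
proof -
  have "x \<in> is_subfield hull (S \<union> B)" for x
  proof -
    obtain c where c: "\<forall>b\<in>B. c b \<in> K" "x = (\<Sum>b\<in>B. c b * b)"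
      using assms(2) by (auto simp: span_over_def)
    have "is_subfield hull S \<subseteq> is_subfield hull (S \<union> B)" by (rule hull_mono) simp
    with c(1) assms(1) show ?thesis
      unfolding c(2)
      by (intro subfield_sum[OF subfield_hull] subfield_mult[OF subfield_hull]) (auto intro: hull_inc)
  qed
  then show ?thesis by blast
qed

text \<open>With $m = m'g$, $n = n'g$ for $g = \gcd(m,n)$ and $m'u = n'v + 1$, the quotient $y^u/x^v$ has the
required power, since $\mathrm{lcm}(m,n) = n m' = m n'$.\<close>

lemma root_exponents_lcm:
  fixes a :: "'a::field"
  assumes "x ^ m = a" "y ^ n = a" "a \<noteq> 0" "m \<ge> 1" "n \<ge> 1"
  shows "\<exists>z. z ^ lcm m n = a"
proof -
  define g where "g = gcd m n"
  have "g > 0" using assms by (simp add: g_def)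
  obtain m' n' where mn: "m = m' * g" "n = n' * g" "coprime m' n'"
    using gcd_coprime_exists[of m n] \<open>g > 0\<close> unfolding g_def by blast
  have l1: "lcm m n = n * m'" if "lcm m n = m' * n' * g" using that mn(2) by (metis mult.assoc mult.commute)
  have l2: "lcm m n = m * n'" if "lcm m n = m' * n' * g" using that mn(1) by (metis mult.assoc mult.commute)
  have "m' \<noteq> 0" using mn assms(4) by (cases "m' = 0") simp_all
  have "lcm m n * g = m * n" unfolding g_def by (simp add: lcm_mult_gcd)
  also have "m * n = m' * n' * g * g" by (subst mn(1), subst mn(2)) (simp add: mult_ac)
  finally have "lcm m n * g = m' * n' * g * g" .
  then have l: "lcm m n = m' * n' * g" using \<open>g > 0\<close> by simp
  obtain u v where uv: "m' * u = n' * v + 1"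
    using bezout_nat[of m' n'] \<open>m' \<noteq> 0\<close> mn(3) by auto
  have "(y ^ u) ^ lcm m n = (y ^ n) ^ (m' * u)"
    unfolding l1[OF l] by (simp add: power_mult[symmetric] mult_ac)
  moreover have "(x ^ v) ^ lcm m n = (x ^ m) ^ (n' * v)"
    unfolding l2[OF l] by (simp add: power_mult[symmetric] mult_ac)
  ultimately have "(y ^ u / x ^ v) ^ lcm m n = a"
    using assms(3) by (simp add: power_divide assms(1,2) uv)
  then show ?thesis by blast
qed

lemma monom_minus_1_dvd:
  assumes "m dvd n"
  shows "(monom 1 m - 1 :: 'a::field poly) dvd monom 1 n - 1"
proof -
  obtain k where k: "n = m * k" using assms by (elim dvdE)
  have "monom 1 n = (monom 1 m :: 'a poly) ^ k" by (simp add: k monom_power)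
  then show ?thesis by (simp add: power_diff_1_eq)
qed

text \<open>If infinitely many $x^n = a$ were solvable, the exponents, being closed under least common
multiples, would contain divisibility chains $n_1 \mid n_2 \mid \dots \mid n_j$ of any length $j$. Each step of the
chain adds a nonconstant factor to $x^{n_j} - 1$, and the substitution $x \mapsto x/b$ with
$b^{n_j} = a$ turns these into factors of $x^{n_j} - a$.\<close>

theorem rootless_if_good_heredity:
  assumes gh: "good_heredity TYPE('c::field)"
  shows "rootless TYPE('c)"
  unfolding rootless_def
proof (intro allI impI)
  fix a :: 'c assume a: "a \<noteq> 0" "\<not> root_of_unity a"
  have "map_poly to_ac [:- a, 1:] = [:- to_ac a, 1:]" by (simp add: map_poly_pCons)
  moreover have "\<not> root_of_unity (to_ac a)"
    using a(2) unfolding root_of_unity_def by (simp flip: to_ac_power to_ac_1 del: to_ac_1 to_ac_power)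
  ultimately have "poly_good_heredity [:- a, 1:]"
    using gh a unfolding good_heredity_def by auto
  then obtain r where r: "\<And>n. n \<ge> 1 \<Longrightarrow> factors_at_most UNIV r (subst_power n [:- a, 1:])"
    using poly_good_heredity_imp_bounded by blast
  define N where "N = {n. n \<ge> 1 \<and> (\<exists>x. x ^ n = a)}"
  have "finite N"
  proof (rule ccontr)
    assume inf: "infinite N"
    have "\<exists>n\<in>N. \<exists>Qs. length Qs = j \<and> (\<forall>Q\<in>set Qs. degree Q > 0) \<and>
        prod_list Qs dvd (monom 1 n - 1 :: 'c poly)" for j
    proof (induction j)
      case 0
      obtain n where "n \<in> N" using inf by fastforce
      then show ?case by (intro bexI[of _ n] exI[of _ "[]"]) auto
    next
      case (Suc j)
      then obtain n Qs where n: "n \<in> N" and Qs: "length Qs = j" "\<forall>Q\<in>set Qs. degree Q > 0"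
          "prod_list Qs dvd (monom 1 n - 1 :: 'c poly)" by blast
      obtain m where m: "m \<in> N" "m > n" using inf by (meson infinite_nat_iff_unbounded)
      define l where "l = lcm n m"
      have l: "l \<in> N" "n < l"
        using n m root_exponents_lcm[of _ n a _ m] a(1) dvd_imp_le[of m "lcm n m"]
        unfolding N_def l_def by (auto simp: lcm_pos_nat Suc_le_eq)
      obtain S :: "'c poly" where S: "monom 1 l - 1 = (monom 1 n - 1) * S"
        using monom_minus_1_dvd[of n l] by (auto simp: l_def elim: dvdE)
      have deg: "degree (monom 1 i - 1 :: 'c poly) = i" if "i \<ge> 1" for i
        using that degree_add_eq_left[of "-1" "monom 1 i :: 'c poly"] by (simp add: degree_monom_eq)
      have "degree S > 0"
      proof (rule Nat.gr0I)
        assume "degree S = 0"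
        then have "degree ((monom 1 n - 1) * S) \<le> n"
          using degree_mult_le[of "monom 1 n - 1" S] deg[of n] n by (simp add: N_def)
        then show False using S deg[of l] l n by (simp add: N_def)
      qed
      then show ?case
        using Qs l S by (intro bexI[of _ l] exI[of _ "S # Qs"])
          (auto simp: mult.commute[of S] intro!: mult_dvd_mono)
    qed
    then obtain n Qs where n: "n \<in> N" and Qs: "length Qs = Suc r" "\<forall>Q\<in>set Qs. degree Q > 0"
        "prod_list Qs dvd (monom 1 n - 1 :: 'c poly)" by blast
    obtain b where b: "n \<ge> 1" "b ^ n = a" using n by (auto simp: N_def)
    have "b \<noteq> 0" using a(1) b by auto
    let ?l = "[:0, inverse b:]"
    have "prod_list (map (\<lambda>Q. pcompose Q ?l) Rs) = pcompose (prod_list Rs) ?l" for Rs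
      by (induction Rs) (simp_all add: pcompose_1 pcompose_mult)
    moreover have "subst_power n [:- a, 1:] = smult a (pcompose (monom 1 n - 1) ?l)"
    proof (rule poly_eqI)
      fix i
      have "subst_power n [:- a, 1:] = monom 1 n - [:a:]"
        by (simp add: subst_power_def pcompose_pCons)
      moreover have "a * inverse b ^ n = 1" using a(1) by (simp add: power_inverse b(2))
      moreover have "coeff [:a:] i = (if i = 0 then a else 0)" "coeff (1 :: 'c poly) i = (if i = 0 then 1 else 0)"
        by (cases i; simp)+
      ultimately show "coeff (subst_power n [:- a, 1:]) i = coeff (smult a (pcompose (monom 1 n - 1) ?l)) i"
        using b(1) by (auto simp: coeff_pcompose_linear)
    qed
    moreover obtain S where "monom 1 n - 1 = prod_list Qs * S" using Qs(3) by (elim dvdE)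
    then have "pcompose (prod_list Qs) ?l dvd pcompose (monom 1 n - 1) ?l"
      by (simp only: pcompose_mult dvd_triv_left)
    ultimately have "prod_list (map (\<lambda>Q. pcompose Q ?l) Qs) dvd subst_power n [:- a, 1:]"
      by (simp only: dvd_smult)
    then have "length (map (\<lambda>Q. pcompose Q ?l) Qs) \<le> r"
      using Qs(2) \<open>b \<noteq> 0\<close> by (intro factors_at_mostD[OF r[OF b(1)]])
        (auto simp: polys_over_def degree_pcompose)
    then show False using Qs(1) by simp
  qed
  then show "rootless_elem a" using a by (simp add: rootless_elem_def N_def)
qed

text \<open>If $z^w = 1$ for all roots of unity, then $x^n = z a$ implies $x^{nw} = a^w$.\<close>

lemma rootless_modtor_if_finite_torsion:
  assumes rl: "rootless TYPE('c::field)" and fin: "finite {z :: 'c. root_of_unity z}"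
  shows "rootless_modtor TYPE('c)"
  unfolding rootless_modtor_def
proof (intro allI impI)
  fix a :: 'c assume a: "a \<noteq> 0" "\<not> root_of_unity a"
  obtain w where w: "w \<ge> 1" "\<And>z :: 'c. root_of_unity z \<Longrightarrow> z ^ w = 1"
    using common_exponent[OF fin] by blast
  have "a ^ w \<noteq> 0" "\<not> root_of_unity (a ^ w)" using a root_of_unity_of_power[OF w(1)] by auto
  then have fin: "finite {n. n \<ge> 1 \<and> (\<exists>x. x ^ n = a ^ w)}" (is "finite ?N")
    using rl unfolding rootless_def rootless_elem_def by blast
  have "n \<le> Max ?N" if "n \<ge> 1" "root_of_unity z" "x ^ n = z * a" for n z x
  proof -
    have "x ^ (n * w) = a ^ w" by (simp add: power_mult that(3) power_mult_distrib w(2)[OF that(2)])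
    then have "n * w \<in> ?N" using that(1) w(1) by auto
    then have "n * w \<le> Max ?N" by (rule Max_ge[OF fin])
    then show ?thesis using mult_le_mono2[OF w(1), of n] by linarith
  qed
  then have "{n. n \<ge> 1 \<and> (\<exists>z. root_of_unity z \<and> (\<exists>x. x ^ n = z * a))} \<subseteq> {..Max ?N}" by blast
  then show "rootless_modtor_elem a"
    using a finite_subset unfolding rootless_modtor_elem_def by blast
qed

lemma number_field_properties:
  assumes "number_field TYPE('c::field)"
  shows "good_heredity TYPE('c)" "finite {z :: 'c. root_of_unity z}"
proof -
  obtain h :: "rat \<Rightarrow> 'c" where h: "field_embedding h" and "finite_over (range h)"
    using assms unfolding number_field_def by blast
  then obtain B where B: "finite B" "UNIV \<subseteq> span_over (range h) B" by (auto simp: finite_over_iff)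
  have "is_subfield hull (range h \<union> B) = UNIV"
    by (rule hull_eq_UNIV_if_finite_over[OF hull_subset B(2)])
  then have "finitely_generated_extension h"
    using h B(1) unfolding finitely_generated_extension_def by blast
  then show "good_heredity TYPE('c)" by (rule good_heredity_finitely_generated[OF good_heredity_rat])
  have "is_subfield (UNIV :: 'c set)" by (simp add: is_subfield_def)
  from finite_torsion_finite_extension[OF h this B] show "finite {z :: 'c. root_of_unity z}" by simp
qed

lemma finite_polys_over:
  assumes "finite k"
  shows "finite {p \<in> polys_over k. degree p \<le> D}"
proof (rule finite_subset)
  let ?L = "{xs. set xs \<subseteq> k \<and> length xs \<le> Suc D}"
  show "finite (Poly ` ?L)" by (intro finite_imageI finite_lists_length_le assms)
  show "{p \<in> polys_over k. degree p \<le> D} \<subseteq> Poly ` ?L"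
  proof
    fix p assume p: "p \<in> {p \<in> polys_over k. degree p \<le> D}"
    have "set (coeffs p) \<subseteq> k" using p by (auto simp: coeffs_def polys_over_def)
    moreover have "length (coeffs p) \<le> Suc D"
      using p by (cases "p = 0") (auto simp: length_coeffs_degree)
    moreover have "p = Poly (coeffs p)" by simp
    ultimately show "p \<in> Poly ` ?L" by blast
  qed
qed

lemma poly_poly_const: "poly (poly A [:t:]) z = poly (map_poly (\<lambda>p. poly p z) A) t"
  by (induction A) (simp_all add: map_poly_pCons)

text \<open>A root of unity $z$ is a root of a nonzero polynomial over $k(t)$ of bounded degree. After clearing
denominators this is a polynomial in $t$ whose coefficients are values at $z$ of polynomials over $k$
of bounded degree. Since $t$ is transcendental over the finite field $k(z)$, all these values are zero, and $z$
is a root of one of finitely many nonzero polynomials over $k$.\<close>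

lemma finite_torsion_function_field:
  fixes t :: "'c::field"
  assumes k: "is_subfield k" "finite k" and t: "\<not> algebraic_over k t"
    and B: "finite B" "UNIV \<subseteq> span_over (is_subfield hull (insert t k)) B"
  shows "finite {z :: 'c. root_of_unity z}"
proof (rule finite_subset)
  define D where "D = Suc (card B)"
  define G where "G = {p \<in> polys_over k. degree p \<le> D} - {0}"
  have "finite G" unfolding G_def by (intro finite_Diff finite_polys_over k)
  then show "finite (\<Union>p\<in>G. {z. poly p z = 0})"
    by (intro finite_UN_I poly_roots_finite) (auto simp: G_def)
  show "{z. root_of_unity z} \<subseteq> (\<Union>p\<in>G. {z. poly p z = 0})"
  proof
    fix z :: 'c assume "z \<in> {z. root_of_unity z}"
    then obtain j where j: "j \<ge> 1" "z ^ Suc j = z" using torsion_iff[of z] by blast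
    then have z: "algebraic_over k z"
      using torsion_poly_over[OF k(1), of j] torsion_poly_nonzero[OF j(1)] poly_torsion_poly[of j z]
      unfolding algebraic_over_iff by blast
    obtain T where T: "T \<in> polys_over (is_subfield hull (insert t k))" "T \<noteq> 0" "degree T \<le> card B"
        "poly T z = 0"
      using algebraic_if_powers_in_span[OF subfield_hull B(1)] B(2) by (metis UNIV_I subsetD)
    obtain d A where dA: "poly d t \<noteq> 0" "A \<in> bivariate_over k"
        "poly A [:t:] = smult (poly d t) T" "\<And>j. degree (coeff A j) \<le> length (coeffs T)"
      using clear_denominators[OF k(1) T(1)] by blast
    have degA: "degree (coeff A j) \<le> D" for j
      using dA(4)[of j] T(2,3) by (simp add: length_coeffs_degree D_def)
    \<comment> \<open>Substituting $z$ for $x$ first gives a polynomial over $k(z)$ that vanishes at $t$.\<close>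
    define p where "p = map_poly (\<lambda>p. poly p z) A"
    let ?k' = "is_subfield hull (insert z k)"
    have sub: "k \<subseteq> ?k'" "z \<in> ?k'" using hull_subset[of "insert z k"] by auto
    have fin: "finite ?k'" by (rule finite_simple_extension[OF k z])
    have "p \<in> polys_over ?k'"
    proof (rule polys_overI)
      fix i
      have "coeff A i \<in> polys_over ?k'"
        using dA(2) polys_over_mono[OF sub(1)] by (auto simp: bivariate_over_def)
      then show "coeff p i \<in> ?k'"
        using poly_in_subfield[OF subfield_hull _ sub(2)] by (simp add: p_def coeff_map_poly)
    qed
    moreover have "poly p t = 0"
      by (simp add: p_def poly_poly_const[symmetric] dA(3) T(4))
    moreover have "\<not> algebraic_over ?k' t"
    proof
      assume "algebraic_over ?k' t"
      then have "t = 0 \<or> root_of_unity t" by (rule algebraic_over_finite_imp_torsion[OF subfield_hull fin])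
      then obtain i where i: "i \<ge> 1" "t ^ Suc i = t" using torsion_iff[of t] by blast
      then have "algebraic_over k t"
        using torsion_poly_over[OF k(1), of i] torsion_poly_nonzero[OF i(1)] poly_torsion_poly[of i t]
        unfolding algebraic_over_iff by blast
      with t show False ..
    qed
    ultimately have "p = 0" by (auto simp: algebraic_over_iff)
    then have root: "poly (coeff A i) z = 0" for i
      by (metis coeff_0 coeff_map_poly p_def poly_0)
    have "A \<noteq> 0" using dA T(2) by auto
    then have "lead_coeff A \<in> G"
      using dA(2) degA by (simp add: G_def bivariate_over_def)
    then show "z \<in> (\<Union>p\<in>G. {z. poly p z = 0})" using root by blast
  qed
qed

text \<open>The field is generated by finitely many elements over its finite subfield $k$.\<close>

lemma global_function_field_properties:
  assumes "global_function_field TYPE('c::field)"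
  shows "good_heredity TYPE('c)" "finite {z :: 'c. root_of_unity z}"
proof -
  obtain k :: "'c set" and t where k: "is_subfield k" "prime (card k)" and t: "\<not> algebraic_over k t"
    and "finite_over (is_subfield hull (insert t k))"
    using assms unfolding global_function_field_def by blast
  then obtain B where B: "finite B" "UNIV \<subseteq> span_over (is_subfield hull (insert t k)) B"
    by (auto simp: finite_over_iff)
  have fin: "finite k" using k(2) by (metis card.infinite not_prime_0)
  show "finite {z :: 'c. root_of_unity z}"
    by (rule finite_torsion_function_field[OF k(1) fin t B])
  let ?g = "to_ac :: 'c \<Rightarrow> 'c alg_closure"
  note g = field_embedding_to_ac[where 'a = 'c]
  note gk = subfield_image[OF g k(1)]
  have "good_heredity_in (?g ` k)"
    by (intro good_heredity_in_if_torsion algebraic_over_finite_imp_torsion[OF gk] finite_imageI fin)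
  then have "good_heredity_in (is_subfield hull (?g ` k \<union> ?g ` insert t B))"
    using B(1) by (intro good_heredity_in_finitely_generated[OF gk]) auto
  also have "is_subfield hull (?g ` k \<union> ?g ` insert t B) = ?g ` (is_subfield hull (k \<union> insert t B))"
    by (simp only: image_subfield_hull[OF g] image_Un)
  also have "is_subfield hull (k \<union> insert t B) = UNIV"
    using hull_eq_UNIV_if_finite_over[OF order.refl B(2)]
      hull_Un_left[of is_subfield "insert t k" B] by simp
  finally show "good_heredity TYPE('c)" using good_heredity_iff_range[OF g] by simp
qed

theorem proposition32:
  shows "(\<forall>p. prime p \<longrightarrow> is_Fp_alg_closure p TYPE('a::alg_closed_field) \<longrightarrow> good_heredity TYPE('a)) \<and>
         (good_heredity TYPE('b::alg_closed_field) \<longrightarrow> (\<exists>p. prime p \<and> is_Fp_alg_closure p TYPE('b))) \<and>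
         (global_field TYPE('c::field) \<longrightarrow>
            rootless TYPE('c) \<and> rootless_modtor TYPE('c) \<and> good_heredity TYPE('c)) \<and>
         (\<forall>h :: 'd::field \<Rightarrow> 'e::field. good_heredity TYPE('d) \<longrightarrow> finitely_generated_extension h \<longrightarrow>
            good_heredity TYPE('e))"
proof (intro conjI allI impI)
  show "good_heredity TYPE('a)" if "prime p" "is_Fp_alg_closure p TYPE('a)" for p
    using that by (rule good_heredity_Fp_alg_closure)
  show "\<exists>p. prime p \<and> is_Fp_alg_closure p TYPE('b)" if "good_heredity TYPE('b)"
    using that by (rule Fp_alg_closure_if_good_heredity)
  show "good_heredity TYPE('e)" if "good_heredity TYPE('d)" "finitely_generated_extension h"
    for h :: "'d \<Rightarrow> 'e"
    using that by (rule good_heredity_finitely_generated)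
next
  assume "global_field TYPE('c)"
  then have gh: "good_heredity TYPE('c)" and fin: "finite {z :: 'c. root_of_unity z}"
    using number_field_properties[where 'c = 'c] global_function_field_properties[where 'c = 'c]
    unfolding global_field_def by blast+
  show "good_heredity TYPE('c)" by (rule gh)
  show "rootless TYPE('c)" by (rule rootless_if_good_heredity[OF gh])
  then show "rootless_modtor TYPE('c)" by (rule rootless_modtor_if_finite_torsion[OF _ fin])
qed

end
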